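(* Let $u$ be the solution of $$u_t+uu_x-\mathcal I^{(\alpha)}u_{xx}=f\ \text{ in }(0,L)\times(0,T],\qquad u(0,t)=u(L,t)=0\ (0<t\le T),\qquad u(x,0)=u_0(x)\ (0\le x\le L),$$ with $u^n=u(\cdot,t_n)\in C^4([0,L])$ for $0\le n\le N$. Assume that $f^{n-1/2}$ is selected so that $$\Big\|f^{1/2}k_1-\int_{t_0}^{t_1}f(\cdot,t)\,dt\Big\|\le C\int_{t_0}^{t_1}t\,\|f'(\cdot,t)\|\,dt,\qquad \Big\|f^{n-1/2}k_n-\int_{t_{n-1}}^{t_n}f(\cdot,t)\,dt\Big\|\le Ck_n^2\int_{t_{n-1}}^{t_n}\|f''(\cdot,t)\|\,dt\quad(n\ge2),$$ and that, for some $\sigma>0$ and $\mathcal M>0$ and all $t>0$ (in $(0,T]$), $$t\|u_{xx}'(\cdot,t)\|+t^2\|u_{xx}''(\cdot,t)\|\le\mathcal M t^{\sigma-1},\qquad t\|f'(\cdot,t)\|+t^2\|f''(\cdot,t)\|\le\mathcal M t^{\sigma-1}.$$ If $h$ is sufficiently small, $k=o(h^{1/2})$ and $\gamma=\frac2\sigma$, then the implicit difference scheme $$\delta_tU_j^{1/2}+\nabla U_j^1\,\Delta_xU_j^1=I^{(\alpha)}\delta_x^2U_j^{1/2}+f_j^{1/2},\qquad 1\le j\le J-1,$$ $$\delta_tU_j^{n-1/2}+\nabla U_j^{n-1/2}\,\Delta_xU_j^{n-1/2}=I^{(\alpha)}\delta_x^2U_j^{n-1/2}+f_j^{n-1/2},\qquad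 1\le j\le J-1,\ 2\le n\le N,$$ $$U_j^0=u_0(x_j),\quad 1\le j\le J-1,\qquad U_0^n=U_J^n=0,\quad 1\le n\le N$$ has a unique solution. (That is: for any family of discretizations with $h\to0$ and $k/h^{1/2}\to0$, with $\gamma=2/\sigma$, there is $h_0>0$ such that the scheme has exactly one solution for every member of the family with $h<h_0$.)
   Context: Fix $L,T>0$, $0<\alpha<1$, $\beta(t)=t^{\alpha-1}/\Gamma(\alpha)$, and $\mathcal I^{(\alpha)}\varpi(t)=\int_0^t\beta(t-\zeta)\varpi(\zeta)\,d\zeta$. Primes denote derivatives in $t$. Grids: $J,N\in\mathbb{Z}^+$, $h=L/J$, $x_j=jh$ ($0\le j\le J$); temporal levels $0=t_0<t_1<\dots<t_N=T$, $k_n=t_n-t_{n-1}$, $t_{n-1/2}=\frac12(t_n+t_{n-1})$. The temporal mesh depends on a parameter $k>0$ and a grading exponent $\gamma\ge1$, and satisfies, with positive constants $\widetilde C_\gamma,\widetilde c_\gamma$ independent of $k$: $k_n\le\widetilde C_\gamma k\min\{1,t_n^{1-1/\gamma}\}$ for $n\ge1$; $t_1=k_1\ge\widetilde c_\gamma k^\gamma$; $t_n\le\widetilde C_\gamma t_{n-1}$ for $n\ge2$; and $0\le k_{n+1}-k_n\le\widetilde C_\gamma k^2\min\{1,t_n^{1-2/\gamma}\}$ for $n\ge2$. (Example: $t_n=(nk)^\gamma$, $k=T^{1/\gamma}/N$.) Time operators, for a sequence $W^0,\dots,W^N$: $\delta_tW^{n-1/2}=\frac{1}{k_n}(W^n-W^{n-1})$,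 $W^{n-1/2}=\frac12(W^n+W^{n-1})$ for $n\ge1$, and $$I^{(\alpha)}W^{n-1/2}=\widehat w_{n1}W^1k_1+\sum_{s=2}^{n}\widehat w_{ns}W^{s-1/2}k_s,\qquad \widehat w_{ns}=\frac{1}{k_nk_s}\int_{t_{n-1}}^{t_n}\int_{t_{s-1}}^{\min\{t,t_s\}}\beta(t-\zeta)\,d\zeta\,dt;$$ $I^{(\alpha)}\delta_x^2U_j^{n-1/2}$ means this expression with $W^m=\delta_x^2U_j^m$. Space operators, for $1\le j\le J-1$: $\Delta_xW_j=\frac{1}{2h}(W_{j+1}-W_{j-1})$, $\delta_x^2W_j=\frac{1}{h^2}(W_{j+1}-2W_j+W_{j-1})$, $\nabla W_j=\frac13(W_{j-1}+W_j+W_{j+1})$. $f_j^{n-1/2}$ are real numbers approximating $\frac1{k_n}\int_{t_{n-1}}^{t_n}f(x_j,t)\,dt$. Norm: $\|w\|=\big(h\sum_{s=1}^{J-1}w_s^2\big)^{1/2}$ for grid functions; applied to a function of $x$, it is taken on its grid values $w_s=w(x_s)$. $\mathcal M$, $\sigma$ and the constant $C$ in the assumptions on $f^{n-1/2}$ are independent of the step sizes. Standing regularity assumptions on $u$: $c_0=\max_{(x,t)\in[0,L]\times(0,T]}\{|u|,|u_x|\}<\infty$, and $u$ is smooth enough for the truncation errors of the scheme to obey the following bounds. With $u_j^n=u(x_j,t_n)$, let $\overline u_{xx}(x,t)=u_{xx}(x,t_1)$ for $t_0<t<t_1$ and $\overline u_{xx}(x,t)=\frac12(u_{xx}(x,t_n)+u_{xx}(x,t_{n-1}))$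 for $t_{n-1}<t<t_n$, $n\ge2$; let $$(R_1)_j^{n-1/2}=\frac1{k_n}\int_{t_{n-1}}^{t_n}f(x_j,t)\,dt-f_j^{n-1/2}+\frac1{k_n}\int_{t_{n-1}}^{t_n}\int_{t_0}^t\beta(t-s)\big[u_{xx}(x_j,s)-\overline u_{xx}(x_j,s)\big]ds\,dt,$$ and define $(R_2)_j^{n-1/2}$ by $\delta_tu_j^{1/2}+\nabla u_j^1\Delta_xu_j^1=I^{(\alpha)}\delta_x^2u_j^{1/2}+f_j^{1/2}+(R_1)_j^{1/2}+(R_2)_j^{1/2}$ and, for $2\le n\le N$, $\delta_tu_j^{n-1/2}+\nabla u_j^{n-1/2}\Delta_xu_j^{n-1/2}=I^{(\alpha)}\delta_x^2u_j^{n-1/2}+f_j^{n-1/2}+(R_1)_j^{n-1/2}+(R_2)_j^{n-1/2}$. Then $$|(R_2)_j^{1/2}|\le C\Big(k_1+h^2+\frac{t_1^\alpha-t_0^\alpha}{k_1\Gamma(\alpha+1)}h^2\Big),\qquad |(R_2)_j^{n-1/2}|\le C\Big(k_n^2+h^2+\frac{t_n^\alpha-t_{n-1}^\alpha}{k_n\Gamma(\alpha+1)}h^2\Big)\quad(2\le n\le N),$$ with $C$ independent of the step sizes. *)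

theory Defs
  imports "HOL-Analysis.Analysis" "HOL-Library.Landau_Symbols"
begin

text \<open>The continuous problem. Functions of space and time take the space variable first.\<close>

definition frac_kernel :: "real \<Rightarrow> real \<Rightarrow> real" where
  "frac_kernel \<alpha> t = t powr (\<alpha> - 1) / Gamma \<alpha>"

definition frac_integral :: "real \<Rightarrow> (real \<Rightarrow> real) \<Rightarrow> real \<Rightarrow> real" where
  "frac_integral \<alpha> w t = integral {0..t} (\<lambda>\<zeta>. frac_kernel \<alpha> (t - \<zeta>) * w \<zeta>)"

text \<open>At the final time the derivative is one-sided.\<close>

definition time_derivative :: "real \<Rightarrow> real \<Rightarrow> (real \<Rightarrow> real \<Rightarrow> real) \<Rightarrow> (real \<Rightarrow> real \<Rightarrow> real) \<Rightarrow> bool" where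
  "time_derivative L T g g' \<longleftrightarrow>
     (\<forall>x\<in>{0<..<L}. \<forall>t\<in>{0<..T}. ((\<lambda>s. g x s) has_real_derivative g' x t) (at t within {0<..T}))"

text \<open>The functions \<open>u_t\<close>, \<open>u_x\<close>, \<open>u_xx\<close> are the partial derivatives of \<open>u\<close>. The integrability
  clause says that the fractional integral in the equation exists; an integral that does not
  exist would have the value 0.\<close>

definition ibvp_solution ::
  "real \<Rightarrow> real \<Rightarrow> real \<Rightarrow> (real \<Rightarrow> real \<Rightarrow> real) \<Rightarrow> (real \<Rightarrow> real) \<Rightarrow>
   (real \<Rightarrow> real \<Rightarrow> real) \<Rightarrow> (real \<Rightarrow> real \<Rightarrow> real) \<Rightarrow> (real \<Rightarrow> real \<Rightarrow> real) \<Rightarrow> (real \<Rightarrow> real \<Rightarrow> real) \<Rightarrow> bool" where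
  "ibvp_solution L T \<alpha> f u0 u u_t u_x u_xx \<longleftrightarrow>
     time_derivative L T u u_t \<and>
     (\<forall>x\<in>{0..L}. \<forall>t\<in>{0<..T}. ((\<lambda>y. u y t) has_real_derivative u_x x t) (at x within {0..L})) \<and>
     (\<forall>x\<in>{0<..<L}. \<forall>t\<in>{0<..T}. ((\<lambda>y. u_x y t) has_real_derivative u_xx x t) (at x)) \<and>
     (\<forall>x\<in>{0<..<L}. \<forall>t\<in>{0<..T}.
        (\<lambda>\<zeta>. frac_kernel \<alpha> (t - \<zeta>) * u_xx x \<zeta>) absolutely_integrable_on {0..t} \<and>
        u_t x t + u x t * u_x x t - frac_integral \<alpha> (u_xx x) t = f x t) \<and>
     (\<forall>t\<in>{0<..T}. u 0 t = 0 \<and> u L t = 0) \<and>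
     (\<forall>x\<in>{0..L}. u x 0 = u0 x)"

text \<open>Class \<open>C\<^sup>m\<close> on a set (one-sided derivatives at the ends of a closed interval).\<close>

definition C_class_on :: "nat \<Rightarrow> real set \<Rightarrow> (real \<Rightarrow> real) \<Rightarrow> bool" where
  "C_class_on m S g \<longleftrightarrow>
     (\<exists>D :: nat \<Rightarrow> real \<Rightarrow> real.
        (\<forall>x\<in>S. D 0 x = g x) \<and>
        (\<forall>l<m. \<forall>x\<in>S. (D l has_real_derivative D (Suc l) x) (at x within S)) \<and>
        continuous_on S (D m))"

text \<open>The discretization. A mesh \<open>t\<close> gives the levels \<open>t 0, \<dots>, t N\<close>; a quantity with upper index
  \<open>n - 1/2\<close> is indexed by \<open>n\<close>. A grid function is written \<open>U n j\<close>, time level first.\<close>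

definition step :: "(nat \<Rightarrow> real) \<Rightarrow> nat \<Rightarrow> real" where
  "step t n = t n - t (n - 1)"

definition graded_mesh ::
  "real \<Rightarrow> real \<Rightarrow> real \<Rightarrow> real \<Rightarrow> real \<Rightarrow> nat \<Rightarrow> (nat \<Rightarrow> real) \<Rightarrow> bool" where
  "graded_mesh T Cg cg \<gamma> k N t \<longleftrightarrow>
     0 < N \<and> t 0 = 0 \<and> t N = T \<and> (\<forall>n\<in>{1..N}. t (n - 1) < t n) \<and>
     (\<forall>n\<in>{1..N}. step t n \<le> Cg * k * min 1 (t n powr (1 - 1 / \<gamma>))) \<and>
     cg * k powr \<gamma> \<le> t 1 \<and>
     (\<forall>n\<in>{2..N}. t n \<le> Cg * t (n - 1)) \<and>
     (\<forall>n. 2 \<le> n \<and> n < N \<longrightarrow>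
        0 \<le> step t (n + 1) - step t n \<and>
        step t (n + 1) - step t n \<le> Cg * k\<^sup>2 * min 1 (t n powr (1 - 2 / \<gamma>)))"

definition diff_t :: "(nat \<Rightarrow> real) \<Rightarrow> (nat \<Rightarrow> real) \<Rightarrow> nat \<Rightarrow> real" where
  "diff_t t W n = (W n - W (n - 1)) / step t n"

definition half_level :: "(nat \<Rightarrow> real) \<Rightarrow> nat \<Rightarrow> real" where
  "half_level W n = (W n + W (n - 1)) / 2"

definition quad_weight :: "real \<Rightarrow> (nat \<Rightarrow> real) \<Rightarrow> nat \<Rightarrow> nat \<Rightarrow> real" where
  "quad_weight \<alpha> t n s =
     1 / (step t n * step t s) *
     integral {t (n - 1)..t n}
       (\<lambda>\<tau>. integral {t (s - 1)..min \<tau> (t s)} (\<lambda>\<zeta>. frac_kernel \<alpha> (\<tau> - \<zeta>)))"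

definition frac_quad :: "real \<Rightarrow> (nat \<Rightarrow> real) \<Rightarrow> (nat \<Rightarrow> real) \<Rightarrow> nat \<Rightarrow> real" where
  "frac_quad \<alpha> t W n =
     quad_weight \<alpha> t n 1 * W 1 * step t 1 +
     (\<Sum>s=2..n. quad_weight \<alpha> t n s * half_level W s * step t s)"

definition diff_x :: "real \<Rightarrow> (nat \<Rightarrow> real) \<Rightarrow> nat \<Rightarrow> real" where
  "diff_x h W j = (W (j + 1) - W (j - 1)) / (2 * h)"

definition diff_xx :: "real \<Rightarrow> (nat \<Rightarrow> real) \<Rightarrow> nat \<Rightarrow> real" where
  "diff_xx h W j = (W (j + 1) - 2 * W j + W (j - 1)) / h\<^sup>2"

definition avg_x :: "(nat \<Rightarrow> real) \<Rightarrow> nat \<Rightarrow> real" where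
  "avg_x W j = (W (j - 1) + W j + W (j + 1)) / 3"

text \<open>The discrete nonlinear term: evaluated at level 1 in the first step, and at the half level
  \<open>n - 1/2\<close> in the step \<open>n \<ge> 2\<close>.\<close>

definition convection :: "real \<Rightarrow> (nat \<Rightarrow> nat \<Rightarrow> real) \<Rightarrow> nat \<Rightarrow> nat \<Rightarrow> real" where
  "convection h U n j =
     (if n = 1 then avg_x (U 1) j * diff_x h (U 1) j
      else avg_x (\<lambda>i. half_level (\<lambda>m. U m i) n) j * diff_x h (\<lambda>i. half_level (\<lambda>m. U m i) n) j)"

definition scheme_solution ::
  "real \<Rightarrow> nat \<Rightarrow> nat \<Rightarrow> real \<Rightarrow> (nat \<Rightarrow> real) \<Rightarrow> (real \<Rightarrow> real) \<Rightarrow> (nat \<Rightarrow> nat \<Rightarrow> real) \<Rightarrow>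
   (nat \<Rightarrow> nat \<Rightarrow> real) \<Rightarrow> bool" where
  "scheme_solution h J N \<alpha> t u0 fh U \<longleftrightarrow>
     (\<forall>n\<in>{1..N}. \<forall>j\<in>{1..J - 1}.
        diff_t t (\<lambda>m. U m j) n + convection h U n j =
        frac_quad \<alpha> t (\<lambda>m. diff_xx h (U m) j) n + fh n j) \<and>
     (\<forall>j\<in>{1..J - 1}. U 0 j = u0 (real j * h)) \<and>
     (\<forall>n\<in>{1..N}. U n 0 = 0 \<and> U n J = 0)"

text \<open>The unknowns of the scheme. The corner values \<open>U 0 0\<close> and \<open>U 0 J\<close> occur in none of
  its equations.\<close>

definition scheme_unknowns :: "nat \<Rightarrow> nat \<Rightarrow> (nat \<times> nat) set" where
  "scheme_unknowns J N = {0} \<times> {1..J - 1} \<union> {1..N} \<times> {0..J}"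

definition scheme_uniquely_solvable ::
  "real \<Rightarrow> nat \<Rightarrow> nat \<Rightarrow> real \<Rightarrow> (nat \<Rightarrow> real) \<Rightarrow> (real \<Rightarrow> real) \<Rightarrow> (nat \<Rightarrow> nat \<Rightarrow> real) \<Rightarrow> bool" where
  "scheme_uniquely_solvable h J N \<alpha> t u0 fh \<longleftrightarrow>
     (\<exists>U. scheme_solution h J N \<alpha> t u0 fh U \<and>
        (\<forall>V. scheme_solution h J N \<alpha> t u0 fh V \<longrightarrow>
           (\<forall>(n, j)\<in>scheme_unknowns J N. V n j = U n j)))"

definition grid_norm :: "real \<Rightarrow> nat \<Rightarrow> (nat \<Rightarrow> real) \<Rightarrow> real" where
  "grid_norm h J w = sqrt (h * (\<Sum>s=1..J - 1. (w s)\<^sup>2))"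

definition grid_norm_fun :: "real \<Rightarrow> nat \<Rightarrow> (real \<Rightarrow> real) \<Rightarrow> real" where
  "grid_norm_fun h J w = grid_norm h J (\<lambda>s. w (real s * h))"

text \<open>The interpolant of \<open>u_xx\<close> that is constant on each mesh interval: for \<open>s\<close> in the interval
  \<open>(t (n - 1), t n)\<close>, the least index is \<open>n\<close>. The values at the mesh points do not matter, since
  the interpolant is only integrated.\<close>

definition mesh_interpolant :: "(nat \<Rightarrow> real) \<Rightarrow> (real \<Rightarrow> real) \<Rightarrow> real \<Rightarrow> real" where
  "mesh_interpolant t v s =
     (let n = (LEAST n. s \<le> t n)
      in if n \<le> 1 then v (t 1) else (v (t n) + v (t (n - 1))) / 2)"

definition trunc1 ::
  "real \<Rightarrow> real \<Rightarrow> (nat \<Rightarrow> real) \<Rightarrow> (real \<Rightarrow> real \<Rightarrow> real) \<Rightarrow> (nat \<Rightarrow> nat \<Rightarrow> real) \<Rightarrow>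
   (real \<Rightarrow> real \<Rightarrow> real) \<Rightarrow> nat \<Rightarrow> nat \<Rightarrow> real" where
  "trunc1 h \<alpha> t f fh u_xx n j =
     1 / step t n * integral {t (n - 1)..t n} (f (real j * h)) - fh n j +
     1 / step t n * integral {t (n - 1)..t n}
       (\<lambda>\<tau>. integral {t 0..\<tau>}
          (\<lambda>s. frac_kernel \<alpha> (\<tau> - s) *
               (u_xx (real j * h) s - mesh_interpolant t (u_xx (real j * h)) s)))"

text \<open>\<open>trunc2\<close> is what remains when the grid values of \<open>u\<close> are inserted into the scheme.\<close>

definition trunc2 ::
  "real \<Rightarrow> real \<Rightarrow> (nat \<Rightarrow> real) \<Rightarrow> (real \<Rightarrow> real \<Rightarrow> real) \<Rightarrow> (nat \<Rightarrow> nat \<Rightarrow> real) \<Rightarrow>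
   (real \<Rightarrow> real \<Rightarrow> real) \<Rightarrow> (real \<Rightarrow> real \<Rightarrow> real) \<Rightarrow> nat \<Rightarrow> nat \<Rightarrow> real" where
  "trunc2 h \<alpha> t f fh u u_xx n j =
     (let v = (\<lambda>m i. u (real i * h) (t m))
      in diff_t t (\<lambda>m. v m j) n + convection h v n j
         - frac_quad \<alpha> t (\<lambda>m. diff_xx h (v m) j) n - fh n j - trunc1 h \<alpha> t f fh u_xx n j)"

definition trunc2_bound ::
  "real \<Rightarrow> real \<Rightarrow> nat \<Rightarrow> nat \<Rightarrow> real \<Rightarrow> (nat \<Rightarrow> real) \<Rightarrow> (real \<Rightarrow> real \<Rightarrow> real) \<Rightarrow>
   (nat \<Rightarrow> nat \<Rightarrow> real) \<Rightarrow> (real \<Rightarrow> real \<Rightarrow> real) \<Rightarrow> (real \<Rightarrow> real \<Rightarrow> real) \<Rightarrow> bool" where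
  "trunc2_bound C h J N \<alpha> t f fh u u_xx \<longleftrightarrow>
     (\<forall>j\<in>{1..J - 1}.
        \<bar>trunc2 h \<alpha> t f fh u u_xx 1 j\<bar> \<le>
          C * (step t 1 + h\<^sup>2 +
               (t 1 powr \<alpha> - t 0 powr \<alpha>) / (step t 1 * Gamma (\<alpha> + 1)) * h\<^sup>2)) \<and>
     (\<forall>n\<in>{2..N}. \<forall>j\<in>{1..J - 1}.
        \<bar>trunc2 h \<alpha> t f fh u u_xx n j\<bar> \<le>
          C * ((step t n)\<^sup>2 + h\<^sup>2 +
               (t n powr \<alpha> - t (n - 1) powr \<alpha>) / (step t n * Gamma (\<alpha> + 1)) * h\<^sup>2))"

text \<open>Here \<open>f'\<close> and \<open>f''\<close> are the first and second time derivatives of \<open>f\<close>.\<close>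

definition source_approx ::
  "real \<Rightarrow> real \<Rightarrow> nat \<Rightarrow> nat \<Rightarrow> (nat \<Rightarrow> real) \<Rightarrow> (real \<Rightarrow> real \<Rightarrow> real) \<Rightarrow>
   (real \<Rightarrow> real \<Rightarrow> real) \<Rightarrow> (real \<Rightarrow> real \<Rightarrow> real) \<Rightarrow> (nat \<Rightarrow> nat \<Rightarrow> real) \<Rightarrow> bool" where
  "source_approx C h J N t f f' f'' fh \<longleftrightarrow>
     grid_norm h J (\<lambda>j. fh 1 j * step t 1 - integral {t 0..t 1} (f (real j * h)))
       \<le> C * integral {t 0..t 1} (\<lambda>\<tau>. \<tau> * grid_norm_fun h J (\<lambda>x. f' x \<tau>)) \<and>
     (\<forall>n\<in>{2..N}.
        grid_norm h J (\<lambda>j. fh n j * step t n - integral {t (n - 1)..t n} (f (real j * h)))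
          \<le> C * (step t n)\<^sup>2 * integral {t (n - 1)..t n} (\<lambda>\<tau>. grid_norm_fun h J (\<lambda>x. f'' x \<tau>)))"

definition regularity_bound ::
  "real \<Rightarrow> real \<Rightarrow> real \<Rightarrow> real \<Rightarrow> nat \<Rightarrow> (real \<Rightarrow> real \<Rightarrow> real) \<Rightarrow> (real \<Rightarrow> real \<Rightarrow> real) \<Rightarrow> bool" where
  "regularity_bound M \<sigma> T h J g' g'' \<longleftrightarrow>
     (\<forall>\<tau>\<in>{0<..T}.
        \<tau> * grid_norm_fun h J (\<lambda>x. g' x \<tau>) + \<tau>\<^sup>2 * grid_norm_fun h J (\<lambda>x. g'' x \<tau>)
          \<le> M * \<tau> powr (\<sigma> - 1))"

end

theory Submission
  imports Defs
begin

text \<open>Existence is a consequence of coercivity. In every step the unknown can be taken to be the vector at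
  which the nonlinear and the diffusive term are evaluated. The nonlinear term is orthogonal to this vector
  (\<open>convect_skew\<close>), so the step equation asks for a zero of a coercive map on a finite-dimensional space
  (\<open>coercive_box_zero\<close>, \<open>implicit_step_solvable\<close>).

  Uniqueness is proved level by level. If two solutions \<open>U\<close> and \<open>V\<close> agree below level \<open>n\<close> and
  \<open>z = mid V n - mid U n\<close> is the difference of the unknowns of step \<open>n\<close>, testing the difference of the two equations with \<open>z\<close> gives
  \<open>\<parallel>z\<parallel>\<^sup>2 / k\<^sub>n + q |z|\<^sup>2 \<le> K \<parallel>z\<parallel> |z|\<close>, where \<open>|z|\<close> is the discrete \<open>H\<^sup>1\<close> seminorm, \<open>K\<close> bounds the
  maximum of one of the solutions, and \<open>q = k\<^sub>n\<^sup>\<alpha> / \<Gamma>(\<alpha> + 2)\<close> comes from the last quadrature weight. Since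
  \<open>\<alpha> < 1\<close>, the quotient \<open>q / k\<^sub>n\<close> exceeds \<open>K\<^sup>2 / 4\<close> for small \<open>k\<close>, and then \<open>z = 0\<close>
  (\<open>scheme_solution_unique\<close>).

  The bound \<open>K\<close> must not depend on the grid, and it comes from convergence to \<open>u\<close>. On a grid of width \<open>h\<close>
  the maximum is at most \<open>h\<^sup>-\<^sup>1\<^sup>/\<^sup>2\<close> times the norm, so an error of size \<open>O(k + h\<^sup>2)\<close> in the norm is enough
  once \<open>k = o(h\<^sup>1\<^sup>/\<^sup>2)\<close>. This is why accuracy of first order in time is enough: the smoothing part \<open>q |z|\<^sup>2\<close> of the
  uniqueness estimate asks only for a bounded maximum. The error estimate (\<open>scheme_error_bound\<close>) is an energy argument. The
  quadratic form of the fractional quadrature is nonnegative (\<open>quad_area_positive\<close>), because the kernel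
  \<open>|t - s|\<^sup>\<alpha>\<^sup>-\<^sup>1\<close> is a multiple of \<open>\<integral> g(t - y) g(s - y) dy\<close> with \<open>g(r) = r\<^sup>\<alpha>\<^sup>/\<^sup>2\<^sup>-\<^sup>1\<close> for \<open>r > 0\<close> and \<open>g(r) = 0\<close> otherwise. The nonlinear
  terms cost only the Lipschitz constant of \<open>u\<close> (\<open>convect_bound_Lipschitz\<close>). The residual is bounded in
  \<open>residual_pairing\<close> and \<open>sum_residual_bound\<close>: by the grading \<open>\<gamma> = 2/\<sigma>\<close> the interpolation error of
  \<open>u\<^sub>x\<^sub>x\<close> at time \<open>s\<close> is at most a multiple of \<open>k s\<^sup>\<sigma>\<^sup>/\<^sup>2\<^sup>-\<^sup>1\<close>, which is integrable.\<close>

section \<open>Grid functions with zero boundary values\<close>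

definition grid_inner :: "real \<Rightarrow> nat \<Rightarrow> (nat \<Rightarrow> real) \<Rightarrow> (nat \<Rightarrow> real) \<Rightarrow> real" where
  "grid_inner h J a b = h * (\<Sum>j=1..J - 1. a j * b j)"

text \<open>The discrete \<open>H\<^sup>1\<close> seminorm, that is, the norm of the forward difference quotient.\<close>

definition grid_seminorm :: "real \<Rightarrow> nat \<Rightarrow> (nat \<Rightarrow> real) \<Rightarrow> real" where
  "grid_seminorm h J w = sqrt ((\<Sum>j<J. (w (j + 1) - w j)\<^sup>2) / h)"

text \<open>The nonlinear term of a single grid function; in the scheme it is applied to the grid function \<open>mid U n\<close> below.\<close>

definition convect :: "real \<Rightarrow> (nat \<Rightarrow> real) \<Rightarrow> nat \<Rightarrow> real" where
  "convect h W j = avg_x W j * diff_x h W j"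

lemma grid_norm_nonneg: "0 \<le> h \<Longrightarrow> 0 \<le> grid_norm h J w"
  by (simp add: grid_norm_def sum_nonneg)

lemma grid_norm_sq: "0 \<le> h \<Longrightarrow> (grid_norm h J w)\<^sup>2 = grid_inner h J w w"
  by (simp add: grid_norm_def grid_inner_def sum_nonneg power2_eq_square)

lemma grid_norm_L2_set: "grid_norm h J w = sqrt h * L2_set w {1..J - 1}"
  by (simp add: grid_norm_def L2_set_def real_sqrt_mult)

lemma grid_norm_scale: "grid_norm h J (\<lambda>j. c * w j) = \<bar>c\<bar> * grid_norm h J w"
proof -
  have "h * (\<Sum>s=1..J - 1. (c * w s)\<^sup>2) = c\<^sup>2 * (h * (\<Sum>s=1..J - 1. (w s)\<^sup>2))"
    by (simp add: power_mult_distrib sum_distrib_left mult_ac)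
  then have "grid_norm h J (\<lambda>j. c * w j) = sqrt (c\<^sup>2 * (h * (\<Sum>s=1..J - 1. (w s)\<^sup>2)))"
    unfolding grid_norm_def by (rule arg_cong)
  then show ?thesis unfolding grid_norm_def by (metis real_sqrt_abs real_sqrt_mult)
qed

lemma grid_norm_triangle:
  assumes "0 \<le> h"
  shows "grid_norm h J (\<lambda>j. a j + b j) \<le> grid_norm h J a + grid_norm h J b"
  using mult_left_mono[OF L2_set_triangle_ineq[of a b "{1..J - 1}"], of "sqrt h"] assms
  by (simp add: grid_norm_L2_set algebra_simps)

lemma grid_norm_mono:
  assumes "0 \<le> h" "\<And>j. j \<in> {1..J - 1} \<Longrightarrow> \<bar>a j\<bar> \<le> \<bar>b j\<bar>"
  shows "grid_norm h J a \<le> grid_norm h J b"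
  unfolding grid_norm_def using assms
  by (intro real_sqrt_le_mono mult_left_mono sum_mono) (auto simp: abs_le_square_iff)

lemma grid_norm_le_const:
  assumes "0 < J" "h = L / real J" "0 < L" "0 \<le> c" "\<And>j. j \<in> {1..J - 1} \<Longrightarrow> \<bar>a j\<bar> \<le> c"
  shows "grid_norm h J a \<le> sqrt L * c"
proof -
  have h: "0 < h" using assms by simp
  have "(\<Sum>j=1..J - 1. (a j)\<^sup>2) \<le> (\<Sum>j=1..J - 1. c\<^sup>2)"
    using assms(4,5) by (intro sum_mono) (metis abs_ge_zero power2_abs power_mono)
  also have "\<dots> \<le> real J * c\<^sup>2" using assms(1) by (simp add: mult_right_mono)
  finally have "h * (\<Sum>j=1..J - 1. (a j)\<^sup>2) \<le> h * (real J * c\<^sup>2)"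
    using h by (intro mult_left_mono) auto
  also have "\<dots> = L * c\<^sup>2" using assms(1,2) by simp
  finally have "grid_norm h J a \<le> sqrt (L * c\<^sup>2)" by (simp add: grid_norm_def)
  then show ?thesis using assms(4) by (simp add: real_sqrt_mult)
qed

lemma grid_value_le_norm:
  assumes "0 < h" "j \<in> {1..J - 1}"
  shows "sqrt h * \<bar>w j\<bar> \<le> grid_norm h J w"
proof -
  have "\<bar>w j\<bar> \<le> L2_set (\<lambda>j. \<bar>w j\<bar>) {1..J - 1}"
    using member_le_L2_set[of "{1..J - 1}" j "\<lambda>j. \<bar>w j\<bar>"] assms(2) by simp
  then show ?thesis using assms(1) by (simp add: grid_norm_L2_set L2_set_def mult_left_mono)
qed

lemma grid_inner_add_left:
  "grid_inner h J (\<lambda>j. a j + b j) c = grid_inner h J a c + grid_inner h J b c"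
  by (simp add: grid_inner_def sum.distrib algebra_simps)

lemma grid_inner_scale_left: "grid_inner h J (\<lambda>j. c * a j) b = c * grid_inner h J a b"
  by (simp add: grid_inner_def sum_distrib_left mult_ac)

lemma grid_inner_diff_left:
  "grid_inner h J (\<lambda>j. a j - b j) c = grid_inner h J a c - grid_inner h J b c"
  by (simp add: grid_inner_def sum_subtractf algebra_simps)

lemma grid_inner_cong:
  "(\<And>j. j \<in> {1..J - 1} \<Longrightarrow> a j = b j) \<Longrightarrow> grid_inner h J a c = grid_inner h J b c"
  by (simp add: grid_inner_def)

lemma grid_inner_Cauchy_Schwarz:
  assumes "0 \<le> h"
  shows "\<bar>grid_inner h J a b\<bar> \<le> grid_norm h J a * grid_norm h J b"
proof -
  have "(\<Sum>j=1..J - 1. a j * b j)\<^sup>2 \<le> (\<Sum>j=1..J - 1. (a j)\<^sup>2) * (\<Sum>j=1..J - 1. (b j)\<^sup>2)"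
    by (rule Cauchy_Schwarz_ineq_sum)
  then have "\<bar>\<Sum>j=1..J - 1. a j * b j\<bar> \<le> sqrt ((\<Sum>j=1..J - 1. (a j)\<^sup>2) * (\<Sum>j=1..J - 1. (b j)\<^sup>2))"
    by (metis real_sqrt_abs real_sqrt_le_iff)
  then have "h * \<bar>\<Sum>j=1..J - 1. a j * b j\<bar> \<le> h * (sqrt (\<Sum>j=1..J - 1. (a j)\<^sup>2) * sqrt (\<Sum>j=1..J - 1. (b j)\<^sup>2))"
    using assms by (intro mult_left_mono) (simp_all add: real_sqrt_mult)
  also have "\<dots> = grid_norm h J a * grid_norm h J b"
    using assms by (simp add: grid_norm_def real_sqrt_mult)
  finally show ?thesis using assms by (simp add: grid_inner_def abs_mult)
qed

lemma grid_inner_le_weighted: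
  assumes "0 \<le> h" "\<And>j. j \<in> {1..J - 1} \<Longrightarrow> 0 \<le> a j"
  shows "h * (\<Sum>j=1..J - 1. \<bar>z j\<bar> * a j) \<le> grid_norm h J z * grid_norm h J a"
  using order_trans[OF abs_ge_self grid_inner_Cauchy_Schwarz[OF assms(1), of J "\<lambda>j. \<bar>z j\<bar>" a]]
  by (simp add: grid_inner_def grid_norm_def)

lemma sum_by_parts:
  fixes d z :: "nat \<Rightarrow> real"
  shows "(\<Sum>j=1..m. (d j - d (j - 1)) * z j) + (\<Sum>j<Suc m. d j * (z (j + 1) - z j)) = d m * z (m + 1) - d 0 * z 0"
  by (induction m) (simp_all add: algebra_simps)

lemma sum_diff_telescope:
  fixes g :: "nat \<Rightarrow> real"
  shows "(\<Sum>j=1..m. g (j + 1) - g j) = g (m + 1) - g 1"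
  by (induction m) simp_all

lemma grid_inner_diff_xx:
  assumes "0 < J" "h \<noteq> 0" "z 0 = 0" "z J = 0"
  shows "grid_inner h J (diff_xx h w) z = - (\<Sum>j<J. (w (j + 1) - w j) * (z (j + 1) - z j)) / h"
proof -
  obtain m where J: "J = Suc m" using assms(1) by (cases J) auto
  let ?d = "\<lambda>j. w (j + 1) - w j"
  have "grid_inner h J (diff_xx h w) z = (\<Sum>j=1..m. (?d j - ?d (j - 1)) * z j) / h"
    unfolding grid_inner_def J sum_distrib_left sum_divide_distrib using assms(2)
    by (intro sum.cong refl) (auto simp: diff_xx_def power2_eq_square field_simps)
  then show ?thesis
    using sum_by_parts[of ?d z m] assms(3,4) unfolding J by (simp add: field_simps)
qed

lemma grid_seminorm_sq:
  "0 < h \<Longrightarrow> (grid_seminorm h J w)\<^sup>2 = (\<Sum>j<J. (w (j + 1) - w j) * (w (j + 1) - w j)) / h"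
  by (simp add: grid_seminorm_def sum_nonneg power2_eq_square)

lemma grid_seminorm_nonneg: "0 < h \<Longrightarrow> 0 \<le> grid_seminorm h J w"
  by (simp add: grid_seminorm_def sum_nonneg)

text \<open>Up to the factor \<open>6 h\<close> the summand is \<open>(x\<^sub>j\<^sub>-\<^sub>1 + x\<^sub>j + x\<^sub>j\<^sub>+\<^sub>1) (x\<^sub>j\<^sub>+\<^sub>1 - x\<^sub>j\<^sub>-\<^sub>1) x\<^sub>j\<close>, which is the increment of
  \<open>x\<^sub>j x\<^sub>j\<^sub>-\<^sub>1 (x\<^sub>j + x\<^sub>j\<^sub>-\<^sub>1)\<close> from \<open>j\<close> to \<open>j + 1\<close>. This is the purpose of the average over three points.\<close>

lemma convect_skew:
  assumes "0 < J" "x 0 = 0" "x J = 0"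
  shows "grid_inner h J (convect h x) x = 0"
proof -
  obtain m where J: "J = Suc m" using assms(1) by (cases J) auto
  define g where "g j = x j * x (j - 1) * (x j + x (j - 1)) / (6 * h)" for j
  have "grid_inner h J (convect h x) x = h * (\<Sum>j=1..m. g (j + 1) - g j)"
    unfolding grid_inner_def J
    by (intro arg_cong[where f = "\<lambda>x. h * x"] sum.cong)
       (auto simp: convect_def avg_x_def diff_x_def g_def algebra_simps add_divide_distrib diff_divide_distrib)
  also have "\<dots> = 0"
    unfolding sum_diff_telescope using assms(2,3) by (simp add: g_def J)
  finally show ?thesis .
qed

text \<open>The part of \<open>convect_skew\<close> that is quadratic in \<open>z\<close> and linear in \<open>V\<close>. It removes all differences
  of \<open>V\<close> from the energy identity and leaves \<open>V\<close> as a plain weight.\<close>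

lemma convect_polarized:
  assumes "0 < J" "V 0 = 0" "V J = 0" "z 0 = 0" "z J = 0"
  shows "grid_inner h J (\<lambda>j. convect h (\<lambda>i. V i + z i) j - convect h V j) z = - grid_inner h J (convect h z) V"
proof -
  let ?S = "\<lambda>x. grid_inner h J (convect h x) x"
  \<comment> \<open>The odd part in \<open>V\<close> of the cubic form at \<open>z + V\<close> consists of the cubic form of \<open>V\<close> and of the
    terms that are linear in \<open>V\<close>.\<close>
  have "grid_inner h J (\<lambda>j. convect h (\<lambda>i. V i + z i) j - convect h V j) z + grid_inner h J (convect h z) V
     = (?S (\<lambda>i. z i + V i) - ?S (\<lambda>i. z i - V i)) / 2 - ?S V + ?S z"
    unfolding grid_inner_def right_diff_distrib[symmetric] distrib_left[symmetric] sum_subtractf[symmetric]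
        sum.distrib[symmetric] times_divide_eq_right[symmetric] sum_divide_distrib
    by (intro arg_cong[where f = "\<lambda>x. h * x"] sum.cong refl)
       (simp add: convect_def avg_x_def diff_x_def divide_simps, simp add: algebra_simps)
  also have "\<dots> = 0" using assms by (simp add: convect_skew)
  finally show ?thesis by simp
qed

lemma grid_sum_shift_le:
  fixes a :: "nat \<Rightarrow> real"
  assumes "\<And>j. 0 \<le> a j" "a 0 = 0" "a (Suc m) = 0"
  shows "(\<Sum>j=1..m. a (j - 1)) \<le> (\<Sum>j=1..m. a j)" "(\<Sum>j=1..m. a (j + 1)) \<le> (\<Sum>j=1..m. a j)"
proof -
  have "(\<Sum>j=1..m. a (j - 1)) + a m = (\<Sum>j=1..m. a j)" using assms(2) by (induction m) simp_all
  then show "(\<Sum>j=1..m. a (j - 1)) \<le> (\<Sum>j=1..m. a j)" using assms(1)[of m] by linarith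
  have "(\<Sum>j=1..m. a (j + 1)) + a 1 = (\<Sum>j=1..m. a j) + a (Suc m)" by (induction m) simp_all
  then show "(\<Sum>j=1..m. a (j + 1)) \<le> (\<Sum>j=1..m. a j)" using assms(1)[of 1] assms(3) by linarith
qed

lemma grid_norm_avg_x_le:
  assumes "0 < J" "0 \<le> h" "z 0 = 0" "z J = 0"
  shows "grid_norm h J (avg_x z) \<le> grid_norm h J z"
proof -
  obtain m where J: "J = Suc m" using assms(1) by (cases J) auto
  have pt: "(avg_x z j)\<^sup>2 \<le> ((z (j - 1))\<^sup>2 + (z j)\<^sup>2 + (z (j + 1))\<^sup>2) / 3" for j
  proof -
    have "0 \<le> (z (j - 1) - z j)\<^sup>2 + (z j - z (j + 1))\<^sup>2 + (z (j - 1) - z (j + 1))\<^sup>2" by simp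
    then show ?thesis by (simp add: avg_x_def power2_eq_square field_simps)
  qed
  have "(\<Sum>j=1..m. (avg_x z j)\<^sup>2) \<le> (\<Sum>j=1..m. ((z (j - 1))\<^sup>2 + (z j)\<^sup>2 + (z (j + 1))\<^sup>2) / 3)"
    by (intro sum_mono pt)
  also have "\<dots> = ((\<Sum>j=1..m. (z (j - 1))\<^sup>2) + (\<Sum>j=1..m. (z j)\<^sup>2) + (\<Sum>j=1..m. (z (j + 1))\<^sup>2)) / 3"
    by (simp add: sum_divide_distrib[symmetric] sum.distrib)
  also have "\<dots> \<le> (\<Sum>j=1..m. (z j)\<^sup>2)"
    using grid_sum_shift_le[of "\<lambda>j. (z j)\<^sup>2" m] assms(3,4) J by simp
  finally show ?thesis unfolding grid_norm_def J using assms(2) by (simp add: mult_left_mono)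
qed

lemma grid_norm_diff_x_le:
  assumes "0 < J" "0 < h"
  shows "grid_norm h J (diff_x h z) \<le> grid_seminorm h J z"
proof -
  obtain m where J: "J = Suc m" using assms(1) by (cases J) auto
  define d where "d j = (z (j + 1) - z j)\<^sup>2" for j
  have pt: "(diff_x h z j)\<^sup>2 \<le> (d (j - 1) + d j) / (2 * h\<^sup>2)" if "j \<in> {1..m}" for j
  proof -
    have "0 \<le> ((z (j + 1) - z j) - (z j - z (j - 1)))\<^sup>2" by simp
    then have "(z (j + 1) - z (j - 1))\<^sup>2 \<le> 2 * (d (j - 1) + d j)"
      using that by (simp add: d_def power2_eq_square algebra_simps)
    then show ?thesis using assms(2)
      by (simp add: diff_x_def power_divide power_mult_distrib field_simps)
  qed
  have s1: "(\<Sum>j=1..m. d (j - 1)) + d m = (\<Sum>j<J. d j)"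
    unfolding J by (induction m) simp_all
  have s2: "(\<Sum>j=1..m. d j) + d 0 = (\<Sum>j<J. d j)"
    unfolding J by (induction m) simp_all
  have "(\<Sum>j=1..m. (diff_x h z j)\<^sup>2) \<le> (\<Sum>j=1..m. (d (j - 1) + d j) / (2 * h\<^sup>2))"
    by (intro sum_mono pt)
  also have "\<dots> = ((\<Sum>j=1..m. d (j - 1)) + (\<Sum>j=1..m. d j)) / (2 * h\<^sup>2)"
    by (simp add: sum_divide_distrib[symmetric] sum.distrib)
  also have "\<dots> \<le> (2 * (\<Sum>j<J. d j)) / (2 * h\<^sup>2)"
    by (intro divide_right_mono) (use s1 s2 in \<open>auto simp: d_def intro: add_mono\<close>, smt (verit) zero_le_power2)
  finally have "h * (\<Sum>j=1..m. (diff_x h z j)\<^sup>2) \<le> h * ((2 * (\<Sum>j<J. d j)) / (2 * h\<^sup>2))"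
    using assms(2) by (intro mult_left_mono) auto
  also have "\<dots> = (\<Sum>j<J. d j) / h" using assms(2) by (simp add: power2_eq_square)
  finally show ?thesis unfolding grid_norm_def grid_seminorm_def d_def J by simp
qed

text \<open>For a weight \<open>V\<close> that is merely bounded, one difference of \<open>z\<close> remains; the smoothing of the
  last quadrature weight absorbs it in the proof of uniqueness.\<close>

lemma convect_bound_sup:
  assumes "0 < J" "0 < h" "z 0 = 0" "z J = 0" "\<And>j. j \<in> {1..J - 1} \<Longrightarrow> \<bar>V j\<bar> \<le> K" "0 \<le> K"
  shows "\<bar>grid_inner h J (convect h z) V\<bar> \<le> K * (grid_norm h J z * grid_seminorm h J z)"
proof -
  have "\<bar>grid_inner h J (convect h z) V\<bar> = \<bar>grid_inner h J (\<lambda>j. diff_x h z j * V j) (avg_x z)\<bar>"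
    by (simp add: grid_inner_def convect_def mult_ac)
  also have "\<dots> \<le> grid_norm h J (\<lambda>j. diff_x h z j * V j) * grid_norm h J (avg_x z)"
    using assms(2) by (intro grid_inner_Cauchy_Schwarz) simp
  also have "\<dots> \<le> (K * grid_seminorm h J z) * grid_norm h J z"
  proof (intro mult_mono)
    have "grid_norm h J (\<lambda>j. diff_x h z j * V j) \<le> grid_norm h J (\<lambda>j. K * diff_x h z j)"
      using assms(2,5,6) by (intro grid_norm_mono) (auto simp: abs_mult mult.commute intro!: mult_right_mono)
    also have "\<dots> \<le> K * grid_seminorm h J z"
      unfolding grid_norm_scale using grid_norm_diff_x_le[OF assms(1,2), of z] assms(6) by (simp add: mult_left_mono)
    finally show "grid_norm h J (\<lambda>j. diff_x h z j * V j) \<le> K * grid_seminorm h J z" .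
  qed (use assms in \<open>auto intro!: grid_norm_avg_x_le grid_norm_nonneg mult_nonneg_nonneg grid_seminorm_nonneg\<close>)
  finally show ?thesis by (simp add: mult_ac)
qed

text \<open>\<open>(z\<^sub>j\<^sub>-\<^sub>1 + z\<^sub>j + z\<^sub>j\<^sub>+\<^sub>1) (z\<^sub>j\<^sub>+\<^sub>1 - z\<^sub>j\<^sub>-\<^sub>1)\<close> is the increment of a nonnegative quadratic expression
  \<open>S\<close> in two neighbouring values, so summation by parts moves the difference onto \<open>V\<close>, and no
  difference of \<open>z\<close> is left.\<close>

lemma convect_bound_Lipschitz:
  assumes "0 < J" "0 < h" "z 0 = 0" "z J = 0" "V 0 = 0" "V J = 0"
    and lip: "\<And>j. j < J \<Longrightarrow> \<bar>V (j + 1) - V j\<bar> \<le> c * h"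
  shows "\<bar>grid_inner h J (convect h z) V\<bar> \<le> c / 2 * (grid_norm h J z)\<^sup>2"
proof -
  obtain m where J: "J = Suc m" using assms(1) by (cases J) auto
  define S where "S j = (z (j + 1))\<^sup>2 + (z j)\<^sup>2 + z (j + 1) * z j" for j
  have S0: "0 \<le> S j" "S j \<le> 3 / 2 * ((z (j + 1))\<^sup>2 + (z j)\<^sup>2)" for j
  proof -
    have "0 \<le> (z (j + 1) + z j)\<^sup>2 + ((z (j + 1))\<^sup>2 + (z j)\<^sup>2)" "0 \<le> (z (j + 1) - z j)\<^sup>2" by simp_all
    then show "0 \<le> S j" "S j \<le> 3 / 2 * ((z (j + 1))\<^sup>2 + (z j)\<^sup>2)"
      by (simp_all add: S_def power2_eq_square algebra_simps)
  qed
  have "6 * grid_inner h J (convect h z) V = (\<Sum>j=1..m. (S j - S (j - 1)) * V j)"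
    unfolding grid_inner_def J sum_distrib_left using assms(2)
    by (intro sum.cong refl)
       (auto simp: convect_def avg_x_def diff_x_def S_def power2_eq_square field_simps)
  also have "\<dots> = - (\<Sum>j<J. S j * (V (j + 1) - V j))"
    using sum_by_parts[of S V m] assms(5,6) J by simp
  finally have "6 * \<bar>grid_inner h J (convect h z) V\<bar> = \<bar>\<Sum>j<J. S j * (V (j + 1) - V j)\<bar>" by linarith
  also have "\<dots> \<le> (\<Sum>j<J. \<bar>S j * (V (j + 1) - V j)\<bar>)" by (rule sum_abs)
  also have "\<dots> \<le> (\<Sum>j<J. 3 / 2 * ((z (j + 1))\<^sup>2 + (z j)\<^sup>2) * (c * h))"
  proof (rule sum_mono)
    fix j assume "j \<in> {..<J}"
    then show "\<bar>S j * (V (j + 1) - V j)\<bar> \<le> 3 / 2 * ((z (j + 1))\<^sup>2 + (z j)\<^sup>2) * (c * h)"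
      unfolding abs_mult using S0[of j] lip[of j] by (intro mult_mono) auto
  qed
  also have "\<dots> = 3 / 2 * (c * h) * ((\<Sum>j<J. (z (j + 1))\<^sup>2) + (\<Sum>j<J. (z j)\<^sup>2))"
    unfolding sum.distrib[symmetric] sum_distrib_left by (intro sum.cong refl) (simp add: algebra_simps)
  also have "(\<Sum>j<J. (z (j + 1))\<^sup>2) = (\<Sum>j=1..J - 1. (z j)\<^sup>2) + (z J)\<^sup>2"
    unfolding J by (induction m) simp_all
  also have "(\<Sum>j<J. (z j)\<^sup>2) = (z 0)\<^sup>2 + (\<Sum>j=1..J - 1. (z j)\<^sup>2)"
    unfolding J by (induction m) simp_all
  finally show ?thesis
    unfolding grid_norm_sq[OF less_imp_le[OF assms(2)]] using assms(2-4)
    by (simp add: grid_inner_def power2_eq_square algebra_simps)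
qed

section \<open>Positivity of the fractional quadrature\<close>

lemma frac_kernel_nonneg: "0 < \<alpha> \<Longrightarrow> 0 \<le> frac_kernel \<alpha> x"
  by (simp add: frac_kernel_def Gamma_real_pos less_imp_le)

lemma borel_frac_kernel [measurable]: "frac_kernel \<alpha> \<in> borel_measurable borel"
  unfolding frac_kernel_def by measurable

lemma Gamma_plus1_pos: "0 < (\<alpha>::real) \<Longrightarrow> Gamma (\<alpha> + 1) = \<alpha> * Gamma \<alpha>"
  by (rule Gamma_plus1) (auto simp: nonpos_Ints_def)

lemma Gamma_nonzero: "0 < (\<alpha>::real) \<Longrightarrow> Gamma \<alpha> \<noteq> 0"
  by (metis Gamma_real_pos less_irrefl)

lemma has_integral_frac_kernel:
  assumes "0 < \<alpha>" "a \<le> b" "b \<le> \<tau>"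
  shows "((\<lambda>\<zeta>. frac_kernel \<alpha> (\<tau> - \<zeta>)) has_integral
           ((\<tau> - a) powr \<alpha> - (\<tau> - b) powr \<alpha>) / Gamma (\<alpha> + 1)) {a..b}"
proof -
  have G: "0 < Gamma \<alpha>" using assms(1) by (rule Gamma_real_pos)
  then have G': "Gamma \<alpha> \<noteq> 0" by simp
  have "((\<lambda>\<zeta>. frac_kernel \<alpha> (\<tau> - \<zeta>)) has_integral
      (- ((\<tau> - b) powr \<alpha> / Gamma (\<alpha> + 1)) - (- ((\<tau> - a) powr \<alpha> / Gamma (\<alpha> + 1))))) {a..b}"
  proof (rule fundamental_theorem_of_calculus_interior[OF assms(2)])
    show "continuous_on {a..b} (\<lambda>\<zeta>. - ((\<tau> - \<zeta>) powr \<alpha> / Gamma (\<alpha> + 1)))"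
      using assms G' by (intro continuous_on_minus continuous_on_divide continuous_on_powr' continuous_intros)
        (auto simp: Gamma_plus1_pos)
    fix \<zeta> assume "\<zeta> \<in> {a<..<b}"
    then have "0 < \<tau> - \<zeta>" using assms by auto
    then show "((\<lambda>\<zeta>. - ((\<tau> - \<zeta>) powr \<alpha> / Gamma (\<alpha> + 1))) has_vector_derivative frac_kernel \<alpha> (\<tau> - \<zeta>)) (at \<zeta>)"
      using assms(1) G' unfolding has_real_derivative_iff_has_vector_derivative[symmetric] Gamma_plus1_pos[OF assms(1)]
      by (auto intro!: derivative_eq_intros simp: frac_kernel_def powr_diff divide_simps)
  qed
  then show ?thesis by (simp add: diff_divide_distrib)
qed

lemma has_integral_powr_shift:
  assumes "- 1 < (\<alpha>::real)" "a \<le> b"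
  shows "((\<lambda>\<tau>. (\<tau> - a) powr \<alpha>) has_integral (b - a) powr (\<alpha> + 1) / (\<alpha> + 1)) {a..b}"
proof -
  have "((\<lambda>\<tau>. (\<tau> - a) powr \<alpha>) has_integral
      ((b - a) powr (\<alpha> + 1) / (\<alpha> + 1) - (a - a) powr (\<alpha> + 1) / (\<alpha> + 1))) {a..b}"
  proof (rule fundamental_theorem_of_calculus_interior[OF assms(2)])
    show "continuous_on {a..b} (\<lambda>\<tau>. (\<tau> - a) powr (\<alpha> + 1) / (\<alpha> + 1))"
      using assms by (intro continuous_on_divide continuous_on_powr' continuous_intros) auto
    fix \<tau> assume "\<tau> \<in> {a<..<b}"
    then have "0 < \<tau> - a" by auto
    then show "((\<lambda>\<tau>. (\<tau> - a) powr (\<alpha> + 1) / (\<alpha> + 1)) has_vector_derivative (\<tau> - a) powr \<alpha>) (at \<tau>)"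
      using assms(1) unfolding has_real_derivative_iff_has_vector_derivative[symmetric]
      by (auto intro!: derivative_eq_intros)
  qed
  then show ?thesis by simp
qed

text \<open>The form equals the integral of \<open>(\<Sum>n. a\<^sub>n G\<^sub>n)\<^sup>2\<close>. The functions take extended values, but the
  diagonal entries being finite makes them finite almost everywhere.\<close>

lemma gram_form_nonneg:
  fixes G :: "nat \<Rightarrow> 'a \<Rightarrow> ennreal" and q :: "nat \<Rightarrow> nat \<Rightarrow> real"
  assumes meas: "\<And>n. n \<in> A \<Longrightarrow> G n \<in> borel_measurable M"
    and q: "\<And>n s. n \<in> A \<Longrightarrow> s \<in> A \<Longrightarrow> (\<integral>\<^sup>+y. G n y * G s y \<partial>M) = ennreal (q n s)"
    and q0: "\<And>n s. n \<in> A \<Longrightarrow> s \<in> A \<Longrightarrow> 0 \<le> q n s"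
  shows "0 \<le> (\<Sum>n\<in>A. \<Sum>s\<in>A. a n * a s * q n s)"
proof -
  define g where "g n y = enn2real (G n y)" for n y
  have fin: "AE y in M. G n y \<noteq> \<infinity>" if "n \<in> A" for n
  proof -
    have "AE y in M. G n y * G n y \<noteq> \<infinity>"
      using meas[OF that] q[OF that that] by (intro nn_integral_PInf_AE) auto
    then show ?thesis by eventually_elim (auto simp: ennreal_mult_eq_top_iff)
  qed
  have hb: "has_bochner_integral M (\<lambda>y. g n y * g s y) (q n s)" if "n \<in> A" "s \<in> A" for n s
  proof (rule has_bochner_integral_nn_integral)
    show "(\<lambda>y. g n y * g s y) \<in> borel_measurable M"
      unfolding g_def using meas that by measurable
    have "(\<integral>\<^sup>+y. ennreal (g n y * g s y) \<partial>M) = (\<integral>\<^sup>+y. G n y * G s y \<partial>M)"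
    proof (rule nn_integral_cong_AE, use fin[OF that(1)] fin[OF that(2)] in eventually_elim)
      case (elim y)
      then show ?case by (simp add: g_def ennreal_mult less_top)
    qed
    then show "(\<integral>\<^sup>+y. ennreal (g n y * g s y) \<partial>M) = ennreal (q n s)" using q that by simp
  qed (use q0 that in \<open>auto simp: g_def\<close>)
  have "has_bochner_integral M (\<lambda>y. \<Sum>n\<in>A. \<Sum>s\<in>A. a n * a s * (g n y * g s y)) (\<Sum>n\<in>A. \<Sum>s\<in>A. a n * a s * q n s)"
    using hb by (intro has_bochner_integral_sum has_bochner_integral_mult_right) auto
  moreover have "(\<Sum>n\<in>A. \<Sum>s\<in>A. a n * a s * (g n y * g s y)) = (\<Sum>n\<in>A. a n * g n y)\<^sup>2" for y
    by (simp add: power2_eq_square sum_product mult_ac)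
  ultimately have "(\<Sum>n\<in>A. \<Sum>s\<in>A. a n * a s * q n s) = (\<integral>y. (\<Sum>n\<in>A. a n * g n y)\<^sup>2 \<partial>M)"
    using has_bochner_integral_integral_eq by force
  then show ?thesis by simp
qed

text \<open>A square root of the kernel with respect to correlation: the correlation of two translates of
  \<open>half_power\<close> is a multiple of \<open>|t - s|\<^sup>\<alpha>\<^sup>-\<^sup>1\<close>.\<close>

definition half_power :: "real \<Rightarrow> real \<Rightarrow> real" where
  "half_power \<alpha> r = (if 0 < r then r powr (\<alpha> / 2 - 1) else 0)"

lemma borel_half_power [measurable]: "half_power \<alpha> \<in> borel_measurable borel"
  unfolding half_power_def by measurable

lemma half_power_nonneg: "0 \<le> half_power \<alpha> r"
  by (simp add: half_power_def)

definition half_power_const :: "real \<Rightarrow> ennreal" where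
  "half_power_const \<alpha> = (\<integral>\<^sup>+r. ennreal (half_power \<alpha> r * half_power \<alpha> (r + 1)) \<partial>lborel)"

text \<open>The singularity at \<open>0\<close> has order \<open>1 - \<alpha>/2 < 1\<close>, and the integrand decays like
  \<open>r\<^sup>\<alpha>\<^sup>-\<^sup>2\<close> at infinity; here \<open>\<alpha> < 1\<close> is used.\<close>

lemma half_power_const_finite:
  assumes "0 < \<alpha>" "\<alpha> < 1"
  shows "half_power_const \<alpha> < \<infinity>"
proof -
  let ?p = "\<alpha> / 2 - 1"
  have "half_power_const \<alpha> \<le>
      (\<integral>\<^sup>+r. ennreal (r powr ?p) * indicator {0..1} r + ennreal (r powr (2 * ?p)) * indicator {1..} r \<partial>lborel)"
    unfolding half_power_const_def
  proof (rule nn_integral_mono)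
    fix r :: real
    have *: "half_power \<alpha> r * half_power \<alpha> (r + 1) \<le> r powr ?p * 1" if "0 < r" "r \<le> 1"
      using that assms powr_mono2'[of ?p 1 "r + 1"] by (auto simp: half_power_def intro!: mult_left_mono)
    have **: "half_power \<alpha> r * half_power \<alpha> (r + 1) \<le> r powr (2 * ?p)" if "1 \<le> r"
    proof -
      have "half_power \<alpha> r * half_power \<alpha> (r + 1) \<le> r powr ?p * r powr ?p"
        using that assms by (auto simp: half_power_def intro!: mult_left_mono powr_mono2')
      also have "\<dots> = r powr (2 * ?p)" by (simp add: powr_add[symmetric])
      finally show ?thesis .
    qed
    consider "r \<le> 0" | "0 < r" "r \<le> 1" | "1 < r" by linarith
    then show "ennreal (half_power \<alpha> r * half_power \<alpha> (r + 1)) \<le>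
        ennreal (r powr ?p) * indicator {0..1} r + ennreal (r powr (2 * ?p)) * indicator {1..} r"
    proof cases
      case 1 then show ?thesis by (simp add: half_power_def)
    next
      case 2
      then have "ennreal (half_power \<alpha> r * half_power \<alpha> (r + 1)) \<le> ennreal (r powr ?p) * indicator {0..1} r"
        using * by (simp add: ennreal_leI)
      then show ?thesis by (rule order_trans) simp
    next
      case 3
      then show ?thesis using ** by (simp add: ennreal_leI)
    qed
  qed
  also have "\<dots> = (\<integral>\<^sup>+r. ennreal (r powr ?p) * indicator {0..1} r \<partial>lborel) + (\<integral>\<^sup>+r. ennreal (r powr (2 * ?p)) * indicator {1..} r \<partial>lborel)"
    by (rule nn_integral_add) auto
  also have "\<dots> = ennreal (1 powr (?p + 1) / (?p + 1)) + ennreal (- (1 powr (2 * ?p + 1)) / (2 * ?p + 1))"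
    using assms by (intro arg_cong2[where f = "(+)"] nn_integral_has_integral_lebesgue'
        has_integral_powr_from_0 has_integral_powr_to_inf) auto
  also have "\<dots> < \<infinity>" by simp
  finally show ?thesis .
qed

lemma half_power_const_pos: "0 < half_power_const \<alpha>"
proof -
  have "\<not> (AE r in lborel. ennreal (half_power \<alpha> r * half_power \<alpha> (r + 1)) = 0)"
  proof
    assume "AE r in lborel. ennreal (half_power \<alpha> r * half_power \<alpha> (r + 1)) = 0"
    then have "AE r in lborel. r \<notin> {0<..<1::real}"
      by (rule AE_mp) (auto simp: half_power_def)
    then have "emeasure lborel {0<..<1::real} = 0"
      by (subst (asm) AE_iff_measurable[OF _ refl]) (auto simp: greaterThanLessThan_def greaterThan_def lessThan_def Int_def)
    then show False by simp
  qed
  then have "half_power_const \<alpha> \<noteq> 0"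
    unfolding half_power_const_def by (subst nn_integral_0_iff_AE) auto
  then show ?thesis by (simp add: zero_less_iff_neq_zero)
qed

text \<open>Substitute \<open>y = s - (t - s) r\<close>; both factors are homogeneous of degree \<open>\<alpha>/2 - 1\<close>.\<close>

lemma half_power_convolution_less:
  assumes "s < t"
  shows "(\<integral>\<^sup>+y. ennreal (half_power \<alpha> (t - y)) * ennreal (half_power \<alpha> (s - y)) \<partial>lborel)
     = half_power_const \<alpha> * ennreal ((t - s) powr (\<alpha> - 1))"
proof -
  let ?d = "t - s"
  let ?P = "\<lambda>r. half_power \<alpha> (t - (s + - ?d * r)) * half_power \<alpha> (s - (s + - ?d * r))"
  have scale: "half_power \<alpha> (?d * r) = ?d powr (\<alpha> / 2 - 1) * half_power \<alpha> r" for r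
    using assms by (auto simp: half_power_def powr_mult zero_less_mult_iff)
  have "(\<integral>\<^sup>+y. ennreal (half_power \<alpha> (t - y)) * ennreal (half_power \<alpha> (s - y)) \<partial>lborel)
      = (\<integral>\<^sup>+y. ennreal (half_power \<alpha> (t - y) * half_power \<alpha> (s - y)) \<partial>lborel)"
    by (simp add: ennreal_mult half_power_nonneg)
  also have "\<dots> = \<bar>- ?d\<bar> * (\<integral>\<^sup>+r. ennreal (?P r) \<partial>lborel)"
    using assms by (intro nn_integral_real_affine) auto
  also have "(\<integral>\<^sup>+r. ennreal (?P r) \<partial>lborel)
      = (\<integral>\<^sup>+r. ennreal (?d powr (\<alpha> - 2)) * ennreal (half_power \<alpha> r * half_power \<alpha> (r + 1)) \<partial>lborel)"
  proof (rule nn_integral_cong)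
    fix r :: real
    have "t - (s + - ?d * r) = ?d * (r + 1)" "s - (s + - ?d * r) = ?d * r" by (simp_all add: algebra_simps)
    then have "?P r
        = (?d powr (\<alpha> / 2 - 1) * ?d powr (\<alpha> / 2 - 1)) * (half_power \<alpha> r * half_power \<alpha> (r + 1))"
      by (simp only: scale mult.assoc mult.left_commute) (simp only: scale mult.commute mult.left_commute)
    also have "?d powr (\<alpha> / 2 - 1) * ?d powr (\<alpha> / 2 - 1) = ?d powr (\<alpha> - 2)" by (simp add: powr_add[symmetric])
    finally show "ennreal (?P r)
        = ennreal (?d powr (\<alpha> - 2)) * ennreal (half_power \<alpha> r * half_power \<alpha> (r + 1))"
      by (simp only: ennreal_mult half_power_nonneg mult_nonneg_nonneg powr_ge_zero)
  qed
  also have "\<dots> = ennreal (?d powr (\<alpha> - 2)) * half_power_const \<alpha>"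
    unfolding half_power_const_def by (rule nn_integral_cmult) measurable
  also have "ennreal \<bar>- ?d\<bar> * (ennreal (?d powr (\<alpha> - 2)) * half_power_const \<alpha>) = half_power_const \<alpha> * ennreal (?d * ?d powr (\<alpha> - 2))"
    using assms by (simp add: ennreal_mult mult_ac)
  also have "?d * ?d powr (\<alpha> - 2) = ?d powr (\<alpha> - 1)"
    using assms powr_mult_base[of ?d "\<alpha> - 2"] by simp
  finally show ?thesis .
qed

lemma half_power_convolution:
  assumes "s \<noteq> t"
  shows "(\<integral>\<^sup>+y. ennreal (half_power \<alpha> (t - y)) * ennreal (half_power \<alpha> (s - y)) \<partial>lborel)
     = half_power_const \<alpha> * ennreal (\<bar>t - s\<bar> powr (\<alpha> - 1))"
proof (cases "s < t")
  case True then show ?thesis using half_power_convolution_less by simp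
next
  case False
  then have "t < s" using assms by simp
  from half_power_convolution_less[OF this, of \<alpha>] this show ?thesis by (simp add: mult.commute)
qed

definition half_potential :: "real \<Rightarrow> real \<Rightarrow> real \<Rightarrow> real \<Rightarrow> ennreal" where
  "half_potential \<alpha> a b y = (\<integral>\<^sup>+\<tau>. ennreal (half_power \<alpha> (\<tau> - y)) * indicator {a..b} \<tau> \<partial>lborel)"

lemma borel_half_potential [measurable]: "half_potential \<alpha> a b \<in> borel_measurable borel"
  unfolding half_potential_def by measurable

lemma half_potential_product:
  "(\<integral>\<^sup>+y. half_potential \<alpha> a b y * half_potential \<alpha> a' b' y \<partial>lborel) =
   half_power_const \<alpha> * (\<integral>\<^sup>+\<tau>. (\<integral>\<^sup>+\<zeta>. ennreal (\<bar>\<tau> - \<zeta>\<bar> powr (\<alpha> - 1)) * indicator {a'..b'} \<zeta> \<partial>lborel) * indicator {a..b} \<tau> \<partial>lborel)"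
proof -
  let ?f = "\<lambda>\<tau> y. ennreal (half_power \<alpha> (\<tau> - y)) * indicator {a..b} \<tau>"
  let ?g = "\<lambda>\<zeta> y. ennreal (half_power \<alpha> (\<zeta> - y)) * indicator {a'..b'} \<zeta>"
  have "(\<integral>\<^sup>+y. half_potential \<alpha> a b y * half_potential \<alpha> a' b' y \<partial>lborel)
      = (\<integral>\<^sup>+y. \<integral>\<^sup>+\<tau>. ?f \<tau> y * half_potential \<alpha> a' b' y \<partial>lborel \<partial>lborel)"
    by (intro nn_integral_cong, subst nn_integral_multc) (simp_all add: half_potential_def)
  also have "\<dots> = (\<integral>\<^sup>+\<tau>. \<integral>\<^sup>+y. ?f \<tau> y * half_potential \<alpha> a' b' y \<partial>lborel \<partial>lborel)"
    by (rule lborel_pair.Fubini') measurable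
  also have "\<dots> = (\<integral>\<^sup>+\<tau>. \<integral>\<^sup>+y. \<integral>\<^sup>+\<zeta>. ?f \<tau> y * ?g \<zeta> y \<partial>lborel \<partial>lborel \<partial>lborel)"
    by (intro nn_integral_cong, subst nn_integral_cmult) (simp_all add: half_potential_def)
  also have "\<dots> = (\<integral>\<^sup>+\<tau>. \<integral>\<^sup>+\<zeta>. \<integral>\<^sup>+y. ?f \<tau> y * ?g \<zeta> y \<partial>lborel \<partial>lborel \<partial>lborel)"
    by (intro nn_integral_cong lborel_pair.Fubini') measurable
  also have "\<dots> = (\<integral>\<^sup>+\<tau>. \<integral>\<^sup>+\<zeta>. (\<integral>\<^sup>+y. ennreal (half_power \<alpha> (\<tau> - y)) * ennreal (half_power \<alpha> (\<zeta> - y)) \<partial>lborel) *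
        (indicator {a..b} \<tau> * indicator {a'..b'} \<zeta>) \<partial>lborel \<partial>lborel)"
    by (intro nn_integral_cong, subst nn_integral_multc[symmetric]) (auto simp: mult_ac intro!: nn_integral_cong)
  also have "\<dots> = (\<integral>\<^sup>+\<tau>. \<integral>\<^sup>+\<zeta>. (half_power_const \<alpha> * ennreal (\<bar>\<tau> - \<zeta>\<bar> powr (\<alpha> - 1))) *
        (indicator {a..b} \<tau> * indicator {a'..b'} \<zeta>) \<partial>lborel \<partial>lborel)"
  proof (rule nn_integral_cong, rule nn_integral_cong_AE)
    fix \<tau> :: real
    show "AE \<zeta> in lborel. (\<integral>\<^sup>+y. ennreal (half_power \<alpha> (\<tau> - y)) * ennreal (half_power \<alpha> (\<zeta> - y)) \<partial>lborel) *
        (indicator {a..b} \<tau> * indicator {a'..b'} \<zeta>) = (half_power_const \<alpha> * ennreal (\<bar>\<tau> - \<zeta>\<bar> powr (\<alpha> - 1))) *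
        (indicator {a..b} \<tau> * indicator {a'..b'} \<zeta>)"
      using AE_lborel_singleton[of \<tau>] by eventually_elim (simp add: half_power_convolution)
  qed
  also have "\<dots> = (\<integral>\<^sup>+\<tau>. \<integral>\<^sup>+\<zeta>. half_power_const \<alpha> * (indicator {a..b} \<tau> * (ennreal (\<bar>\<tau> - \<zeta>\<bar> powr (\<alpha> - 1)) * indicator {a'..b'} \<zeta>)) \<partial>lborel \<partial>lborel)"
    by (simp add: mult_ac)
  also have "\<dots> = half_power_const \<alpha> * (\<integral>\<^sup>+\<tau>. indicator {a..b} \<tau> * (\<integral>\<^sup>+\<zeta>. ennreal (\<bar>\<tau> - \<zeta>\<bar> powr (\<alpha> - 1)) * indicator {a'..b'} \<zeta> \<partial>lborel) \<partial>lborel)"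
    by (simp add: nn_integral_cmult)
  finally show ?thesis by (simp add: mult.commute)
qed

text \<open>The number \<open>k\<^sub>n k\<^sub>s w\<^sub>n\<^sub>s\<close>, i.e. the integral of the kernel over the part of the rectangle
  \<open>[t\<^sub>n\<^sub>-\<^sub>1, t\<^sub>n] \<times> [t\<^sub>s\<^sub>-\<^sub>1, t\<^sub>s]\<close> that lies below the diagonal.\<close>

definition quad_area :: "real \<Rightarrow> (nat \<Rightarrow> real) \<Rightarrow> nat \<Rightarrow> nat \<Rightarrow> real" where
  "quad_area \<alpha> t n s = integral {t (n - 1)..t n}
     (\<lambda>\<tau>. integral {t (s - 1)..min \<tau> (t s)} (\<lambda>\<zeta>. frac_kernel \<alpha> (\<tau> - \<zeta>)))"

text \<open>The inner integral is a continuous function of \<open>\<tau>\<close>, so the iterated integral can be rewritten as a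
  nonnegative Lebesgue integral, for which Tonelli's theorem is available.\<close>

lemma frac_kernel_triangle:
  assumes "0 < \<alpha>" "a \<le> b" "a' \<le> a" "a' \<le> b'"
  defines "I \<equiv> integral {a..b} (\<lambda>\<tau>. integral {a'..min \<tau> b'} (\<lambda>\<zeta>. frac_kernel \<alpha> (\<tau> - \<zeta>)))"
  shows "ennreal I = (\<integral>\<^sup>+\<tau>. (\<integral>\<^sup>+\<zeta>. ennreal (frac_kernel \<alpha> (\<tau> - \<zeta>)) * indicator {a'..min \<tau> b'} \<zeta> \<partial>lborel)
            * indicator {a..b} \<tau> \<partial>lborel)"
    and "0 \<le> I"
proof -
  let ?K = "\<lambda>\<tau>. \<integral>\<^sup>+\<zeta>. ennreal (frac_kernel \<alpha> (\<tau> - \<zeta>)) * indicator {a'..min \<tau> b'} \<zeta> \<partial>lborel"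
  let ?i = "\<lambda>\<tau>. integral {a'..min \<tau> b'} (\<lambda>\<zeta>. frac_kernel \<alpha> (\<tau> - \<zeta>))"
  have hi: "((\<lambda>\<zeta>. frac_kernel \<alpha> (\<tau> - \<zeta>)) has_integral
       ((\<tau> - a') powr \<alpha> - (\<tau> - min \<tau> b') powr \<alpha>) / Gamma (\<alpha> + 1)) {a'..min \<tau> b'}" if "\<tau> \<in> {a..b}" for \<tau>
    using that assms by (intro has_integral_frac_kernel) auto
  have "continuous_on {a..b} (\<lambda>\<tau>. ((\<tau> - a') powr \<alpha> - (\<tau> - min \<tau> b') powr \<alpha>) / Gamma (\<alpha> + 1))"
    unfolding divide_inverse using assms
    by (intro continuous_on_mult continuous_on_diff continuous_on_powr' continuous_intros) auto
  then have "continuous_on {a..b} ?i"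
    by (rule continuous_on_eq) (rule integral_unique[OF hi, symmetric])
  then have I: "(?i has_integral I) {a..b}"
    unfolding I_def using integrable_continuous_interval integrable_integral by blast
  have i0: "0 \<le> ?i \<tau>" if "\<tau> \<in> {a..b}" for \<tau>
    using hi[OF that] by (intro integral_nonneg) (auto simp: frac_kernel_nonneg assms(1) has_integral_integrable)
  show "0 \<le> I" using has_integral_nonneg[OF I] i0 by auto
  have "ennreal I = (\<integral>\<^sup>+\<tau>. ennreal (?i \<tau>) * indicator {a..b} \<tau> \<partial>lborel)"
    using nn_integral_has_integral_lebesgue'[OF i0 I] by simp
  also have "\<dots> = (\<integral>\<^sup>+\<tau>. ?K \<tau>
            * indicator {a..b} \<tau> \<partial>lborel)"
  proof (rule nn_integral_cong)
    fix \<tau> :: real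
    have "ennreal (?i \<tau>) = ?K \<tau>"
      if "\<tau> \<in> {a..b}"
      using nn_integral_has_integral_lebesgue'[OF _ hi[OF that]] integral_unique[OF hi[OF that]]
      by (simp add: frac_kernel_nonneg assms(1))
    then show "ennreal (?i \<tau>) * indicator {a..b} \<tau> = ?K \<tau>
            * indicator {a..b} \<tau>"
      by (cases "\<tau> \<in> {a..b}") auto
  qed
  finally show "ennreal I = \<dots>" .
qed

text \<open>The symmetric kernel over a full rectangle. Only this version is a Gram matrix.\<close>

definition sym_area :: "real \<Rightarrow> real \<Rightarrow> real \<Rightarrow> real \<Rightarrow> real \<Rightarrow> ennreal" where
  "sym_area \<alpha> a b a' b' = (\<integral>\<^sup>+\<tau>. (\<integral>\<^sup>+\<zeta>. ennreal (\<bar>\<tau> - \<zeta>\<bar> powr (\<alpha> - 1)) * indicator {a'..b'} \<zeta> \<partial>lborel)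
      * indicator {a..b} \<tau> \<partial>lborel)"

lemma powr_eq_frac_kernel:
  assumes "0 < \<alpha>"
  shows "ennreal (x powr (\<alpha> - 1)) = ennreal (Gamma \<alpha>) * ennreal (frac_kernel \<alpha> x)"
  using Gamma_real_pos[OF assms] Gamma_nonzero[OF assms]
  by (subst ennreal_mult[symmetric]) (auto simp: frac_kernel_def)

lemma sym_area_separated:
  assumes "0 < \<alpha>" "a \<le> b" "a' \<le> b'" "b' \<le> a"
  shows "sym_area \<alpha> a b a' b' = ennreal (Gamma \<alpha> *
      integral {a..b} (\<lambda>\<tau>. integral {a'..min \<tau> b'} (\<lambda>\<zeta>. frac_kernel \<alpha> (\<tau> - \<zeta>))))" (is "_ = ennreal (_ * ?I)")
proof -
  let ?K = "\<lambda>c \<tau>. \<integral>\<^sup>+\<zeta>. ennreal (frac_kernel \<alpha> (\<tau> - \<zeta>)) * indicator {a'..c} \<zeta> \<partial>lborel"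
  have "sym_area \<alpha> a b a' b' = (\<integral>\<^sup>+\<tau>. ennreal (Gamma \<alpha>) * (?K b' \<tau>
            * indicator {a..b} \<tau>) \<partial>lborel)"
    unfolding sym_area_def
  proof (rule nn_integral_cong)
    fix \<tau> :: real
    have "(\<integral>\<^sup>+\<zeta>. ennreal (\<bar>\<tau> - \<zeta>\<bar> powr (\<alpha> - 1)) * indicator {a'..b'} \<zeta> \<partial>lborel)
       = (\<integral>\<^sup>+\<zeta>. ennreal (Gamma \<alpha>) * (ennreal (frac_kernel \<alpha> (\<tau> - \<zeta>)) * indicator {a'..b'} \<zeta>) \<partial>lborel)"
      if "\<tau> \<in> {a..b}"
      using that assms by (intro nn_integral_cong) (auto simp: powr_eq_frac_kernel mult.assoc min_def split: split_indicator)
    then show "(\<integral>\<^sup>+\<zeta>. ennreal (\<bar>\<tau> - \<zeta>\<bar> powr (\<alpha> - 1)) * indicator {a'..b'} \<zeta> \<partial>lborel) * indicator {a..b} \<tau>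
      = ennreal (Gamma \<alpha>) * (?K b' \<tau> * indicator {a..b} \<tau>)"
      by (cases "\<tau> \<in> {a..b}") (auto simp: nn_integral_cmult)
  qed
  also have "\<dots> = ennreal (Gamma \<alpha>) * (\<integral>\<^sup>+\<tau>. ?K b' \<tau>
            * indicator {a..b} \<tau> \<partial>lborel)"
    by (rule nn_integral_cmult) measurable
  also have "\<dots> = ennreal (Gamma \<alpha>) * ennreal ?I"
  proof -
    have "min \<tau> b' = b'" if "\<tau> \<in> {a..b}" for \<tau> using that assms by simp
    then have "(\<integral>\<^sup>+\<tau>. ?K b' \<tau> * indicator {a..b} \<tau> \<partial>lborel)
       = (\<integral>\<^sup>+\<tau>. ?K (min \<tau> b') \<tau> * indicator {a..b} \<tau> \<partial>lborel)"
      by (intro nn_integral_cong) (metis indicator_simps(2) mult_zero_right)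
    then show ?thesis using frac_kernel_triangle(1)[of \<alpha> a b a' b'] assms by simp
  qed
  also have "\<dots> = ennreal (Gamma \<alpha> * ?I)"
    using frac_kernel_triangle(2)[of \<alpha> a b a' b'] assms Gamma_real_pos[OF assms(1)]
    by (simp add: ennreal_mult)
  finally show ?thesis .
qed

text \<open>Reflection in the diagonal maps the lower triangle of the square to the upper one.\<close>

lemma sym_area_diagonal:
  assumes "0 < \<alpha>" "a \<le> b"
  shows "sym_area \<alpha> a b a b = ennreal (2 * (Gamma \<alpha> *
      integral {a..b} (\<lambda>\<tau>. integral {a..min \<tau> b} (\<lambda>\<zeta>. frac_kernel \<alpha> (\<tau> - \<zeta>)))))" (is "_ = ennreal (2 * (_ * ?I))")
proof -
  define k where "k \<tau> \<zeta> = ennreal (frac_kernel \<alpha> (\<tau> - \<zeta>)) * indicator {(\<tau>, \<zeta>). a \<le> \<zeta> \<and> \<zeta> \<le> \<tau> \<and> \<tau> \<le> b} (\<tau>, \<zeta>)" for \<tau> \<zeta>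
  have [measurable]: "(\<lambda>(\<tau>, \<zeta>). k \<tau> \<zeta>) \<in> borel_measurable (lborel \<Otimes>\<^sub>M lborel)"
    unfolding k_def by measurable
  have I: "(\<integral>\<^sup>+\<tau>. \<integral>\<^sup>+\<zeta>. k \<tau> \<zeta> \<partial>lborel \<partial>lborel) = ennreal ?I"
    unfolding frac_kernel_triangle(1)[OF assms(1,2) order_refl assms(2)]
    by (rule nn_integral_cong, subst nn_integral_multc[symmetric], measurable, rule nn_integral_cong)
       (auto simp: k_def split: split_indicator)
  have "sym_area \<alpha> a b a b = (\<integral>\<^sup>+\<tau>. \<integral>\<^sup>+\<zeta>. ennreal (Gamma \<alpha>) * (k \<tau> \<zeta> + k \<zeta> \<tau>) \<partial>lborel \<partial>lborel)"
    unfolding sym_area_def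
  proof (rule nn_integral_cong, subst nn_integral_multc[symmetric])
    fix \<tau> :: real
    show "(\<integral>\<^sup>+\<zeta>. ennreal (\<bar>\<tau> - \<zeta>\<bar> powr (\<alpha> - 1)) * indicator {a..b} \<zeta> * indicator {a..b} \<tau> \<partial>lborel) =
       (\<integral>\<^sup>+\<zeta>. ennreal (Gamma \<alpha>) * (k \<tau> \<zeta> + k \<zeta> \<tau>) \<partial>lborel)"
    proof (rule nn_integral_cong)
      fix \<zeta> :: real
      \<comment> \<open>On the diagonal both sides are \<open>0\<close>, as \<open>0 powr (\<alpha> - 1) = 0\<close>.\<close>
      consider "\<zeta> < \<tau>" | "\<zeta> = \<tau>" | "\<tau> < \<zeta>" by linarith
      then show "ennreal (\<bar>\<tau> - \<zeta>\<bar> powr (\<alpha> - 1)) * indicator {a..b} \<zeta> * indicator {a..b} \<tau> = ennreal (Gamma \<alpha>) * (k \<tau> \<zeta> + k \<zeta> \<tau>)"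
        using assms(1) by cases (auto simp: powr_eq_frac_kernel k_def frac_kernel_def[of \<alpha> 0] split: split_indicator)
    qed
  qed simp
  also have "\<dots> = ennreal (Gamma \<alpha>) * ((\<integral>\<^sup>+\<tau>. \<integral>\<^sup>+\<zeta>. k \<tau> \<zeta> \<partial>lborel \<partial>lborel) + (\<integral>\<^sup>+\<tau>. \<integral>\<^sup>+\<zeta>. k \<zeta> \<tau> \<partial>lborel \<partial>lborel))"
    by (simp add: nn_integral_cmult nn_integral_add)
  also have "(\<integral>\<^sup>+\<tau>. \<integral>\<^sup>+\<zeta>. k \<zeta> \<tau> \<partial>lborel \<partial>lborel) = (\<integral>\<^sup>+\<zeta>. \<integral>\<^sup>+\<tau>. k \<zeta> \<tau> \<partial>lborel \<partial>lborel)"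
    by (rule lborel_pair.Fubini') measurable
  also have "ennreal (Gamma \<alpha>) * ((\<integral>\<^sup>+\<tau>. \<integral>\<^sup>+\<zeta>. k \<tau> \<zeta> \<partial>lborel \<partial>lborel) + (\<integral>\<^sup>+\<zeta>. \<integral>\<^sup>+\<tau>. k \<zeta> \<tau> \<partial>lborel \<partial>lborel))
      = ennreal (2 * (Gamma \<alpha> * ?I))"
    unfolding I using frac_kernel_triangle(2)[OF assms(1,2) order_refl assms(2)] Gamma_real_pos[OF assms(1)]
    by (simp add: ennreal_mult[symmetric] ennreal_plus[symmetric] del: ennreal_plus)
  finally show ?thesis .
qed

lemma sum_symmetric_triangle:
  fixes f g :: "nat \<Rightarrow> nat \<Rightarrow> real"
  assumes "\<And>n s. s \<in> {1..m} \<Longrightarrow> n \<in> {1..m} \<Longrightarrow> s < n \<Longrightarrow> f n s = g n s \<and> f s n = g n s"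
    and "\<And>n. n \<in> {1..m} \<Longrightarrow> f n n = 2 * g n n"
  shows "(\<Sum>n=1..m. \<Sum>s=1..m. f n s) = 2 * (\<Sum>n=1..m. \<Sum>s=1..n. g n s)"
  using assms
proof (induction m)
  case (Suc m)
  have "(\<Sum>n=1..Suc m. \<Sum>s=1..Suc m. f n s) =
      (\<Sum>n=1..m. \<Sum>s=1..m. f n s) + (\<Sum>n=1..m. f n (Suc m)) + (\<Sum>s=1..m. f (Suc m) s) + f (Suc m) (Suc m)"
    by (simp add: sum.distrib)
  also have "(\<Sum>n=1..m. \<Sum>s=1..m. f n s) = 2 * (\<Sum>n=1..m. \<Sum>s=1..n. g n s)"
    by (rule Suc.IH) (use Suc.prems in auto)
  also have "(\<Sum>n=1..m. f n (Suc m)) = (\<Sum>s=1..m. g (Suc m) s)"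
    using Suc.prems(1) by (intro sum.cong) auto
  also have "(\<Sum>s=1..m. f (Suc m) s) = (\<Sum>s=1..m. g (Suc m) s)"
    using Suc.prems(1) by (intro sum.cong) auto
  finally show ?case using Suc.prems(2)[of "Suc m"] by simp
qed simp

text \<open>Twice this sum is, up to a constant, the full quadratic form of the symmetric areas, because a diagonal
  block counts only a triangle. The symmetric areas form the Gram matrix of the functions
  \<open>half_potential\<close>.\<close>

lemma quad_area_positive:
  assumes \<alpha>: "0 < \<alpha>" "\<alpha> < 1" and mesh: "\<And>n. n \<in> {1..m} \<Longrightarrow> t (n - 1) < t n"
  shows "0 \<le> (\<Sum>n=1..m. \<Sum>s=1..n. quad_area \<alpha> t n s * a n * a s)"
proof -
  define c where "c = enn2real (half_power_const \<alpha>)"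
  have c: "half_power_const \<alpha> = ennreal c" "0 < c"
    using half_power_const_finite[OF \<alpha>] half_power_const_pos[of \<alpha>]
    by (simp_all add: c_def less_top enn2real_positive_iff)
  have G: "0 < Gamma \<alpha>" using \<alpha>(1) by (rule Gamma_real_pos)
  have mono: "t i \<le> t j" if "i \<le> j" "j \<le> m" for i j
    using that
  proof (induction rule: dec_induct)
    case (step j)
    then show ?case using mesh[of "Suc j"] by auto
  qed simp
  define q where "q n s = c * (Gamma \<alpha> * (if n = s then 2 * quad_area \<alpha> t n n else quad_area \<alpha> t (max n s) (min n s)))" for n s
  let ?P = "\<lambda>n. half_potential \<alpha> (t (n - 1)) (t n)"
  have area0: "0 \<le> quad_area \<alpha> t n s" if "n \<in> {1..m}" "s \<in> {1..m}" "s \<le> n" for n s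
    unfolding quad_area_def using that \<alpha> mesh[of n] mesh[of s] mono[of "s - 1" "n - 1"]
    by (intro frac_kernel_triangle(2)) auto
  have less: "(\<integral>\<^sup>+y. ?P n y * ?P s y \<partial>lborel) = ennreal (q n s)"
    if "n \<in> {1..m}" "s \<in> {1..m}" "s \<le> n" for n s
  proof -
    have "(\<integral>\<^sup>+y. ?P n y * ?P s y \<partial>lborel) = ennreal c * sym_area \<alpha> (t (n - 1)) (t n) (t (s - 1)) (t s)"
      unfolding half_potential_product c(1) sym_area_def ..
    also have "sym_area \<alpha> (t (n - 1)) (t n) (t (s - 1)) (t s) =
        ennreal (Gamma \<alpha> * (if n = s then 2 * quad_area \<alpha> t n n else quad_area \<alpha> t n s))"
    proof (cases "n = s")
      case True
      then show ?thesis using sym_area_diagonal[OF \<alpha>(1), of "t (n - 1)" "t n"] mesh[of n] that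
        by (simp add: quad_area_def mult.left_commute)
    next
      case False
      then show ?thesis using sym_area_separated[OF \<alpha>(1), of "t (n - 1)" "t n" "t (s - 1)" "t s"]
          mesh[of n] mesh[of s] that mono[of s "n - 1"] by (auto simp: quad_area_def)
    qed
    finally have "(\<integral>\<^sup>+y. ?P n y * ?P s y \<partial>lborel) =
        ennreal (c * (Gamma \<alpha> * (if n = s then 2 * quad_area \<alpha> t n n else quad_area \<alpha> t n s)))"
      using c(2) by (simp only: ennreal_mult' less_imp_le)
    then show ?thesis using that by (simp add: q_def max_def min_def)
  qed
  have q: "(\<integral>\<^sup>+y. ?P n y * ?P s y \<partial>lborel) = ennreal (q n s)"
    if "n \<in> {1..m}" "s \<in> {1..m}" for n s
  proof (cases "s \<le> n")
    case False
    then have "(\<integral>\<^sup>+y. ?P s y * ?P n y \<partial>lborel) = ennreal (q s n)" using that by (intro less) auto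
    moreover have "q s n = q n s" by (auto simp: q_def max.commute min.commute)
    ultimately show ?thesis by (simp add: mult.commute)
  qed (use less that in auto)
  have q0: "0 \<le> q n s" if "n \<in> {1..m}" "s \<in> {1..m}" for n s
    unfolding q_def using c(2) G that area0[of n n] area0[of n s] area0[of s n]
    by (intro mult_nonneg_nonneg) (auto simp: max_def min_def)
  have "0 \<le> (\<Sum>n=1..m. \<Sum>s=1..m. a n * a s * q n s)"
    by (rule gram_form_nonneg[where G = ?P and M = lborel]) (use q q0 in auto)
  also have "\<dots> = 2 * (\<Sum>n=1..m. \<Sum>s=1..n. c * Gamma \<alpha> * (quad_area \<alpha> t n s * a n * a s))"
    by (rule sum_symmetric_triangle) (auto simp: q_def max_def min_def)
  also have "\<dots> = 2 * (c * Gamma \<alpha>) * (\<Sum>n=1..m. \<Sum>s=1..n. quad_area \<alpha> t n s * a n * a s)"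
    by (simp add: sum_distrib_left mult_ac)
  finally have "0 \<le> 2 * (c * Gamma \<alpha>) * (\<Sum>n=1..m. \<Sum>s=1..n. quad_area \<alpha> t n s * a n * a s)" .
  moreover have "0 < 2 * (c * Gamma \<alpha>)" using c(2) G by simp
  ultimately show ?thesis by (meson mult_pos_neg not_le)
qed

text \<open>The last weight supplies the smoothing of order \<open>k\<^sub>n\<^sup>\<alpha>\<close> that the proof of uniqueness relies on.\<close>

lemma quad_area_diagonal:
  assumes "0 < \<alpha>" "t (n - 1) \<le> t n"
  shows "quad_area \<alpha> t n n = step t n powr (\<alpha> + 1) / Gamma (\<alpha> + 2)"
proof -
  have G: "Gamma (\<alpha> + 2) = (\<alpha> + 1) * Gamma (\<alpha> + 1)"
    using Gamma_plus1_pos[of "\<alpha> + 1"] assms(1) by (simp add: add.commute add.left_commute)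
  have "quad_area \<alpha> t n n = integral {t (n - 1)..t n} (\<lambda>\<tau>. (\<tau> - t (n - 1)) powr \<alpha> / Gamma (\<alpha> + 1))"
    unfolding quad_area_def
  proof (rule integral_cong)
    fix \<tau> assume "\<tau> \<in> {t (n - 1)..t n}"
    then show "integral {t (n - 1)..min \<tau> (t n)} (\<lambda>\<zeta>. frac_kernel \<alpha> (\<tau> - \<zeta>)) = (\<tau> - t (n - 1)) powr \<alpha> / Gamma (\<alpha> + 1)"
      using integral_unique[OF has_integral_frac_kernel[OF assms(1), of "t (n - 1)" \<tau> \<tau>]] by (simp add: min_def)
  qed
  also have "\<dots> = (t n - t (n - 1)) powr (\<alpha> + 1) / (\<alpha> + 1) / Gamma (\<alpha> + 1)"
    using has_integral_divide[OF has_integral_powr_shift[OF _ assms(2)], of \<alpha>] assms(1) by (intro integral_unique) auto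
  finally show ?thesis by (simp add: step_def G)
qed

section \<open>Zeros of coercive maps and existence of discrete solutions\<close>

lemma tendsto_coordinatewise_iff:
  fixes f :: "'a \<Rightarrow> nat \<Rightarrow> real"
  shows "(f \<longlongrightarrow> x) F \<longleftrightarrow> (\<forall>j. ((\<lambda>m. f m j) \<longlongrightarrow> x j) F)"
  using limitin_componentwise[of "\<lambda>_. euclidean" "UNIV :: nat set" f x F]
  by (simp add: euclidean_product_topology)

text \<open>The dimension \<open>n\<close> is a number, not a type, since it is the number of interior grid points. Kuhn's lemma
  on a grid with \<open>p\<close> subdivisions, with labels given by the sign of \<open>F\<^sub>i\<close> and forced on the faces of the
  box, yields, for each \<open>i\<close>, two points within \<open>2 R / p\<close> of each other at which the labels differ. In the limit
  \<open>F\<^sub>i(x) x\<^sub>i \<le> 0\<close> for all \<open>i\<close>; coercivity on the boundary then excludes the boundary, and in the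
  interior the signs force \<open>F(x) = 0\<close>.\<close>

lemma coercive_box_zero:
  fixes F :: "(nat \<Rightarrow> real) \<Rightarrow> nat \<Rightarrow> real"
  assumes R: "0 < R"
    and cont: "\<And>i. i < n \<Longrightarrow> continuous_on UNIV (\<lambda>x. F x i)"
    and coercive: "\<And>x i. (\<And>j. j < n \<Longrightarrow> \<bar>x j\<bar> \<le> R) \<Longrightarrow> (\<And>j. n \<le> j \<Longrightarrow> x j = 0) \<Longrightarrow> i < n \<Longrightarrow> \<bar>x i\<bar> = R
       \<Longrightarrow> 0 < (\<Sum>j<n. F x j * x j)"
  shows "\<exists>x. (\<forall>j<n. F x j = 0) \<and> (\<forall>j\<ge>n. x j = 0)"
proof -
  define pt where "pt p q = (\<lambda>i. if i < n then - R + 2 * R * real (q i) / real p else 0)" for p :: nat and q :: "nat \<Rightarrow> nat"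
  \<comment> \<open>\<open>P0\<close> and \<open>P1\<close> are closed conditions that contain the cases of a face, so they pass to the limit.\<close>
  define P0 where "P0 x i \<longleftrightarrow> x i = - R \<or> F x i \<le> 0" for x i
  define P1 where "P1 x i \<longleftrightarrow> x i = R \<or> 0 \<le> F x i" for x i
  have "\<exists>q. (\<forall>i<n. q i < Suc p) \<and> (\<forall>i<n. \<exists>r s. (\<forall>j<n. q j \<le> r j \<and> r j \<le> q j + 1) \<and> (\<forall>j<n. q j \<le> s j \<and> s j \<le> q j + 1)
      \<and> P0 (pt (Suc p) r) i \<and> P1 (pt (Suc p) s) i)" for p
  proof -
    define label where "label q i = (if q i = 0 \<or> (q i \<noteq> Suc p \<and> F (pt (Suc p) q) i \<le> 0) then 0 else 1::nat)" for q i
    have l0: "P0 (pt (Suc p) q) i" if "label q i = 0" "i < n" for q i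
      using that by (auto simp: label_def P0_def pt_def split: if_splits)
    have l1: "P1 (pt (Suc p) q) i" if "label q i = 1" "i < n" for q i
      using that by (auto simp: label_def P1_def pt_def split: if_splits)
    obtain q where q: "\<forall>i<n. q i < Suc p" "\<forall>i<n. \<exists>r s. (\<forall>j<n. q j \<le> r j \<and> r j \<le> q j + 1) \<and> (\<forall>j<n. q j \<le> s j \<and> s j \<le> q j + 1) \<and> label r i \<noteq> label s i"
      by (rule kuhn_lemma[of "Suc p" n label]) (auto simp: label_def)
    have "\<exists>r s. (\<forall>j<n. q j \<le> r j \<and> r j \<le> q j + 1) \<and> (\<forall>j<n. q j \<le> s j \<and> s j \<le> q j + 1)
      \<and> P0 (pt (Suc p) r) i \<and> P1 (pt (Suc p) s) i" if i: "i < n" for i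
    proof -
      from q(2) i obtain r s where rs: "\<forall>j<n. q j \<le> r j \<and> r j \<le> q j + 1" "\<forall>j<n. q j \<le> s j \<and> s j \<le> q j + 1" "label r i \<noteq> label s i"
        by blast
      have "label r i = 0 \<and> label s i = 1 \<or> label s i = 0 \<and> label r i = 1"
        using rs(3) by (auto simp: label_def split: if_splits)
      then show ?thesis using rs l0 l1 i by blast
    qed
    with q(1) show ?thesis by blast
  qed
  then obtain q where q1: "\<And>p i. i < n \<Longrightarrow> q p i < Suc p"
    and q2: "\<And>p i. i < n \<Longrightarrow> \<exists>r s. (\<forall>j<n. q p j \<le> r j \<and> r j \<le> q p j + 1) \<and> (\<forall>j<n. q p j \<le> s j \<and> s j \<le> q p j + 1)
      \<and> P0 (pt (Suc p) r) i \<and> P1 (pt (Suc p) s) i" by metis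
  define good where "good p i r s \<longleftrightarrow> (\<forall>j<n. q p j \<le> r j \<and> r j \<le> q p j + 1) \<and> (\<forall>j<n. q p j \<le> s j \<and> s j \<le> q p j + 1)
      \<and> P0 (pt (Suc p) r) i \<and> P1 (pt (Suc p) s) i" for p i r s
  define r where "r p i = (SOME r. \<exists>s. good p i r s)" for p i
  define s where "s p i = (SOME s. good p i (r p i) s)" for p i
  have "good p i (r p i) (s p i)" if "i < n" for p i
  proof -
    have "\<exists>r s. good p i r s" using q2[OF that, of p] unfolding good_def by blast
    then have "\<exists>s. good p i (r p i) s" unfolding r_def by (rule someI_ex)
    then show ?thesis unfolding s_def by (rule someI_ex)
  qed
  then have r: "\<And>p i j. i < n \<Longrightarrow> j < n \<Longrightarrow> q p j \<le> r p i j \<and> r p i j \<le> q p j + 1"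
    and s: "\<And>p i j. i < n \<Longrightarrow> j < n \<Longrightarrow> q p j \<le> s p i j \<and> s p i j \<le> q p j + 1"
    and P0: "\<And>p i. i < n \<Longrightarrow> P0 (pt (Suc p) (r p i)) i" and P1: "\<And>p i. i < n \<Longrightarrow> P1 (pt (Suc p) (s p i)) i"
    unfolding good_def by blast+
  define K where "K = (\<Pi>\<^sub>E j\<in>UNIV. if j < n then {-R..R} else {0::real})"
  have K: "x \<in> K \<longleftrightarrow> (\<forall>j<n. \<bar>x j\<bar> \<le> R) \<and> (\<forall>j\<ge>n. x j = 0)" for x
  proof -
    have "x \<in> K \<longleftrightarrow> (\<forall>j. x j \<in> (if j < n then {-R..R} else {0}))" by (simp add: K_def PiE_iff)
    also have "\<dots> \<longleftrightarrow> (\<forall>j. (j < n \<longrightarrow> \<bar>x j\<bar> \<le> R) \<and> (n \<le> j \<longrightarrow> x j = 0))"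
      by (rule all_cong1) auto
    finally show ?thesis by blast
  qed
  have "compactin (product_topology (\<lambda>i. euclidean) (UNIV::nat set)) K"
    unfolding K_def compactin_PiE by auto
  then have "compact K" by (simp add: euclidean_product_topology)
  have inK: "pt (Suc p) q' \<in> K" if "\<And>j. j < n \<Longrightarrow> q' j \<le> Suc p" for p q'
  proof -
    have "\<bar>- R + 2 * R * real (q' j) / real (Suc p)\<bar> \<le> R" if "j < n" for j
    proof -
      have "2 * R * real (q' j) / real (Suc p) \<le> 2 * R * real (Suc p) / real (Suc p)"
        using \<open>j < n\<close> \<open>\<And>j. j < n \<Longrightarrow> q' j \<le> Suc p\<close>[of j] R by (intro divide_right_mono mult_left_mono) auto
      moreover have "0 \<le> 2 * R * real (q' j) / real (Suc p)" using R by simp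
      ultimately show ?thesis by auto
    qed
    then show ?thesis unfolding K by (auto simp: pt_def)
  qed
  let ?z = "\<lambda>p. pt (Suc p) (q p)"
  have "\<forall>p. ?z p \<in> K" using q1 by (auto intro!: inK less_imp_le)
  with \<open>compact K\<close> obtain x \<phi> where x: "x \<in> K" and \<phi>: "strict_mono (\<phi> :: nat \<Rightarrow> nat)" and lim: "(?z \<circ> \<phi>) \<longlonglongrightarrow> x"
    unfolding compact_def by meson
  have limc: "(\<lambda>m. ?z (\<phi> m) j) \<longlonglongrightarrow> x j" for j
    using lim unfolding tendsto_coordinatewise_iff[of "?z \<circ> \<phi>"] by (simp add: o_def)
  have inv0: "(\<lambda>m. 2 * R / real (Suc (\<phi> m))) \<longlonglongrightarrow> 0"
  proof -
    have "(\<lambda>m. 2 * R / real (Suc m)) \<longlonglongrightarrow> 0" by (rule LIMSEQ_Suc[OF lim_const_over_n])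
    from LIMSEQ_subseq_LIMSEQ[OF this \<phi>] show ?thesis by (simp add: o_def)
  qed
  have near: "(\<lambda>m. pt (Suc (\<phi> m)) (r' (\<phi> m))) \<longlonglongrightarrow> x"
    if r': "\<And>p j. j < n \<Longrightarrow> q p j \<le> r' p j \<and> r' p j \<le> q p j + 1" for r'
    unfolding tendsto_coordinatewise_iff[of "\<lambda>m. pt (Suc (\<phi> m)) (r' (\<phi> m))"]
  proof
    fix j
    have "(\<lambda>m. pt (Suc (\<phi> m)) (r' (\<phi> m)) j - ?z (\<phi> m) j) \<longlonglongrightarrow> 0"
    proof (rule Lim_null_comparison[OF _ inv0], rule eventuallyI)
      fix m
      show "norm (pt (Suc (\<phi> m)) (r' (\<phi> m)) j - ?z (\<phi> m) j) \<le> 2 * R / real (Suc (\<phi> m))"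
      proof (cases "j < n")
        case True
        have "pt (Suc (\<phi> m)) (r' (\<phi> m)) j - ?z (\<phi> m) j = 2 * R / real (Suc (\<phi> m)) * (real (r' (\<phi> m) j) - real (q (\<phi> m) j))"
          using True by (simp add: pt_def right_diff_distrib diff_divide_distrib)
        moreover have "\<bar>real (r' (\<phi> m) j) - real (q (\<phi> m) j)\<bar> \<le> 1" using r'[OF True, of "\<phi> m"] by auto
        ultimately show ?thesis using R by (simp add: abs_mult mult_left_le divide_right_mono)
      qed (use R in \<open>simp add: pt_def\<close>)
    qed
    from tendsto_add[OF this limc[of j]] show "(\<lambda>m. pt (Suc (\<phi> m)) (r' (\<phi> m)) j) \<longlonglongrightarrow> x j" by simp
  qed
  have closedP: "closed {x. P0 x i}" "closed {x. P1 x i}" if "i < n" for i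
    unfolding P0_def P1_def
    by (intro closed_Collect_disj closed_Collect_eq closed_Collect_le cont[OF that] continuous_intros continuous_on_product_coordinates)+
  have "P0 x i" if i: "i < n" for i
    using closed_sequentially[OF closedP(1)[OF i], of "\<lambda>m. pt (Suc (\<phi> m)) (r (\<phi> m) i)" x]
      near[of "\<lambda>p. r p i"] P0[OF i] r[OF i] by simp
  moreover have "P1 x i" if i: "i < n" for i
    using closed_sequentially[OF closedP(2)[OF i], of "\<lambda>m. pt (Suc (\<phi> m)) (s (\<phi> m) i)" x]
      near[of "\<lambda>p. s p i"] P1[OF i] s[OF i] by simp
  ultimately have sign: "F x i = 0 \<or> x i = R \<and> F x i \<le> 0 \<or> x i = - R \<and> 0 \<le> F x i" if "i < n" for i
    using that R unfolding P0_def P1_def by force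
  have "F x i * x i \<le> 0" if "i < n" for i
    using sign[OF that] R by (auto simp: mult_le_0_iff)
  then have "(\<Sum>j<n. F x j * x j) \<le> 0" by (intro sum_nonpos) auto
  with coercive[of x] x have "\<bar>x i\<bar> \<noteq> R" if "i < n" for i
    using that unfolding K by (metis not_le)
  with sign R have "F x i = 0" if "i < n" for i using that by fastforce
  with x show ?thesis unfolding K by blast
qed

text \<open>Tested with \<open>z\<close>, the nonlinear term vanishes and the diffusive term has the good sign, so
  \<open>c \<parallel>z\<parallel>\<^sup>2\<close> dominates the linear term \<open>b\<close> on the boundary of a large box.\<close>

lemma implicit_step_solvable:
  assumes J: "0 < J" and h: "0 < h" and c: "0 < c" and w: "0 \<le> w"
  shows "\<exists>z. z 0 = 0 \<and> z J = 0 \<and> (\<forall>j\<in>{1..J - 1}. c * z j + convect h z j - w * diff_xx h z j = b j)"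
proof -
  obtain n where n: "J = Suc n" using J by (cases J) auto
  define E where "E x = (\<lambda>j. if 1 \<le> j \<and> j \<le> n then x (j - 1) else (0::real))" for x :: "nat \<Rightarrow> real"
  define F where "F x i = c * E x (i + 1) + convect h (E x) (i + 1) - w * diff_xx h (E x) (i + 1) - b (i + 1)" for x i
  define B where "B = (\<Sum>j=1..n. (b j)\<^sup>2)"
  \<comment> \<open>For \<open>R \<ge> 1\<close> and \<open>R > B / c\<^sup>2\<close> one has \<open>c R\<^sup>2 / 2 > B / (2 c)\<close>.\<close>
  define R where "R = B / c\<^sup>2 + 1"
  have B: "0 \<le> B" by (simp add: B_def sum_nonneg)
  have R: "1 \<le> R" "B / c\<^sup>2 < R" using B by (simp_all add: R_def)
  have E0: "E x 0 = 0" "E x J = 0" for x by (simp_all add: E_def n)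
  have contE: "continuous_on UNIV (\<lambda>x. E x j)" for j
    by (cases "1 \<le> j \<and> j \<le> n") (auto simp: E_def intro: continuous_on_product_coordinates)
  have "\<exists>x. (\<forall>j<n. F x j = 0) \<and> (\<forall>j\<ge>n. x j = 0)"
  proof (rule coercive_box_zero)
    show "0 < R" using R by simp
    show "continuous_on UNIV (\<lambda>x. F x i)" for i
      unfolding F_def convect_def avg_x_def diff_x_def diff_xx_def
      using h by (intro continuous_intros contE) auto
    fix x i assume "i < n" and xi: "\<bar>x i\<bar> = R"
    let ?z = "E x"
    have "(\<Sum>j<n. F x j * x j) = (\<Sum>j=1..J - 1. (c * ?z j + convect h ?z j - w * diff_xx h ?z j - b j) * ?z j)"
      unfolding n by (rule sum.reindex_bij_witness[where i = "\<lambda>j. j - 1" and j = Suc]) (auto simp: F_def E_def)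
    also have "\<dots> = (\<Sum>j=1..J - 1. (c * ?z j - b j) * ?z j) + (grid_inner h J (convect h ?z) ?z - w * grid_inner h J (diff_xx h ?z) ?z) / h"
    proof -
      have "(grid_inner h J (convect h ?z) ?z - w * grid_inner h J (diff_xx h ?z) ?z) / h =
          (\<Sum>j=1..J - 1. convect h ?z j * ?z j) - w * (\<Sum>j=1..J - 1. diff_xx h ?z j * ?z j)"
        using h by (simp add: grid_inner_def diff_divide_distrib)
      then show ?thesis by (simp add: algebra_simps sum.distrib sum_subtractf sum_distrib_left)
    qed
    also have "grid_inner h J (convect h ?z) ?z = 0" using J E0 by (rule convect_skew)
    also have "grid_inner h J (diff_xx h ?z) ?z = - (\<Sum>j<J. (?z (j + 1) - ?z j) * (?z (j + 1) - ?z j)) / h"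
      using J h E0 by (intro grid_inner_diff_xx) auto
    finally have "(\<Sum>j<n. F x j * x j) \<ge> (\<Sum>j=1..J - 1. (c * ?z j - b j) * ?z j)"
      using h w by (simp add: sum_nonneg)
    moreover have "(\<Sum>j=1..J - 1. (c * ?z j - b j) * ?z j) \<ge> (\<Sum>j=1..J - 1. c / 2 * (?z j)\<^sup>2 - (b j)\<^sup>2 / (2 * c))"
    proof (rule sum_mono)
      fix j
      have "0 \<le> (c * ?z j - b j)\<^sup>2 / (2 * c)" using c by simp
      then show "c / 2 * (?z j)\<^sup>2 - (b j)\<^sup>2 / (2 * c) \<le> (c * ?z j - b j) * ?z j"
        using c by (simp add: power2_eq_square field_simps)
    qed
    moreover have "(\<Sum>j=1..J - 1. c / 2 * (?z j)\<^sup>2 - (b j)\<^sup>2 / (2 * c)) = c / 2 * (\<Sum>j=1..n. (?z j)\<^sup>2) - B / (2 * c)"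
      by (simp add: n B_def sum_subtractf sum_distrib_left sum_divide_distrib)
    moreover have "(\<Sum>j=1..n. (?z j)\<^sup>2) \<ge> (?z (Suc i))\<^sup>2"
      using \<open>i < n\<close> by (intro member_le_sum) auto
    moreover have "(?z (Suc i))\<^sup>2 = R\<^sup>2" using \<open>i < n\<close> xi by (metis E_def One_nat_def Suc_leI Suc_le_mono diff_Suc_1 le0 power2_abs)
    moreover have "R \<le> R\<^sup>2" using R by (simp add: power2_eq_square)
    ultimately have "(\<Sum>j<n. F x j * x j) \<ge> c / 2 * R - B / (2 * c)"
      using c by (smt (verit, ccfv_SIG) divide_pos_pos mult_left_mono)
    moreover have "c / 2 * R - B / (2 * c) > 0" using R(2) c by (simp add: field_simps power2_eq_square)
    ultimately show "0 < (\<Sum>j<n. F x j * x j)" by simp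
  qed
  then obtain x where x: "\<And>j. j < n \<Longrightarrow> F x j = 0" by blast
  show ?thesis
  proof (intro exI conjI ballI)
    fix j assume "j \<in> {1..J - 1}"
    then have "j - 1 < n" "j - 1 + 1 = j" by (auto simp: n)
    then show "c * E x j + convect h (E x) j - w * diff_xx h (E x) j = b j"
      using x[of "j - 1"] unfolding F_def by simp
  qed (use E0 in auto)
qed

text \<open>The grid function at which the step from level \<open>n - 1\<close> to \<open>n\<close> is evaluated: fully implicit in the first
  step, the midpoint afterwards. It lets the nonlinear term and the quadrature be treated alike in all steps.\<close>

definition mid :: "(nat \<Rightarrow> nat \<Rightarrow> real) \<Rightarrow> nat \<Rightarrow> nat \<Rightarrow> real" where
  "mid U n i = (if n = 1 then U 1 i else (U n i + U (n - 1) i) / 2)"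

text \<open>The factor in \<open>W n - W (n - 1) = lead n * (mid W n - W (n - 1))\<close>.\<close>

definition lead :: "nat \<Rightarrow> real" where
  "lead n = (if n = 1 then 1 else 2)"

lemma lead_pos: "0 < lead n" and lead_ge_1: "1 \<le> lead n"
  by (simp_all add: lead_def)

lemma diff_t_mid: "diff_t t (\<lambda>m. U m j) n = lead n * (mid U n j - U (n - 1) j) / step t n"
  by (simp add: diff_t_def lead_def mid_def field_simps)

lemma convection_mid: "convection h U n j = convect h (mid U n) j"
  by (simp add: convection_def convect_def mid_def half_level_def avg_x_def diff_x_def)

lemma frac_quad_mid:
  assumes "1 \<le> n"
  shows "frac_quad \<alpha> t (\<lambda>m. diff_xx h (U m) j) n = (\<Sum>s=1..n. quad_weight \<alpha> t n s * step t s * diff_xx h (mid U s) j)"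
proof -
  have "(\<Sum>s=1..n. quad_weight \<alpha> t n s * step t s * diff_xx h (mid U s) j) =
     quad_weight \<alpha> t n 1 * step t 1 * diff_xx h (mid U 1) j + (\<Sum>s=2..n. quad_weight \<alpha> t n s * step t s * diff_xx h (mid U s) j)"
    using assms by (simp add: sum.atLeast_Suc_atMost numeral_2_eq_2)
  also have "\<dots> = frac_quad \<alpha> t (\<lambda>m. diff_xx h (U m) j) n"
    unfolding frac_quad_def
    by (intro arg_cong2[where f = "(+)"] sum.cong refl)
       (auto simp: mid_def half_level_def diff_xx_def add_divide_distrib diff_divide_distrib algebra_simps)
  finally show ?thesis ..
qed

lemma scheme_equation_mid:
  assumes "1 \<le> n"
  shows "diff_t t (\<lambda>m. U m j) n + convection h U n j = frac_quad \<alpha> t (\<lambda>m. diff_xx h (U m) j) n + r \<longleftrightarrow>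
    lead n * (mid U n j - U (n - 1) j) / step t n + convect h (mid U n) j
     = (\<Sum>s=1..n. quad_weight \<alpha> t n s * step t s * diff_xx h (mid U s) j) + r"
  unfolding diff_t_mid convection_mid frac_quad_mid[OF assms] ..

lemma quad_weight_area:
  assumes "step t n \<noteq> 0" "step t s \<noteq> 0"
  shows "step t n * (quad_weight \<alpha> t n s * step t s) = quad_area \<alpha> t n s"
  using assms by (simp add: quad_weight_def quad_area_def)

lemma quad_weight_diagonal:
  assumes "0 < \<alpha>" "t (n - 1) < t n"
  shows "quad_weight \<alpha> t n n * step t n = step t n powr \<alpha> / Gamma (\<alpha> + 2)"
proof -
  have k: "0 < step t n" using assms(2) by (simp add: step_def)
  have "step t n * (quad_weight \<alpha> t n n * step t n) = step t n * (step t n powr \<alpha> / Gamma (\<alpha> + 2))"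
    using quad_weight_area[of t n n \<alpha>] quad_area_diagonal[of \<alpha> t n] assms k
    by (simp add: powr_add mult.commute)
  then show ?thesis using k by (metis less_irrefl mult_left_cancel)
qed

lemma scheme_solution_exists:
  assumes J: "0 < J" and h: "0 < h" and \<alpha>: "0 < \<alpha>" and mesh: "\<And>n. n \<in> {1..N} \<Longrightarrow> t (n - 1) < t n"
  shows "\<exists>U. scheme_solution h J N \<alpha> t u0 fh U"
proof -
  have "\<exists>U. scheme_solution h J m \<alpha> t u0 fh U" if "m \<le> N" for m
    using that
  proof (induction m)
    case 0
    then show ?case by (intro exI[of _ "\<lambda>n j. u0 (real j * h)"]) (simp add: scheme_solution_def)
  next
    case (Suc m)
    then obtain U where U: "scheme_solution h J m \<alpha> t u0 fh U" by auto
    let ?n = "Suc m"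
    have k: "0 < step t ?n" using mesh[of ?n] Suc.prems by (simp add: step_def)
    have w: "0 \<le> quad_weight \<alpha> t ?n ?n * step t ?n"
      using quad_weight_diagonal[of \<alpha> t ?n] \<alpha> mesh[of ?n] Suc.prems Gamma_real_pos[of "\<alpha> + 2"] by simp
    have c: "0 < lead ?n / step t ?n" using k lead_pos by simp
    obtain z where z: "z 0 = 0" "z J = 0" and zeq: "\<And>j. j \<in> {1..J - 1} \<Longrightarrow>
        lead ?n / step t ?n * z j + convect h z j - quad_weight \<alpha> t ?n ?n * step t ?n * diff_xx h z j
        = lead ?n / step t ?n * U m j + (\<Sum>s=1..m. quad_weight \<alpha> t ?n s * step t s * diff_xx h (mid U s) j) + fh ?n j"
      using implicit_step_solvable[OF J h c w, of "\<lambda>j. lead ?n / step t ?n * U m j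
         + (\<Sum>s=1..m. quad_weight \<alpha> t ?n s * step t s * diff_xx h (mid U s) j) + fh ?n j"] by blast
    define V where "V = U(?n := (if m = 0 then z else (\<lambda>j. 2 * z j - U m j)))"
    have V: "V n = U n" if "n \<le> m" for n using that by (simp add: V_def)
    have midV: "mid V n = mid U n" if "1 \<le> n" "n \<le> m" for n
      using that by (auto simp: mid_def fun_eq_iff V)
    have midn: "mid V ?n = z" by (auto simp: mid_def fun_eq_iff V_def)
    have bd: "V n 0 = 0 \<and> V n J = 0" if "n \<in> {1..?n}" for n
    proof (cases "n = ?n")
      case True
      then show ?thesis using z U by (auto simp: V_def scheme_solution_def)
    next
      case False
      then show ?thesis using that V[of n] U by (auto simp: scheme_solution_def)
    qed
    have "diff_t t (\<lambda>l. V l j) n + convection h V n j = frac_quad \<alpha> t (\<lambda>l. diff_xx h (V l) j) n + fh n j"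
      if n: "n \<in> {1..?n}" and j: "j \<in> {1..J - 1}" for n j
    proof (cases "n = ?n")
      case True
      have "1 \<le> ?n" by simp
      show ?thesis
        unfolding True scheme_equation_mid[OF \<open>1 \<le> ?n\<close>]
        using zeq[OF j] by (simp add: midn midV V right_diff_distrib diff_divide_distrib)
    next
      case False
      then have nm: "1 \<le> n" "n \<le> m" using n by auto
      have "diff_t t (\<lambda>l. U l j) n + convection h U n j = frac_quad \<alpha> t (\<lambda>l. diff_xx h (U l) j) n + fh n j"
        using U nm j by (simp add: scheme_solution_def)
      then show ?thesis
        unfolding scheme_equation_mid[OF nm(1)] using nm by (simp add: midV V)
    qed
    moreover have "V 0 j = u0 (real j * h)" if "j \<in> {1..J - 1}" for j
      using U that by (simp add: V scheme_solution_def)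
    ultimately have "scheme_solution h J ?n \<alpha> t u0 fh V" using bd unfolding scheme_solution_def by blast
    then show ?case by blast
  qed
  then show ?thesis by blast
qed

section \<open>Energy estimates for the implicit steps\<close>

text \<open>Summation by parts in space reduces the claim to \<open>quad_area_positive\<close> for the sequence of differences
  at each grid point.\<close>

lemma quad_form_nonneg:
  assumes J: "0 < J" and h: "0 < h" and \<alpha>: "0 < \<alpha>" "\<alpha> < 1"
    and mesh: "\<And>n. n \<in> {1..m} \<Longrightarrow> t (n - 1) < t n"
    and bd: "\<And>n. n \<in> {1..m} \<Longrightarrow> y n 0 = 0 \<and> y n J = 0"
  shows "(\<Sum>n=1..m. step t n * grid_inner h J (\<lambda>j. \<Sum>s=1..n. quad_weight \<alpha> t n s * step t s * diff_xx h (y s) j) (y n)) \<le> 0"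
proof -
  let ?F = "\<lambda>n. step t n * grid_inner h J (\<lambda>j. \<Sum>s=1..n. quad_weight \<alpha> t n s * step t s * diff_xx h (y s) j) (y n)"
  let ?d = "\<lambda>n j. y n (j + 1) - y n j"
  have "?F n
      = - (\<Sum>j<J. \<Sum>s=1..n. quad_area \<alpha> t n s * ?d n j * ?d s j) / h" if n: "n \<in> {1..m}" for n
  proof -
    have pos: "step t s \<noteq> 0" if "s \<in> {1..n}" for s using mesh[of s] that n by (auto simp: step_def)
    have "?F n
        = (\<Sum>s=1..n. step t n * (quad_weight \<alpha> t n s * step t s) * grid_inner h J (diff_xx h (y s)) (y n))"
      unfolding grid_inner_def sum_distrib_left sum_distrib_right
      by (subst sum.swap) (simp add: mult_ac)
    also have "\<dots> = (\<Sum>s=1..n. quad_area \<alpha> t n s * (- (\<Sum>j<J. ?d s j * ?d n j) / h))"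
    proof (rule sum.cong[OF refl])
      fix s assume s: "s \<in> {1..n}"
      show "step t n * (quad_weight \<alpha> t n s * step t s) * grid_inner h J (diff_xx h (y s)) (y n)
          = quad_area \<alpha> t n s * (- (\<Sum>j<J. ?d s j * ?d n j) / h)"
        using quad_weight_area[of t n s \<alpha>] pos[of n] pos[OF s] n grid_inner_diff_xx[OF J, of h "y n" "y s"] h bd[OF n]
        by simp
    qed
    also have "\<dots> = - (\<Sum>s=1..n. \<Sum>j<J. quad_area \<alpha> t n s * ?d n j * ?d s j) / h"
      by (simp add: sum_distrib_left sum_divide_distrib sum_negf mult_ac)
    also have "\<dots> = - (\<Sum>j<J. \<Sum>s=1..n. quad_area \<alpha> t n s * ?d n j * ?d s j) / h"
      by (subst sum.swap) (rule refl)
    finally show ?thesis .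
  qed
  then have "(\<Sum>n=1..m. ?F n)
     = - (\<Sum>n=1..m. \<Sum>j<J. \<Sum>s=1..n. quad_area \<alpha> t n s * ?d n j * ?d s j) / h"
    by (simp add: sum_divide_distrib sum_negf)
  also have "(\<Sum>n=1..m. \<Sum>j<J. \<Sum>s=1..n. quad_area \<alpha> t n s * ?d n j * ?d s j)
     = (\<Sum>j<J. \<Sum>n=1..m. \<Sum>s=1..n. quad_area \<alpha> t n s * ?d n j * ?d s j)"
    by (rule sum.swap)
  also have "- \<dots> / h \<le> 0"
  proof -
    have "0 \<le> (\<Sum>j<J. \<Sum>n=1..m. \<Sum>s=1..n. quad_area \<alpha> t n s * ?d n j * ?d s j)"
      by (intro sum_nonneg quad_area_positive \<alpha> mesh)
    then show ?thesis using h by simp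
  qed
  finally show ?thesis .
qed

text \<open>Equality holds for the midpoint; in the implicit first step the difference of the two sides is
  \<open>\<parallel>e\<^sub>1 - e\<^sub>0\<parallel>\<^sup>2 / 2\<close>.\<close>

lemma mid_energy:
  assumes "0 \<le> h"
  shows "((grid_norm h J (e n))\<^sup>2 - (grid_norm h J (e (n - 1)))\<^sup>2) / 2
    \<le> lead n * grid_inner h J (\<lambda>j. mid e n j - e (n - 1) j) (mid e n)"
proof -
  have "(e n j * e n j - e (n - 1) j * e (n - 1) j) / 2 \<le> lead n * ((mid e n j - e (n - 1) j) * mid e n j)" for j
  proof (cases "n = 1")
    case True
    have "0 \<le> (e 1 j - e 0 j)\<^sup>2" by simp
    then show ?thesis using True by (simp add: mid_def lead_def power2_eq_square field_simps)
  next
    case False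
    then show ?thesis by (simp add: mid_def lead_def field_simps)
  qed
  then have "h * (\<Sum>j=1..J - 1. (e n j * e n j - e (n - 1) j * e (n - 1) j) / 2)
      \<le> h * (\<Sum>j=1..J - 1. lead n * ((mid e n j - e (n - 1) j) * mid e n j))"
    using assms by (intro mult_left_mono sum_mono) auto
  then show ?thesis
    unfolding grid_norm_sq[OF assms] grid_inner_def
    by (simp add: sum_subtractf sum_divide_distrib[symmetric] sum_distrib_left[symmetric] right_diff_distrib mult.left_commute)
qed

text \<open>The energy inequality is quadratic in \<open>E\<close>. At a level where \<open>E\<close> exceeds all previous values one can
  divide by it, which gives a linear recursion; the solution \<open>G\<close> of this recursion increases, so the other
  levels follow from the earlier ones.\<close>

lemma discrete_Gronwall:
  fixes E Y r k :: "nat \<Rightarrow> real"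
  assumes E: "\<And>n. 0 \<le> E n" "E 0 = 0"
    and Y: "\<And>n. n \<in> {1..N} \<Longrightarrow> 0 \<le> Y n \<and> Y n \<le> max (E n) (E (n - 1))"
    and k: "\<And>n. n \<in> {1..N} \<Longrightarrow> 0 \<le> k n \<and> c * k n \<le> 1 / 4" and c: "0 \<le> c"
    and r: "\<And>n. n \<in> {1..N} \<Longrightarrow> 0 \<le> r n" "(\<Sum>n=1..N. r n) \<le> \<rho>"
    and energy: "\<And>m. m \<in> {1..N} \<Longrightarrow> (E m)\<^sup>2 / 2 \<le> (\<Sum>n=1..m. c * k n * (Y n)\<^sup>2 + r n * Y n)"
    and m: "m \<le> N"
  shows "E m \<le> 4 * \<rho> * exp (4 * c * (\<Sum>n=1..N. k n))"
proof -
  define G where "G m = 4 * \<rho> * (\<Prod>l=1..m - 1. 1 + 4 * c * k l)" for m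
  have \<rho>: "0 \<le> \<rho>" using r sum_nonneg[of "{1..N}" r] by fastforce
  have rm: "(\<Sum>n=1..m. r n) \<le> \<rho>" if "m \<le> N" for m
  proof -
    have "(\<Sum>n=1..m. r n) \<le> (\<Sum>n=1..N. r n)" using that r(1) by (intro sum_mono2) auto
    then show ?thesis using r(2) by linarith
  qed
  have f: "1 \<le> 1 + 4 * c * k n" if "n \<in> {1..N}" for n using k[OF that] c by simp
  have Gsuc: "G (Suc m) = G m * (1 + 4 * c * k m)" if "1 \<le> m" for m
    using that by (cases m) (simp_all add: G_def)
  have P0: "0 \<le> (\<Prod>l=1..m - 1. 1 + 4 * c * k l)" if "m \<le> Suc N" for m
    using that by (intro prod_nonneg) (auto intro: order_trans[OF zero_le_one f])
  have G0: "0 \<le> G m" if "m \<le> Suc N" for m using P0[OF that] \<rho> by (simp add: G_def)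
  have mono: "G i \<le> G j" if "i \<le> j" "j \<le> N" for i j
    using that
  proof (induction rule: dec_induct)
    case (step j)
    have "G j \<le> G (Suc j)"
    proof (cases "1 \<le> j")
      case True
      then show ?thesis using Gsuc[OF True] G0[of j] f[of j] step.prems by (simp add: mult_le_cancel_left1)
    next
      case False
      then show ?thesis by (simp add: G_def)
    qed
    then show ?case using step by simp
  qed simp
  \<comment> \<open>\<open>G\<close> solves the recursion that the division by \<open>E m\<close> leads to.\<close>
  have Gsum: "G m = 4 * \<rho> + 4 * c * (\<Sum>n=1..m - 1. k n * G n)" for m
  proof (induction m)
    case (Suc m)
    then show ?case
    proof (cases m)
      case (Suc l)
      then have "(\<Sum>n=1..Suc m - 1. k n * G n) = (\<Sum>n=1..m - 1. k n * G n) + k m * G m" by simp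
      then show ?thesis using Suc.IH Gsuc[of m] Suc by (simp add: algebra_simps)
    qed (simp add: G_def)
  qed (simp add: G_def)
  have "E m \<le> G m" if "m \<le> N" for m
    using that
  proof (induction m rule: less_induct)
    case (less m)
    show ?case
    proof (cases "m = 0 \<or> E m = 0 \<or> (\<exists>n<m. E m \<le> E n)")
      case True
      then consider "m = 0" | "E m = 0" | n where "n < m" "E m \<le> E n" by blast
      then show ?thesis
      proof cases
        case 3
        then show ?thesis using less.IH[of n] mono[of n m] less.prems by simp
      qed (use E G0[of m] less.prems in auto)
    next
      case False
      have m1: "m \<in> {1..N}" using False less.prems by auto
      have pos: "0 < E m" using False E(1)[of m] by linarith
      have big: "E n \<le> E m" if "n < m" for n using False that by force
      have Yn: "Y n \<le> E m \<and> Y n \<le> G n" if "n \<in> {1..m - 1}" for n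
      proof -
        have "E n \<le> G n" "E (n - 1) \<le> G (n - 1)" "G (n - 1) \<le> G n" "E n \<le> E m" "E (n - 1) \<le> E m"
          using that less big[of n] big[of "n - 1"] mono[of "n - 1" n] by auto
        then show ?thesis using Y[of n] that less.prems by fastforce
      qed
      have Ym: "0 \<le> Y m" "Y m \<le> E m" using Y[OF m1] big[of "m - 1"] m1 by auto
      have split: "(\<Sum>n=1..m. F n) = (\<Sum>n=1..m - 1. F n) + F m" for F :: "nat \<Rightarrow> real"
        using m1 by (cases m) auto
      have "(\<Sum>n=1..m. c * k n * (Y n)\<^sup>2) \<le> (\<Sum>n=1..m - 1. c * k n * (G n * E m)) + c * k m * (E m)\<^sup>2"
        unfolding split
      proof (intro add_mono sum_mono mult_left_mono)
        fix n assume n: "n \<in> {1..m - 1}"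
        then have nN: "n \<in> {1..N}" using less.prems by auto
        show "(Y n)\<^sup>2 \<le> G n * E m" unfolding power2_eq_square
          using Yn[OF n] Y[OF nN] G0[of n] nN by (intro mult_mono) auto
        show "0 \<le> c * k n" using k[OF nN] c by simp
      next
        show "(Y m)\<^sup>2 \<le> (E m)\<^sup>2" using Ym by (intro power_mono)
        show "0 \<le> c * k m" using k[OF m1] c by simp
      qed
      moreover have "(\<Sum>n=1..m. r n * Y n) \<le> (\<Sum>n=1..m. r n * E m)"
      proof (intro sum_mono mult_left_mono)
        fix n assume n: "n \<in> {1..m}"
        show "Y n \<le> E m" using Yn[of n] Ym n by (cases "n = m") auto
        show "0 \<le> r n" using r(1)[of n] n less.prems by auto
      qed
      moreover have "(\<Sum>n=1..m. r n * E m) \<le> \<rho> * E m"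
        unfolding sum_distrib_right[symmetric] using rm[OF less.prems] pos by (intro mult_right_mono) auto
      moreover have "(\<Sum>n=1..m - 1. c * k n * (G n * E m)) = c * (\<Sum>n=1..m - 1. k n * G n) * E m"
        by (simp add: sum_distrib_left sum_distrib_right mult_ac)
      moreover have "c * k m * (E m)\<^sup>2 \<le> 1 / 4 * (E m)\<^sup>2" using k[OF m1] by (intro mult_right_mono) auto
      moreover have "(E m)\<^sup>2 / 2 \<le> (\<Sum>n=1..m. c * k n * (Y n)\<^sup>2) + (\<Sum>n=1..m. r n * Y n)"
        using energy[OF m1] by (simp add: sum.distrib)
      ultimately have "(E m)\<^sup>2 / 4 \<le> (c * (\<Sum>n=1..m - 1. k n * G n) + \<rho>) * E m"
        by (simp add: algebra_simps)
      then have "E m * E m \<le> G m * E m" unfolding Gsum[of m] by (simp add: power2_eq_square algebra_simps)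
      then show ?thesis using pos by simp
    qed
  qed
  also have "G m \<le> 4 * \<rho> * exp (4 * c * (\<Sum>n=1..N. k n))"
  proof -
    have "(\<Prod>l=1..m - 1. 1 + 4 * c * k l) \<le> (\<Prod>l=1..m - 1. exp (4 * c * k l))"
      using m by (intro prod_mono) (auto intro: order_trans[OF zero_le_one f] simp: exp_ge_add_one_self)
    also have "\<dots> = exp (4 * c * (\<Sum>l=1..m - 1. k l))" by (simp add: exp_sum sum_distrib_left)
    also have "\<dots> \<le> exp (4 * c * (\<Sum>n=1..N. k n))"
    proof -
      have "(\<Sum>l=1..m - 1. k l) \<le> (\<Sum>n=1..N. k n)" using m k by (intro sum_mono2) auto
      then show ?thesis using c by (simp add: mult_left_mono)
    qed
    finally show ?thesis unfolding G_def using \<rho> by (intro mult_left_mono) auto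
  qed
  finally show ?thesis using m by simp
qed

text \<open>The discriminant condition makes the quadratic form \<open>r a\<^sup>2 - K a b + q b\<^sup>2\<close> positive definite.\<close>

lemma quadratic_form_trivial:
  fixes a b q r K :: real
  assumes "0 \<le> a" "0 \<le> b" "0 < r" "K\<^sup>2 < 4 * r * q" "r * a\<^sup>2 + q * b\<^sup>2 \<le> K * (a * b)"
  shows "a = 0"
proof (rule ccontr)
  assume "a \<noteq> 0"
  have "0 \<le> (2 * r * a - K * b)\<^sup>2" by simp
  then have "4 * r * (K * (a * b)) \<le> 4 * r * (r * a\<^sup>2) + K\<^sup>2 * b\<^sup>2" by (simp add: power2_eq_square algebra_simps)
  moreover have "4 * r * (r * a\<^sup>2 + q * b\<^sup>2) \<le> 4 * r * (K * (a * b))" using assms(3,5) by (intro mult_left_mono) auto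
  ultimately have "(4 * r * q - K\<^sup>2) * b\<^sup>2 \<le> 0" by (simp add: algebra_simps)
  then have "b = 0" using assms(4) by (simp add: mult_le_0_iff)
  then have "r * a\<^sup>2 \<le> 0" using assms(5) by simp
  then show False using assms(3) \<open>a \<noteq> 0\<close> by (simp add: mult_le_0_iff)
qed

section \<open>Convolutions with the fractional kernel and increments of grid functions\<close>

lemma sum_mesh_differences:
  fixes g :: "nat \<Rightarrow> real"
  shows "(\<Sum>n=1..m. g n - g (n - 1)) = g m - g 0"
  by (induction m) simp_all

text \<open>The function \<open>x\<^sup>p\<close> is concave.\<close>

lemma powr_increment_ge:
  assumes "0 < p" "p \<le> (1::real)" "0 < a" "a \<le> b"
  shows "b powr (p - 1) * (b - a) \<le> (b powr p - a powr p) / p"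
proof (cases "a = b")
  case False
  then have "a < b" using assms by simp
  have "\<exists>z>a. z < b \<and> b powr p - a powr p = (b - a) * (p * z powr (p - 1))"
    using assms by (intro MVT2[OF \<open>a < b\<close>]) (auto intro!: derivative_eq_intros)
  then obtain z where z: "a < z" "z < b" "b powr p - a powr p = (b - a) * (p * z powr (p - 1))" by blast
  have "b powr (p - 1) \<le> z powr (p - 1)" using z assms by (intro powr_mono2') auto
  then show ?thesis using z(3) assms by (simp add: mult.commute mult_left_mono)
qed simp

lemma mult_le_abs_mult:
  fixes a b c :: real
  assumes "0 \<le> a" "a \<le> b"
  shows "c * a \<le> \<bar>c\<bar> * b"
proof -
  have "c * a \<le> \<bar>c\<bar> * a" using assms by (intro mult_right_mono) auto
  also have "\<dots> \<le> \<bar>c\<bar> * b" using assms by (intro mult_left_mono) auto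
  finally show ?thesis .
qed

text \<open>If the integral does not exist, its value is \<open>0\<close>; if \<open>g\<close> is integrable but not absolutely, the
  right-hand side is infinite. Hence the bound holds for every \<open>g\<close>.\<close>

lemma abs_integral_le_nn_integral:
  fixes g :: "real \<Rightarrow> real"
  shows "ennreal \<bar>integral S g\<bar> \<le> (\<integral>\<^sup>+x. ennreal \<bar>g x\<bar> * indicator S x \<partial>lborel)"
proof (cases "g integrable_on S \<and> (\<integral>\<^sup>+x. ennreal \<bar>g x\<bar> * indicator S x \<partial>lborel) < \<infinity>")
  case True
  then have g: "g integrable_on S" and fin: "(\<integral>\<^sup>+x. ennreal \<bar>g x\<bar> * indicator S x \<partial>lborel) < \<infinity>" by auto
  have m: "(\<lambda>x. indicator S x *\<^sub>R g x) \<in> borel_measurable lebesgue"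
    using g has_integral_implies_lebesgue_measurable by blast
  have "(\<integral>\<^sup>+x. ennreal (norm (indicator S x *\<^sub>R g x)) \<partial>lebesgue) = (\<integral>\<^sup>+x. ennreal (norm (indicator S x *\<^sub>R g x)) \<partial>lborel)"
    by (rule nn_integral_completion) (use m in measurable)
  also have "\<dots> = (\<integral>\<^sup>+x. ennreal \<bar>g x\<bar> * indicator S x \<partial>lborel)"
    by (intro nn_integral_cong) (auto split: split_indicator)
  finally have "set_integrable lebesgue S g"
    unfolding set_integrable_def using m fin by (intro integrableI_bounded) auto
  then have abs: "(\<lambda>x. \<bar>g x\<bar>) integrable_on S"
    unfolding absolutely_integrable_on_def by simp
  have "\<bar>integral S g\<bar> \<le> integral S (\<lambda>x. \<bar>g x\<bar>)"
    using integral_norm_bound_integral[OF g abs] by simp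
  then have "ennreal \<bar>integral S g\<bar> \<le> ennreal (integral S (\<lambda>x. \<bar>g x\<bar>))" by (rule ennreal_leI)
  also have "\<dots> = (\<integral>\<^sup>+x. ennreal \<bar>g x\<bar> * indicator S x \<partial>lborel)"
    using abs by (intro nn_integral_has_integral_lebesgue'[symmetric]) auto
  finally show ?thesis .
next
  case False
  then show ?thesis by (auto simp: not_integrable_integral less_top[symmetric])
qed

lemma integral_le_of_bound:
  fixes g :: "real \<Rightarrow> real"
  assumes "(b has_integral B) S" "\<And>x. x \<in> S \<Longrightarrow> g x \<le> b x" "0 \<le> B"
  shows "integral S g \<le> B"
proof (cases "g integrable_on S")
  case True
  then show ?thesis using assms integral_le[of g S b] by (metis has_integral_integrable integral_unique)
qed (use assms in \<open>simp add: not_integrable_integral\<close>)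

text \<open>Used with the weights \<open>c\<^sub>j = h |z\<^sub>j|\<close>: pairing with a fixed grid function \<open>z\<close> before estimating replaces
  Minkowski's integral inequality for the grid norm.\<close>

lemma weighted_convolution_le:
  fixes \<phi> :: "nat \<Rightarrow> real \<Rightarrow> real" and c :: "nat \<Rightarrow> real"
  assumes A: "finite A" and c: "\<And>j. j \<in> A \<Longrightarrow> 0 \<le> c j" and \<alpha>: "0 < \<alpha>" and ab: "0 \<le> a" "b \<le> T"
    and meas: "\<And>j. j \<in> A \<Longrightarrow> (\<lambda>s. \<phi> j s * indicator {0<..T} s) \<in> borel_measurable borel"
    and bound: "\<And>s. s \<in> {0<..T} \<Longrightarrow> (\<Sum>j\<in>A. c j * \<bar>\<phi> j s\<bar>) \<le> \<Phi> s"
  shows "ennreal (\<Sum>j\<in>A. c j * \<bar>integral {a..b} (\<lambda>\<tau>. integral {0..\<tau>} (\<lambda>s. frac_kernel \<alpha> (\<tau> - s) * \<phi> j s))\<bar>)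
     \<le> (\<integral>\<^sup>+\<tau>. (\<integral>\<^sup>+s. ennreal (frac_kernel \<alpha> (\<tau> - s) * \<Phi> s) * indicator {0<..\<tau>} s \<partial>lborel) * indicator {a..b} \<tau> \<partial>lborel)"
proof -
  let ?Z = "\<lambda>j. integral {a..b} (\<lambda>\<tau>. integral {0..\<tau>} (\<lambda>s. frac_kernel \<alpha> (\<tau> - s) * \<phi> j s))"
  define \<psi> where "\<psi> j s = \<bar>\<phi> j s * indicator {0<..T} s\<bar>" for j s
  have [measurable]: "\<psi> j \<in> borel_measurable borel" if "j \<in> A" for j
    unfolding \<psi>_def using meas[OF that] by measurable
  define D where "D = {(\<tau>, s). 0 < s \<and> s \<le> \<tau> \<and> a \<le> \<tau> \<and> \<tau> \<le> (b::real)}"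
  have "Measurable.pred (borel \<Otimes>\<^sub>M borel) (\<lambda>x::real \<times> real. 0 < snd x \<and> snd x \<le> fst x \<and> a \<le> fst x \<and> fst x \<le> b)" by measurable
  then have [measurable]: "D \<in> sets (borel \<Otimes>\<^sub>M borel)"
    by (simp add: pred_def space_pair_measure D_def case_prod_beta')
  let ?F = "\<lambda>j \<tau> s. ennreal (frac_kernel \<alpha> (\<tau> - s) * (c j * \<psi> j s)) * indicator D (\<tau>, s)"
  have single: "ennreal (c j * \<bar>?Z j\<bar>)
      \<le> (\<integral>\<^sup>+\<tau>. \<integral>\<^sup>+s. ?F j \<tau> s \<partial>lborel \<partial>lborel)" if j: "j \<in> A" for j
  proof -
    have [measurable]: "\<psi> j \<in> borel_measurable borel" using j by measurable
    have "ennreal \<bar>?Z j\<bar>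
       \<le> (\<integral>\<^sup>+\<tau>. ennreal \<bar>integral {0..\<tau>} (\<lambda>s. frac_kernel \<alpha> (\<tau> - s) * \<phi> j s)\<bar> * indicator {a..b} \<tau> \<partial>lborel)"
      by (rule abs_integral_le_nn_integral)
    also have "\<dots> \<le> (\<integral>\<^sup>+\<tau>. \<integral>\<^sup>+s. ennreal (frac_kernel \<alpha> (\<tau> - s) * \<psi> j s) * indicator D (\<tau>, s) \<partial>lborel \<partial>lborel)"
    proof (rule nn_integral_mono)
      fix \<tau> :: real
      show "ennreal \<bar>integral {0..\<tau>} (\<lambda>s. frac_kernel \<alpha> (\<tau> - s) * \<phi> j s)\<bar> * indicator {a..b} \<tau>
         \<le> (\<integral>\<^sup>+s. ennreal (frac_kernel \<alpha> (\<tau> - s) * \<psi> j s) * indicator D (\<tau>, s) \<partial>lborel)"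
      proof (cases "\<tau> \<in> {a..b}")
        case True
        have "ennreal \<bar>integral {0..\<tau>} (\<lambda>s. frac_kernel \<alpha> (\<tau> - s) * \<phi> j s)\<bar>
           \<le> (\<integral>\<^sup>+s. ennreal \<bar>frac_kernel \<alpha> (\<tau> - s) * \<phi> j s\<bar> * indicator {0..\<tau>} s \<partial>lborel)"
          by (rule abs_integral_le_nn_integral)
        also have "\<dots> = (\<integral>\<^sup>+s. ennreal (frac_kernel \<alpha> (\<tau> - s) * \<psi> j s) * indicator D (\<tau>, s) \<partial>lborel)"
        \<comment> \<open>The point \<open>s = 0\<close>, where no bound is given, has measure zero.\<close>
        proof (rule nn_integral_cong_AE, use AE_lborel_singleton[of 0] in eventually_elim)
          case (elim s)
          then show ?case using True ab \<alpha>
            by (auto simp: \<psi>_def D_def abs_mult frac_kernel_nonneg split: split_indicator)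
        qed
        finally show ?thesis using True by simp
      qed simp
    qed
    finally have "ennreal (c j) * ennreal \<bar>?Z j\<bar>
       \<le> ennreal (c j) * (\<integral>\<^sup>+\<tau>. \<integral>\<^sup>+s. ennreal (frac_kernel \<alpha> (\<tau> - s) * \<psi> j s) * indicator D (\<tau>, s) \<partial>lborel \<partial>lborel)"
      by (rule mult_left_mono) simp
    also have "\<dots> = (\<integral>\<^sup>+\<tau>. \<integral>\<^sup>+s. ennreal (c j) * (ennreal (frac_kernel \<alpha> (\<tau> - s) * \<psi> j s) * indicator D (\<tau>, s)) \<partial>lborel \<partial>lborel)"
      by (simp add: nn_integral_cmult)
    also have "\<dots> = (\<integral>\<^sup>+\<tau>. \<integral>\<^sup>+s. ?F j \<tau> s \<partial>lborel \<partial>lborel)"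
      using c[OF j] \<alpha> by (intro nn_integral_cong) (simp add: ennreal_mult' frac_kernel_nonneg mult_ac)
    finally show ?thesis using c[OF j] by (simp add: ennreal_mult)
  qed
  have "ennreal (\<Sum>j\<in>A. c j * \<bar>?Z j\<bar>)
     = (\<Sum>j\<in>A. ennreal (c j * \<bar>?Z j\<bar>))"
    using c by (intro sum_ennreal[symmetric]) auto
  also have "\<dots> \<le> (\<Sum>j\<in>A. \<integral>\<^sup>+\<tau>. \<integral>\<^sup>+s. ?F j \<tau> s \<partial>lborel \<partial>lborel)" by (intro sum_mono single)
  also have "\<dots> = (\<integral>\<^sup>+\<tau>. \<integral>\<^sup>+s. (\<Sum>j\<in>A. ?F j \<tau> s) \<partial>lborel \<partial>lborel)"
  proof -
    have "(\<Sum>j\<in>A. \<integral>\<^sup>+\<tau>. \<integral>\<^sup>+s. ?F j \<tau> s \<partial>lborel \<partial>lborel) = (\<integral>\<^sup>+\<tau>. (\<Sum>j\<in>A. \<integral>\<^sup>+s. ?F j \<tau> s \<partial>lborel) \<partial>lborel)"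
      by (rule nn_integral_sum[symmetric]) measurable
    also have "\<dots> = (\<integral>\<^sup>+\<tau>. \<integral>\<^sup>+s. (\<Sum>j\<in>A. ?F j \<tau> s) \<partial>lborel \<partial>lborel)"
      by (intro nn_integral_cong nn_integral_sum[symmetric]) measurable
    finally show ?thesis .
  qed
  also have "\<dots> \<le> (\<integral>\<^sup>+\<tau>. \<integral>\<^sup>+s. ennreal (frac_kernel \<alpha> (\<tau> - s) * \<Phi> s) * indicator {0<..\<tau>} s * indicator {a..b} \<tau> \<partial>lborel \<partial>lborel)"
  proof (intro nn_integral_mono)
    fix \<tau> s :: real
    show "(\<Sum>j\<in>A. ?F j \<tau> s) \<le> ennreal (frac_kernel \<alpha> (\<tau> - s) * \<Phi> s) * indicator {0<..\<tau>} s * indicator {a..b} \<tau>"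
    proof (cases "(\<tau>, s) \<in> D")
      case True
      then have s: "s \<in> {0<..T}" using ab by (auto simp: D_def)
      have "(\<Sum>j\<in>A. ?F j \<tau> s) = ennreal (\<Sum>j\<in>A. frac_kernel \<alpha> (\<tau> - s) * (c j * \<psi> j s))"
        using True c \<alpha> by (subst sum_ennreal[symmetric]) (auto simp: frac_kernel_nonneg \<psi>_def)
      also have "\<dots> \<le> ennreal (frac_kernel \<alpha> (\<tau> - s) * \<Phi> s)"
        unfolding sum_distrib_left[symmetric] using bound[OF s] s \<alpha>
        by (intro ennreal_leI mult_left_mono) (auto simp: \<psi>_def frac_kernel_nonneg)
      finally show ?thesis using True by (simp add: D_def)
    qed simp
  qed
  also have "\<dots> \<le> (\<integral>\<^sup>+\<tau>. (\<integral>\<^sup>+s. ennreal (frac_kernel \<alpha> (\<tau> - s) * \<Phi> s) * indicator {0<..\<tau>} s \<partial>lborel) * indicator {a..b} \<tau> \<partial>lborel)"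
    by (rule nn_integral_mono) (auto split: split_indicator)
  finally show ?thesis .
qed

definition singular_conv :: "real \<Rightarrow> real \<Rightarrow> real \<Rightarrow> ennreal" where
  "singular_conv \<alpha> p \<tau> = (\<integral>\<^sup>+s. ennreal (frac_kernel \<alpha> (\<tau> - s) * s powr (p - 1)) * indicator {0<..\<tau>} s \<partial>lborel)"

lemma borel_singular_conv [measurable]: "singular_conv \<alpha> p \<in> borel_measurable borel"
proof -
  have "singular_conv \<alpha> p = (\<lambda>\<tau>. \<integral>\<^sup>+s. ennreal (frac_kernel \<alpha> (\<tau> - s) * s powr (p - 1)) * indicator {(\<tau>, s). 0 < s \<and> s \<le> \<tau>} (\<tau>, s) \<partial>lborel)"
    unfolding singular_conv_def by (auto intro!: ext nn_integral_cong split: split_indicator)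
  then show ?thesis by simp
qed

lemma nn_integral_mesh_intervals:
  fixes t :: "nat \<Rightarrow> real"
  assumes "\<And>n. n \<in> {1..m} \<Longrightarrow> t (n - 1) \<le> t n" and [measurable]: "g \<in> borel_measurable borel"
  shows "(\<Sum>n=1..m. \<integral>\<^sup>+\<tau>. g \<tau> * indicator {t (n - 1)..t n} \<tau> \<partial>lborel) = (\<integral>\<^sup>+\<tau>. g \<tau> * indicator {t 0..t m::real} \<tau> \<partial>lborel)
    \<and> t 0 \<le> t m"
  using assms(1)
proof (induction m)
  case 0
  have "AE \<tau> in lborel. g \<tau> * indicator {t 0..t 0} \<tau> = 0"
    using AE_lborel_singleton[of "t 0"] by eventually_elim auto
  from nn_integral_cong_AE[OF this] show ?case by simp
next
  case (Suc m)
  have IH: "(\<Sum>n=1..m. \<integral>\<^sup>+\<tau>. g \<tau> * indicator {t (n - 1)..t n} \<tau> \<partial>lborel) = (\<integral>\<^sup>+\<tau>. g \<tau> * indicator {t 0..t m::real} \<tau> \<partial>lborel)"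
    "t 0 \<le> t m" using Suc.IH Suc.prems by auto
  have le: "t m \<le> t (Suc m)" using Suc.prems[of "Suc m"] by simp
  have "(\<Sum>n=1..Suc m. \<integral>\<^sup>+\<tau>. g \<tau> * indicator {t (n - 1)..t n} \<tau> \<partial>lborel)
     = (\<integral>\<^sup>+\<tau>. g \<tau> * indicator {t 0..t m} \<tau> + g \<tau> * indicator {t m..t (Suc m)} \<tau> \<partial>lborel)"
    using IH(1) by (simp add: nn_integral_add)
  also have "\<dots> = (\<integral>\<^sup>+\<tau>. g \<tau> * indicator {t 0..t (Suc m)} \<tau> \<partial>lborel)"
    by (rule nn_integral_cong_AE, use AE_lborel_singleton[of "t m"] in eventually_elim)
       (use IH(2) le in \<open>auto split: split_indicator\<close>)
  finally show ?case using IH(2) le by simp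
qed

text \<open>After exchanging the integrals, the integral of the kernel over \<open>[s, T]\<close> is at most
  \<open>T\<^sup>\<alpha> / \<Gamma>(\<alpha> + 1)\<close>.\<close>

lemma singular_conv_integral_le:
  assumes \<alpha>: "0 < \<alpha>" and p: "0 < p" and T: "0 \<le> T"
  shows "(\<integral>\<^sup>+\<tau>. singular_conv \<alpha> p \<tau> * indicator {0..T} \<tau> \<partial>lborel) \<le> ennreal (T powr \<alpha> / Gamma (\<alpha> + 1) * (T powr p / p))"
proof -
  define D where "D = {(\<tau>, s). 0 < s \<and> s \<le> \<tau> \<and> \<tau> \<le> (T::real)}"
  have "Measurable.pred (borel \<Otimes>\<^sub>M borel) (\<lambda>x::real \<times> real. 0 < snd x \<and> snd x \<le> fst x \<and> fst x \<le> T)" by measurable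
  then have [measurable]: "D \<in> sets (borel \<Otimes>\<^sub>M borel)"
    by (simp add: pred_def space_pair_measure D_def case_prod_beta')
  have G: "0 < Gamma (\<alpha> + 1)" using \<alpha> by (intro Gamma_real_pos) auto
  let ?g = "\<lambda>\<tau> s. ennreal (frac_kernel \<alpha> (\<tau> - s) * s powr (p - 1)) * indicator D (\<tau>, s)"
  have "(\<integral>\<^sup>+\<tau>. singular_conv \<alpha> p \<tau> * indicator {0..T} \<tau> \<partial>lborel) = (\<integral>\<^sup>+\<tau>. \<integral>\<^sup>+s. ?g \<tau> s \<partial>lborel \<partial>lborel)"
  proof (rule nn_integral_cong)
    fix \<tau> :: real
    show "singular_conv \<alpha> p \<tau> * indicator {0..T} \<tau> = (\<integral>\<^sup>+s. ?g \<tau> s \<partial>lborel)"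
    proof (cases "\<tau> \<in> {0..T}")
      case True
      then show ?thesis unfolding singular_conv_def by (auto simp: D_def intro!: nn_integral_cong split: split_indicator)
    next
      case False
      then have "(\<integral>\<^sup>+s. ?g \<tau> s \<partial>lborel) = (\<integral>\<^sup>+(s::real). 0 \<partial>lborel)" by (intro nn_integral_cong) (auto simp: D_def)
      then show ?thesis using False by simp
    qed
  qed
  also have "\<dots> = (\<integral>\<^sup>+s. \<integral>\<^sup>+\<tau>. ?g \<tau> s \<partial>lborel \<partial>lborel)"
    by (rule lborel_pair.Fubini') measurable
  also have "\<dots> \<le> (\<integral>\<^sup>+s. ennreal (T powr \<alpha> / Gamma (\<alpha> + 1)) * (ennreal (s powr (p - 1)) * indicator {0..T} s) \<partial>lborel)"
  proof (rule nn_integral_mono)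
    fix s :: real
    show "(\<integral>\<^sup>+\<tau>. ?g \<tau> s \<partial>lborel) \<le> ennreal (T powr \<alpha> / Gamma (\<alpha> + 1)) * (ennreal (s powr (p - 1)) * indicator {0..T} s)"
    proof (cases "s \<in> {0<..T}")
      case True
      have "(\<integral>\<^sup>+\<tau>. ?g \<tau> s \<partial>lborel) = (\<integral>\<^sup>+\<tau>. ennreal (s powr (p - 1)) * (ennreal (frac_kernel \<alpha> (\<tau> - s)) * indicator {s..T} \<tau>) \<partial>lborel)"
        using True \<alpha> by (intro nn_integral_cong) (auto simp: D_def ennreal_mult frac_kernel_nonneg mult_ac split: split_indicator)
      also have "\<dots> = ennreal (s powr (p - 1)) * (\<integral>\<^sup>+\<tau>. ennreal (frac_kernel \<alpha> (\<tau> - s)) * indicator {s..T} \<tau> \<partial>lborel)"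
        by (rule nn_integral_cmult) measurable
      also have "(\<integral>\<^sup>+\<tau>. ennreal (frac_kernel \<alpha> (\<tau> - s)) * indicator {s..T} \<tau> \<partial>lborel) = ennreal ((T - s) powr \<alpha> / Gamma (\<alpha> + 1))"
      proof (rule nn_integral_has_integral_lebesgue')
        show "((\<lambda>\<tau>. frac_kernel \<alpha> (\<tau> - s)) has_integral (T - s) powr \<alpha> / Gamma (\<alpha> + 1)) {s..T}"
          using has_integral_divide[OF has_integral_powr_shift[of "\<alpha> - 1" s T], of "Gamma \<alpha>"] True \<alpha>
          by (simp add: frac_kernel_def[abs_def] Gamma_plus1_pos)
      qed (use \<alpha> in \<open>auto simp: frac_kernel_nonneg\<close>)
      also have "ennreal ((T - s) powr \<alpha> / Gamma (\<alpha> + 1)) \<le> ennreal (T powr \<alpha> / Gamma (\<alpha> + 1))"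
        using True \<alpha> G by (intro ennreal_leI divide_right_mono powr_mono2) auto
      finally have "(\<integral>\<^sup>+\<tau>. ?g \<tau> s \<partial>lborel) \<le> ennreal (s powr (p - 1)) * ennreal (T powr \<alpha> / Gamma (\<alpha> + 1))"
        by (simp add: mult_left_mono)
      then show ?thesis using True by (simp add: mult.commute)
    next
      case False
      then have "(\<integral>\<^sup>+\<tau>. ?g \<tau> s \<partial>lborel) = (\<integral>\<^sup>+(\<tau>::real). 0 \<partial>lborel)" by (intro nn_integral_cong) (auto simp: D_def)
      then show ?thesis by simp
    qed
  qed
  also have "\<dots> = ennreal (T powr \<alpha> / Gamma (\<alpha> + 1)) * (\<integral>\<^sup>+s. ennreal (s powr (p - 1)) * indicator {0..T} s \<partial>lborel)"
    by (rule nn_integral_cmult) measurable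
  also have "(\<integral>\<^sup>+s. ennreal (s powr (p - 1)) * indicator {0..T} s \<partial>lborel) = ennreal (T powr p / p)"
    using has_integral_powr_from_0[of "p - 1" T] p T by (intro nn_integral_has_integral_lebesgue') auto
  also have "ennreal (T powr \<alpha> / Gamma (\<alpha> + 1)) * ennreal (T powr p / p) = ennreal (T powr \<alpha> / Gamma (\<alpha> + 1) * (T powr p / p))"
    by (rule ennreal_mult[symmetric]) (use G p in auto)
  finally show ?thesis .
qed

text \<open>A mean value inequality for the grid norm: apply the scalar one to the product with the increment
  \<open>w(b) - w(a)\<close> itself.\<close>

lemma grid_norm_increment_le:
  fixes w w' :: "real \<Rightarrow> nat \<Rightarrow> real"
  assumes h: "0 \<le> h" and ab: "a \<le> b"
    and w: "\<And>\<tau> j. \<tau> \<in> {a..b} \<Longrightarrow> j \<in> {1..J - 1} \<Longrightarrow> ((\<lambda>\<tau>. w \<tau> j) has_real_derivative w' \<tau> j) (at \<tau> within {a..b})"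
    and H: "\<And>\<tau>. \<tau> \<in> {a..b} \<Longrightarrow> (H has_real_derivative D \<tau>) (at \<tau> within {a..b})"
    and bound: "\<And>\<tau>. \<tau> \<in> {a..b} \<Longrightarrow> grid_norm h J (w' \<tau>) \<le> D \<tau>"
  shows "grid_norm h J (\<lambda>j. w b j - w a j) \<le> H b - H a"
proof -
  have mono: "f a \<le> f b" if f: "\<And>\<tau>. \<tau> \<in> {a..b} \<Longrightarrow> (f has_real_derivative f' \<tau>) (at \<tau> within {a..b})"
    and f': "\<And>\<tau>. \<tau> \<in> {a..b} \<Longrightarrow> 0 \<le> f' \<tau>" for f f' :: "real \<Rightarrow> real"
  proof (rule DERIV_nonneg_imp_increasing_open[OF ab])
    show "\<exists>y. (f has_real_derivative y) (at x) \<and> 0 \<le> y" if "a < x" "x < b" for x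
      using f[of x] f'[of x] that by (auto simp: at_within_Icc_at)
    show "continuous_on {a..b} f"
      using f by (intro DERIV_continuous_on) auto
  qed
  define v where "v j = w b j - w a j" for j
  let ?n = "grid_norm h J v"
  have n0: "0 \<le> ?n" using h by (rule grid_norm_nonneg)
  have D0: "0 \<le> D \<tau>" if "\<tau> \<in> {a..b}" for \<tau> using bound[OF that] grid_norm_nonneg[OF h, of J "w' \<tau>"] by linarith
  have H0: "H a \<le> H b" using mono[OF H] D0 by blast
  have "?n * H a - grid_inner h J (w a) v \<le> ?n * H b - grid_inner h J (w b) v"
  proof (rule mono)
    fix \<tau> assume \<tau>: "\<tau> \<in> {a..b}"
    show "((\<lambda>\<tau>. ?n * H \<tau> - grid_inner h J (w \<tau>) v) has_real_derivative ?n * D \<tau> - grid_inner h J (w' \<tau>) v) (at \<tau> within {a..b})"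
      unfolding grid_inner_def using w[OF \<tau>] H[OF \<tau>]
      by (auto intro!: derivative_eq_intros)
    have "grid_inner h J (w' \<tau>) v \<le> grid_norm h J (w' \<tau>) * ?n"
      using grid_inner_Cauchy_Schwarz[OF h, of J "w' \<tau>" v] by linarith
    also have "\<dots> \<le> ?n * D \<tau>" using mult_left_mono[OF bound[OF \<tau>] n0] by (simp add: mult.commute)
    finally show "0 \<le> ?n * D \<tau> - grid_inner h J (w' \<tau>) v" by simp
  qed
  moreover have "grid_inner h J (w b) v - grid_inner h J (w a) v = ?n\<^sup>2"
    unfolding grid_norm_sq[OF h] grid_inner_diff_left[symmetric] unfolding v_def[abs_def] ..
  ultimately have "?n * ?n \<le> ?n * (H b - H a)" by (simp add: power2_eq_square algebra_simps)
  then have "?n \<le> H b - H a" using n0 H0 by (cases "?n = 0") (auto simp: mult_le_cancel_left)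
  then show ?thesis unfolding v_def[abs_def] .
qed

section \<open>First-order consistency\<close>

text \<open>One member of the family. The constants \<open>interp_const\<close>, \<open>consistency_const\<close> and \<open>error_bound\<close>
  defined below do not involve \<open>J\<close>, \<open>N\<close>, \<open>h\<close>, \<open>k\<close>, \<open>t\<close> and \<open>fh\<close>, hence are the same for all members.\<close>

locale burgers_discretization =
  fixes L T \<alpha> \<gamma> \<sigma> M c0 Cg cg Cf CR :: real
    and f f' f'' :: "real \<Rightarrow> real \<Rightarrow> real"
    and u u_t u_x u_xx u_xx' u_xx'' :: "real \<Rightarrow> real \<Rightarrow> real"
    and u0 :: "real \<Rightarrow> real"
    and J N :: nat and h k :: real and t :: "nat \<Rightarrow> real" and fh :: "nat \<Rightarrow> nat \<Rightarrow> real"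
  assumes L: "0 < L" and T: "0 < T" and \<alpha>: "0 < \<alpha>" "\<alpha> < 1"
    and \<sigma>: "0 < \<sigma>" and M: "0 < M" and Cg: "0 < Cg"
    and \<gamma>: "1 \<le> \<gamma>" "\<gamma> = 2 / \<sigma>"
    and solution: "ibvp_solution L T \<alpha> f u0 u u_t u_x u_xx"
    and bounded: "\<And>x \<tau>. x \<in> {0..L} \<Longrightarrow> \<tau> \<in> {0<..T} \<Longrightarrow> \<bar>u x \<tau>\<bar> \<le> c0 \<and> \<bar>u_x x \<tau>\<bar> \<le> c0"
    and time_derivative: "time_derivative L T u_xx u_xx'"
    and J: "0 < J" and h_eq: "h = L / real J"
    and k: "0 < k" and mesh: "graded_mesh T Cg cg \<gamma> k N t"
    and truncation: "trunc2_bound CR h J N \<alpha> t f fh u u_xx"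
    and source: "source_approx Cf h J N t f f' f'' fh"
    and regular_u: "regularity_bound M \<sigma> T h J u_xx' u_xx''"
    and regular_f: "regularity_bound M \<sigma> T h J f' f''"
begin

abbreviation p where "p \<equiv> \<sigma> / 2"

lemma p: "0 < p" "p \<le> 1" "1 - 1 / \<gamma> = 1 - p"
proof -
  show "0 < p" using \<sigma> by simp
  show "p \<le> 1" using \<gamma> \<sigma> by (simp add: field_simps)
  show "1 - 1 / \<gamma> = 1 - p" using \<gamma>(2) by simp
qed

lemma c0_nonneg: "0 \<le> c0"
  using bounded[of 0 T] L T by force

lemma h: "0 < h" "real J * h = L"
  using L J by (simp_all add: h_eq)

lemma grid_point: "j \<in> {1..J - 1} \<Longrightarrow> real j * h \<in> {0<..<L}"
proof -
  assume j: "j \<in> {1..J - 1}"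
  then have "real j * h < real J * h" using h(1) by (intro mult_strict_right_mono) auto
  then show "real j * h \<in> {0<..<L}" using j h by auto
qed

lemma t0: "t 0 = 0" and tN: "t N = T" and N: "0 < N"
  using mesh by (auto simp: graded_mesh_def)

lemma mesh_less: "n \<in> {1..N} \<Longrightarrow> t (n - 1) < t n"
  using mesh by (auto simp: graded_mesh_def)

lemma mesh_mono: "i \<le> j \<Longrightarrow> j \<le> N \<Longrightarrow> t i \<le> t j"
proof (induction rule: dec_induct)
  case (step j)
  then show ?case using mesh_less[of "Suc j"] by auto
qed simp

lemma mesh_nonneg: "n \<le> N \<Longrightarrow> 0 \<le> t n" and mesh_le_T: "n \<le> N \<Longrightarrow> t n \<le> T"
  using mesh_mono[of n N] mesh_mono[of 0 n] by (auto simp: t0 tN)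

lemma mesh_pred_nonneg: "n \<in> {1..N} \<Longrightarrow> 0 \<le> t (n - 1)"
  by (rule mesh_nonneg) auto

lemma mesh_pos: "n \<in> {1..N} \<Longrightarrow> 0 < t n"
  using mesh_less[of n] mesh_pred_nonneg[of n] by linarith

lemma step_pos: "n \<in> {1..N} \<Longrightarrow> 0 < step t n"
  using mesh_less by (simp add: step_def)

lemma step_le_k: "n \<in> {1..N} \<Longrightarrow> step t n \<le> Cg * k"
proof -
  assume n: "n \<in> {1..N}"
  then have "step t n \<le> Cg * k * min 1 (t n powr (1 - 1 / \<gamma>))" using mesh by (auto simp: graded_mesh_def)
  also have "\<dots> \<le> Cg * k * 1" using Cg k by (intro mult_left_mono) auto
  finally show "step t n \<le> Cg * k" by simp
qed

lemma step_le_graded: "n \<in> {1..N} \<Longrightarrow> step t n \<le> Cg * k * t n powr (1 - p)"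
proof -
  assume n: "n \<in> {1..N}"
  then have "step t n \<le> Cg * k * min 1 (t n powr (1 - 1 / \<gamma>))" using mesh by (auto simp: graded_mesh_def)
  also have "\<dots> \<le> Cg * k * t n powr (1 - 1 / \<gamma>)" using Cg k by (intro mult_left_mono) auto
  finally show "step t n \<le> Cg * k * t n powr (1 - p)" unfolding p(3) .
qed

lemma step_le_T: "n \<in> {1..N} \<Longrightarrow> step t n \<le> T"
  using mesh_le_T[of n] mesh_pred_nonneg[of n] by (simp add: step_def)

lemma mesh_ratio: "n \<in> {2..N} \<Longrightarrow> t n \<le> Cg * t (n - 1)"
  using mesh by (auto simp: graded_mesh_def)

text \<open>With \<open>\<gamma> = 2/\<sigma>\<close> the grading exponent \<open>1 - 1/\<gamma>\<close> is \<open>1 - p\<close>, and \<open>k\<^sub>1 = t\<^sub>1\<close>.\<close>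

lemma first_step: "t 1 powr p \<le> Cg * k"
proof -
  have t1: "0 < t 1" using mesh_pos[of 1] N by simp
  have "t 1 \<le> Cg * k * t 1 powr (1 - p)" using step_le_graded[of 1] N by (simp add: step_def t0)
  then have "t 1 * t 1 powr (p - 1) \<le> Cg * k * t 1 powr (1 - p) * t 1 powr (p - 1)"
    by (intro mult_right_mono) auto
  also have "\<dots> = Cg * k" using t1 by (simp add: mult.assoc powr_add[symmetric])
  finally show ?thesis using t1 by (simp add: powr_mult_base)
qed

lemma regular_bounds:
  assumes "regularity_bound M \<sigma> T h J g' g''" "\<tau> \<in> {0<..T}"
  shows "grid_norm_fun h J (\<lambda>x. g' x \<tau>) \<le> M * \<tau> powr (2 * p - 2)"
    and "grid_norm_fun h J (\<lambda>x. g'' x \<tau>) \<le> M * \<tau> powr (2 * p - 3)"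
    and "\<tau> * grid_norm_fun h J (\<lambda>x. g' x \<tau>) \<le> M * \<tau> powr (2 * p - 1)"
proof -
  have \<tau>: "0 < \<tau>" using assms(2) by simp
  let ?a = "grid_norm_fun h J (\<lambda>x. g' x \<tau>)" and ?b = "grid_norm_fun h J (\<lambda>x. g'' x \<tau>)"
  have nn: "0 \<le> ?a" "0 \<le> ?b" using h(1) by (simp_all add: grid_norm_fun_def grid_norm_nonneg)
  have s: "\<tau> * ?a + \<tau>\<^sup>2 * ?b \<le> M * \<tau> powr (2 * p - 1)"
    using assms by (simp add: regularity_bound_def)
  moreover have "0 \<le> \<tau> * ?a" "0 \<le> \<tau>\<^sup>2 * ?b" using nn \<tau> by simp_all
  ultimately have 1: "\<tau> * ?a \<le> M * \<tau> powr (2 * p - 1)" and 2: "\<tau>\<^sup>2 * ?b \<le> M * \<tau> powr (2 * p - 1)" by linarith+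
  show "\<tau> * ?a \<le> M * \<tau> powr (2 * p - 1)" by (rule 1)
  have "\<tau> * \<tau> powr (2 * p - 2) = \<tau> powr (2 * p - 1)" using powr_mult_base[of \<tau> "2 * p - 2"] \<tau> by simp
  then have "\<tau> * ?a \<le> \<tau> * (M * \<tau> powr (2 * p - 2))" using 1 by (simp add: mult.left_commute)
  then show "?a \<le> M * \<tau> powr (2 * p - 2)" using \<tau> by simp
  have "\<tau>\<^sup>2 * \<tau> powr (2 * p - 3) = \<tau> powr (2 * p - 1)"
    using powr_mult_base[of \<tau> "2 * p - 3"] powr_mult_base[of \<tau> "2 * p - 2"] \<tau> by (simp add: power2_eq_square mult.assoc)
  then have "\<tau>\<^sup>2 * ?b \<le> \<tau>\<^sup>2 * (M * \<tau> powr (2 * p - 3))" using 2 by (simp add: mult.left_commute)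
  then show "?b \<le> M * \<tau> powr (2 * p - 3)" using \<tau> by simp
qed

lemma u_xx_derivative:
  assumes "j \<in> {1..J - 1}" "0 < a" "b \<le> T" "\<tau> \<in> {a..b}"
  shows "((\<lambda>\<tau>. u_xx (real j * h) \<tau>) has_real_derivative u_xx' (real j * h) \<tau>) (at \<tau> within {a..b})"
proof -
  have "((\<lambda>\<tau>. u_xx (real j * h) \<tau>) has_real_derivative u_xx' (real j * h) \<tau>) (at \<tau> within {0<..T})"
    using time_derivative grid_point[OF assms(1)] assms(2-4) by (auto simp: time_derivative_def)
  then show ?thesis by (rule has_field_derivative_subset) (use assms in auto)
qed

lemma u_xx_increment:
  assumes "0 < a" "a \<le> b" "b \<le> T"
    and "\<And>\<tau>. \<tau> \<in> {a..b} \<Longrightarrow> (H has_real_derivative D \<tau>) (at \<tau> within {a..b})"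
    and "\<And>\<tau>. \<tau> \<in> {a..b} \<Longrightarrow> M * \<tau> powr (2 * p - 2) \<le> D \<tau>"
  shows "grid_norm h J (\<lambda>j. u_xx (real j * h) b - u_xx (real j * h) a) \<le> H b - H a"
proof (rule grid_norm_increment_le[where w = "\<lambda>\<tau> j. u_xx (real j * h) \<tau>" and w' = "\<lambda>\<tau> j. u_xx' (real j * h) \<tau>"])
  fix \<tau> assume \<tau>: "\<tau> \<in> {a..b}"
  then have "grid_norm h J (\<lambda>j. u_xx' (real j * h) \<tau>) \<le> M * \<tau> powr (2 * p - 2)"
    using regular_bounds(1)[OF regular_u, of \<tau>] assms(1,3) by (simp add: grid_norm_fun_def)
  then show "grid_norm h J (\<lambda>j. u_xx' (real j * h) \<tau>) \<le> D \<tau>" using assms(5)[OF \<tau>] by linarith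
qed (use assms h(1) in \<open>auto intro!: u_xx_derivative\<close>)

text \<open>The derivative may be as large as \<open>\<tau>\<^sup>2\<^sup>p\<^sup>-\<^sup>2\<close>, which need not be integrable at \<open>0\<close>. One half of the
  exponent is evaluated at the left end \<open>a\<close>; the other half has the antiderivative \<open>\<tau>\<^sup>p / p\<close>.\<close>

lemma u_xx_increment_singular:
  assumes "0 < a" "a \<le> b" "b \<le> T"
  shows "grid_norm h J (\<lambda>j. u_xx (real j * h) b - u_xx (real j * h) a) \<le> M / p * a powr (p - 1) * b powr p"
proof -
  let ?e = "grid_norm h J (\<lambda>j. u_xx (real j * h) b - u_xx (real j * h) a)"
  have "?e \<le> M / p * a powr (p - 1) * b powr p - M / p * a powr (p - 1) * a powr p"
  proof (rule u_xx_increment[OF assms])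
    fix \<tau> assume \<tau>: "\<tau> \<in> {a..b}"
    then show "((\<lambda>\<tau>. M / p * a powr (p - 1) * \<tau> powr p) has_real_derivative M * a powr (p - 1) * \<tau> powr (p - 1)) (at \<tau> within {a..b})"
      using assms(1) p(1) by (auto intro!: derivative_eq_intros)
    have "\<tau> powr (2 * p - 2) = \<tau> powr (p - 1) * \<tau> powr (p - 1)" by (simp add: powr_add[symmetric])
    also have "\<dots> \<le> a powr (p - 1) * \<tau> powr (p - 1)"
      using \<tau> assms(1) p(2) by (intro mult_right_mono powr_mono2') auto
    finally show "M * \<tau> powr (2 * p - 2) \<le> M * a powr (p - 1) * \<tau> powr (p - 1)" using M by simp
  qed
  moreover have "0 \<le> M / p * a powr (p - 1) * a powr p" using M p(1) by simp
  ultimately show ?thesis by linarith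
qed

lemma u_xx_increment_regular:
  assumes "0 < a" "a \<le> b" "b \<le> T"
  shows "grid_norm h J (\<lambda>j. u_xx (real j * h) b - u_xx (real j * h) a) \<le> M * a powr (2 * p - 2) * (b - a)"
proof -
  have "grid_norm h J (\<lambda>j. u_xx (real j * h) b - u_xx (real j * h) a) \<le> M * a powr (2 * p - 2) * b - M * a powr (2 * p - 2) * a"
  proof (rule u_xx_increment[OF assms])
    fix \<tau> assume \<tau>: "\<tau> \<in> {a..b}"
    show "((\<lambda>\<tau>. M * a powr (2 * p - 2) * \<tau>) has_real_derivative M * a powr (2 * p - 2)) (at \<tau> within {a..b})"
      by (auto intro!: derivative_eq_intros)
    show "M * \<tau> powr (2 * p - 2) \<le> M * a powr (2 * p - 2)"
      using \<tau> assms(1) p(2) M by (intro mult_left_mono powr_mono2') auto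
  qed
  then show ?thesis by (simp add: right_diff_distrib)
qed

definition interp_const where
  "interp_const = M / p * Cg + M * Cg powr (4 - 3 * p)"

definition interp_error where
  "interp_error s j = u_xx (real j * h) s - mesh_interpolant t (u_xx (real j * h)) s"

lemma interp_const_nonneg: "0 \<le> interp_const"
  using M p(1) Cg by (simp add: interp_const_def)

lemma mesh_interval:
  assumes "s \<in> {0<..T}"
  obtains n where "n \<in> {1..N}" "t (n - 1) < s" "s \<le> t n" "(LEAST n. s \<le> t n) = n"
proof -
  let ?n = "LEAST n. s \<le> t n"
  have sN: "s \<le> t N" using assms tN by simp
  have a: "s \<le> t ?n" using sN by (rule LeastI)
  have b: "?n \<le> N" using sN by (rule Least_le)
  have "?n \<noteq> 0" using a assms t0 by (metis greaterThanAtMost_iff not_le)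
  then have n: "?n \<in> {1..N}" using b by simp
  moreover have "\<not> s \<le> t (?n - 1)" using \<open>?n \<noteq> 0\<close> by (intro not_less_Least) simp
  ultimately show ?thesis using that[of ?n] a by simp
qed

text \<open>In the first interval \<open>u_xx_increment_singular\<close> is combined with \<open>t\<^sub>1\<^sup>p \<le> C k\<close>. In the later ones
  \<open>k\<^sub>n \<le> C k t\<^sub>n\<^sup>1\<^sup>-\<^sup>p\<close> turns the derivative bound \<open>s\<^sup>2\<^sup>p\<^sup>-\<^sup>2\<close> into \<open>s\<^sup>p\<^sup>-\<^sup>1\<close>, and consecutive mesh points
  are comparable. The same weight results in both cases.\<close>

lemma interp_error_bound:
  assumes s: "s \<in> {0<..T}"
  shows "grid_norm h J (interp_error s) \<le> interp_const * k * s powr (p - 1)"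
proof -
  let ?e = "\<lambda>b a. grid_norm h J (\<lambda>j. u_xx (real j * h) b - u_xx (real j * h) a)"
  obtain n where n: "n \<in> {1..N}" "t (n - 1) < s" "s \<le> t n" "(LEAST n. s \<le> t n) = n"
    using mesh_interval[OF s] .
  have s0: "0 < s" using s by simp
  show ?thesis
  proof (cases "n = 1")
    case True
    have "interp_error s = (\<lambda>j. - 1 * (u_xx (real j * h) (t 1) - u_xx (real j * h) s))"
      using n(4) True by (simp add: fun_eq_iff interp_error_def mesh_interpolant_def)
    then have "grid_norm h J (interp_error s) = ?e ((t 1)) s"
      by (simp only: grid_norm_scale)
    also have "\<dots> \<le> M / p * s powr (p - 1) * t 1 powr p"
      using s0 n True mesh_le_T[of 1] N by (intro u_xx_increment_singular) auto
    also have "\<dots> \<le> M / p * s powr (p - 1) * (Cg * k)"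
      using first_step M p(1) by (intro mult_left_mono) auto
    also have "\<dots> = M / p * Cg * k * s powr (p - 1)" by simp
    also have "\<dots> \<le> interp_const * k * s powr (p - 1)"
      unfolding interp_const_def using k M by (intro mult_right_mono) auto
    finally show ?thesis .
  next
    case False
    let ?a = "t (n - 1)" and ?b = "t n"
    have n2: "n \<in> {2..N}" using n(1) False by auto
    have "n - 1 \<in> {1..N}" using n2 by auto
    then have a: "0 < ?a" "?b \<le> Cg * ?a" "?b \<le> T" using n2 mesh_pos[of "n - 1"] mesh_ratio[of n] mesh_le_T[of n] by auto
    have e1: "?e s ?a \<le> M * ?a powr (2 * p - 2) * (s - ?a)"
      using a n s by (intro u_xx_increment_regular) auto
    have "?e ?b s \<le> M * s powr (2 * p - 2) * (?b - s)"
      using a n s by (intro u_xx_increment_regular) auto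
    also have "\<dots> \<le> M * ?a powr (2 * p - 2) * (?b - s)"
      using n a M p by (intro mult_right_mono mult_left_mono powr_mono2') auto
    finally have e2: "?e ?b s \<le> M * ?a powr (2 * p - 2) * (?b - s)" .
    \<comment> \<open>The interpolant is the mean of the two end values, so the error is the mean of two increments.\<close>
    have "interp_error s = (\<lambda>j. 1 / 2 * (u_xx (real j * h) s - u_xx (real j * h) ?a) + - 1 / 2 * (u_xx (real j * h) ?b - u_xx (real j * h) s))"
      using n(4) n2 by (simp add: fun_eq_iff interp_error_def mesh_interpolant_def field_simps)
    then have "grid_norm h J (interp_error s) \<le> grid_norm h J (\<lambda>j. 1 / 2 * (u_xx (real j * h) s - u_xx (real j * h) ?a))
        + grid_norm h J (\<lambda>j. - 1 / 2 * (u_xx (real j * h) ?b - u_xx (real j * h) s))"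
      using h(1) by (simp only: grid_norm_triangle less_imp_le)
    also have "\<dots> = 1 / 2 * ?e s ?a
        + 1 / 2 * ?e ?b s"
      unfolding grid_norm_scale by simp
    also have "\<dots> \<le> M * ?a powr (2 * p - 2) * step t n / 2"
      using e1 e2 by (simp add: step_def algebra_simps)
    also have "\<dots> \<le> M * ?a powr (2 * p - 2) * step t n"
      using M step_pos[OF n(1)] by simp
    also have "\<dots> \<le> M * (s / Cg) powr (2 * p - 2) * (Cg * k * (Cg * s) powr (1 - p))"
    proof (intro mult_mono mult_left_mono)
      have "s \<le> Cg * ?a" using n a by linarith
      then show "?a powr (2 * p - 2) \<le> (s / Cg) powr (2 * p - 2)"
        using s0 Cg p(2) by (intro powr_mono2') (auto simp: field_simps)
      have "Cg * ?a \<le> Cg * s" using n(2) Cg by simp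
      then have "?b powr (1 - p) \<le> (Cg * s) powr (1 - p)" using a p(2) n s0 by (intro powr_mono2) auto
      then show "step t n \<le> Cg * k * (Cg * s) powr (1 - p)"
        using step_le_graded[OF n(1)] Cg k by (meson mult_left_mono mult_pos_pos less_imp_le order_trans)
    qed (use M step_pos[OF n(1)] in auto)
    also have "\<dots> = M * (Cg powr (2 - 2 * p) * Cg * Cg powr (1 - p)) * k * (s powr (2 * p - 2) * s powr (1 - p))"
    proof -
      have "(s / Cg) powr (2 * p - 2) = s powr (2 * p - 2) * Cg powr (2 - 2 * p)"
        using s0 Cg powr_minus_divide[of Cg "2 * p - 2"] by (simp add: powr_divide)
      moreover have "(Cg * s) powr (1 - p) = Cg powr (1 - p) * s powr (1 - p)" using s0 Cg by (simp add: powr_mult)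
      ultimately show ?thesis by simp
    qed
    also have "Cg powr (2 - 2 * p) * Cg * Cg powr (1 - p) = Cg powr (4 - 3 * p)"
    proof -
      have "Cg powr (2 - 2 * p) * Cg * Cg powr (1 - p) = Cg powr (2 - 2 * p) * Cg powr 1 * Cg powr (1 - p)" using Cg by simp
      also have "\<dots> = Cg powr (4 - 3 * p)" unfolding powr_add[symmetric] by (simp add: algebra_simps)
      finally show ?thesis .
    qed
    also have "s powr (2 * p - 2) * s powr (1 - p) = s powr (p - 1)" by (simp add: powr_add[symmetric])
    also have "M * Cg powr (4 - 3 * p) * k * s powr (p - 1) \<le> interp_const * k * s powr (p - 1)"
      unfolding interp_const_def using k M p(1) Cg by (intro mult_right_mono) auto
    finally show ?thesis .
  qed
qed

lemma interp_error_measurable: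
  assumes "j \<in> {1..J - 1}"
  shows "(\<lambda>s. interp_error s j * indicator {0<..T} s) \<in> borel_measurable borel"
proof -
  let ?v = "u_xx (real j * h)"
  have "continuous_on {0<..T} ?v"
    using time_derivative grid_point[OF assms]
    by (intro DERIV_continuous_on[where D = "u_xx' (real j * h)"]) (auto simp: time_derivative_def)
  then have [measurable]: "(\<lambda>s. indicator {0<..T} s *\<^sub>R ?v s) \<in> borel_measurable borel"
    by (intro borel_measurable_continuous_on_indicator) auto
  have [measurable]: "(\<lambda>s. LEAST n. s \<le> t n) \<in> borel \<rightarrow>\<^sub>M count_space UNIV"
    by (rule measurable_Least) measurable
  have "(\<lambda>s. (\<lambda>n. if n \<le> 1 then ?v (t 1) else (?v (t n) + ?v (t (n - 1))) / 2) (LEAST n. s \<le> t n)) \<in> borel_measurable borel"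
    by (rule measurable_compose[of _ _ "count_space UNIV"]) measurable
  then have [measurable]: "mesh_interpolant t ?v \<in> borel_measurable borel"
    unfolding mesh_interpolant_def[abs_def] Let_def .
  have "(\<lambda>s. interp_error s j * indicator {0<..T} s) = (\<lambda>s. indicator {0<..T} s *\<^sub>R ?v s - indicator {0<..T} s * mesh_interpolant t ?v s)"
    by (auto simp: interp_error_def fun_eq_iff algebra_simps)
  moreover have "\<dots> \<in> borel_measurable borel" by measurable
  ultimately show ?thesis by simp
qed

text \<open>The second part of \<open>trunc1\<close>, multiplied by the step.\<close>

definition memory_error where
  "memory_error n j = integral {t (n - 1)..t n}
     (\<lambda>\<tau>. integral {0..\<tau>} (\<lambda>s. frac_kernel \<alpha> (\<tau> - s) * interp_error s j))"

text \<open>The share of one mesh interval in the double integral of \<open>singular_conv_integral_le\<close>; unlike pointwise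
  bounds in \<open>n\<close>, these shares can be summed without loss.\<close>

definition memory_mass where
  "memory_mass n = enn2real (\<integral>\<^sup>+\<tau>. singular_conv \<alpha> p \<tau> * indicator {t (n - 1)..t n} \<tau> \<partial>lborel)"

lemma memory_mass_bounds:
  shows "n \<in> {1..N} \<Longrightarrow> (\<integral>\<^sup>+\<tau>. singular_conv \<alpha> p \<tau> * indicator {t (n - 1)..t n} \<tau> \<partial>lborel) = ennreal (memory_mass n)"
    and "(\<Sum>n=1..N. memory_mass n) \<le> T powr \<alpha> / Gamma (\<alpha> + 1) * (T powr p / p)"
    and "0 \<le> memory_mass n"
proof -
  let ?I = "\<lambda>n. \<integral>\<^sup>+\<tau>. singular_conv \<alpha> p \<tau> * indicator {t (n - 1)..t n} \<tau> \<partial>lborel"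
  let ?B = "T powr \<alpha> / Gamma (\<alpha> + 1) * (T powr p / p)"
  have B0: "0 \<le> ?B" using Gamma_real_pos[of "\<alpha> + 1"] \<alpha> p(1) by simp
  have "(\<Sum>n=1..N. ?I n) = (\<integral>\<^sup>+\<tau>. singular_conv \<alpha> p \<tau> * indicator {t 0..t N} \<tau> \<partial>lborel)"
    using nn_integral_mesh_intervals[of N t "singular_conv \<alpha> p"] mesh_less by (simp add: less_imp_le)
  also have "\<dots> \<le> ennreal ?B"
    unfolding t0 tN using singular_conv_integral_le[OF \<alpha>(1) p(1), of T] T by simp
  finally have sum: "(\<Sum>n=1..N. ?I n) \<le> ennreal ?B" .
  have fin: "?I n = ennreal (memory_mass n)" if "n \<in> {1..N}" for n
  proof -
    have "?I n \<le> (\<Sum>n=1..N. ?I n)" using that by (intro member_le_sum) auto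
    also note sum
    finally have "?I n < \<infinity>" by (simp add: le_less_trans)
    then show ?thesis by (simp add: memory_mass_def less_top)
  qed
  then show "n \<in> {1..N} \<Longrightarrow> ?I n = ennreal (memory_mass n)" .
  show nn: "0 \<le> memory_mass n" for n by (simp add: memory_mass_def)
  have "ennreal (\<Sum>n=1..N. memory_mass n) = (\<Sum>n=1..N. ?I n)"
  proof -
    have "(\<Sum>n=1..N. ?I n) = (\<Sum>n=1..N. ennreal (memory_mass n))" by (intro sum.cong refl fin)
    then show ?thesis using nn by (simp add: sum_ennreal)
  qed
  with sum have "ennreal (\<Sum>n=1..N. memory_mass n) \<le> ennreal ?B" by argo
  then show "(\<Sum>n=1..N. memory_mass n) \<le> ?B" unfolding ennreal_le_iff[OF B0] .
qed

lemma memory_error_pairing: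
  assumes n: "n \<in> {1..N}"
  shows "\<bar>grid_inner h J (memory_error n) z\<bar> \<le> interp_const * k * memory_mass n * grid_norm h J z"
proof -
  define G where "G = grid_norm h J z * (interp_const * k)"
  have G: "0 \<le> G" using interp_const_nonneg k h(1) by (simp add: G_def grid_norm_nonneg)
  have "ennreal (\<Sum>j=1..J - 1. (h * \<bar>z j\<bar>) * \<bar>memory_error n j\<bar>)
     \<le> (\<integral>\<^sup>+\<tau>. (\<integral>\<^sup>+s. ennreal (frac_kernel \<alpha> (\<tau> - s) * (G * s powr (p - 1))) * indicator {0<..\<tau>} s \<partial>lborel) * indicator {t (n - 1)..t n} \<tau> \<partial>lborel)"
    unfolding memory_error_def
  proof (rule weighted_convolution_le[where T = T])
    fix s assume s: "s \<in> {0<..T}"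
    have "(\<Sum>j=1..J - 1. h * \<bar>z j\<bar> * \<bar>interp_error s j\<bar>) = h * (\<Sum>j=1..J - 1. \<bar>z j\<bar> * \<bar>interp_error s j\<bar>)"
      by (simp add: sum_distrib_left mult.assoc)
    also have "\<dots> \<le> grid_norm h J z * grid_norm h J (\<lambda>j. \<bar>interp_error s j\<bar>)"
      using h(1) by (intro grid_inner_le_weighted) auto
    also have "\<dots> = grid_norm h J z * grid_norm h J (interp_error s)" by (simp add: grid_norm_def)
    also have "\<dots> \<le> grid_norm h J z * (interp_const * k * s powr (p - 1))"
      using interp_error_bound[OF s] h(1) by (intro mult_left_mono) (auto simp: grid_norm_nonneg)
    finally show "(\<Sum>j=1..J - 1. h * \<bar>z j\<bar> * \<bar>interp_error s j\<bar>) \<le> G * s powr (p - 1)" by (simp add: G_def)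
  qed (use \<alpha> h(1) n mesh_pred_nonneg[of n] mesh_le_T[of n] interp_error_measurable in auto)
  also have "\<dots> = (\<integral>\<^sup>+\<tau>. ennreal G * (singular_conv \<alpha> p \<tau> * indicator {t (n - 1)..t n} \<tau>) \<partial>lborel)"
  proof (rule nn_integral_cong)
    fix \<tau> :: real
    have "(\<integral>\<^sup>+s. ennreal (frac_kernel \<alpha> (\<tau> - s) * (G * s powr (p - 1))) * indicator {0<..\<tau>} s \<partial>lborel)
        = (\<integral>\<^sup>+s. ennreal G * (ennreal (frac_kernel \<alpha> (\<tau> - s) * s powr (p - 1)) * indicator {0<..\<tau>} s) \<partial>lborel)"
      using G by (intro nn_integral_cong) (simp add: ennreal_mult'[symmetric] mult.left_commute flip: mult.assoc)
    also have "\<dots> = ennreal G * singular_conv \<alpha> p \<tau>"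
      unfolding singular_conv_def by (rule nn_integral_cmult) measurable
    finally show "(\<integral>\<^sup>+s. ennreal (frac_kernel \<alpha> (\<tau> - s) * (G * s powr (p - 1))) * indicator {0<..\<tau>} s \<partial>lborel) * indicator {t (n - 1)..t n} \<tau>
      = ennreal G * (singular_conv \<alpha> p \<tau> * indicator {t (n - 1)..t n} \<tau>)" by (simp add: mult.assoc)
  qed
  also have "\<dots> = ennreal G * ennreal (memory_mass n)"
    unfolding memory_mass_bounds(1)[OF n, symmetric] by (rule nn_integral_cmult) measurable
  also have "\<dots> = ennreal (G * memory_mass n)" using G memory_mass_bounds(3) by (simp add: ennreal_mult)
  finally have "(\<Sum>j=1..J - 1. (h * \<bar>z j\<bar>) * \<bar>memory_error n j\<bar>) \<le> G * memory_mass n"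
    using G memory_mass_bounds(3)[of n] by (simp add: ennreal_le_iff)
  moreover have "\<bar>grid_inner h J (memory_error n) z\<bar> \<le> (\<Sum>j=1..J - 1. (h * \<bar>z j\<bar>) * \<bar>memory_error n j\<bar>)"
    unfolding grid_inner_def sum_distrib_left using h(1)
    by (intro order_trans[OF sum_abs] sum_mono) (simp add: abs_mult mult_ac)
  ultimately show ?thesis by (simp add: G_def mult_ac)
qed

definition source_error where
  "source_error n = \<bar>Cf\<bar> * ((if n = 1 then M / (2 * p) * (Cg * k * T powr p) else 0)
      + M * Cg powr (4 - 2 * p) * k * ((t n powr p - t (n - 1) powr p) / p))"

text \<open>The integral is \<open>O(t\<^sub>1\<^sup>2\<^sup>p)\<close>; \<open>first_step\<close> turns one factor \<open>t\<^sub>1\<^sup>p\<close> into \<open>k\<close>.\<close>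

lemma first_source_bound:
  "Cf * integral {t 0..t 1} (\<lambda>\<tau>. \<tau> * grid_norm_fun h J (\<lambda>x. f' x \<tau>)) \<le> \<bar>Cf\<bar> * (M / (2 * p) * (Cg * k * T powr p))"
proof -
  have n1: "(1::nat) \<in> {1..N}" using N by simp
  let ?g = "\<lambda>\<tau>. \<tau> * grid_norm_fun h J (\<lambda>x. f' x \<tau>)"
  have nn: "0 \<le> ?g \<tau>" if "0 \<le> \<tau>" for \<tau> using that h(1) by (simp add: grid_norm_fun_def grid_norm_nonneg)
  have t1: "0 < t 1" "t 1 \<le> T" using mesh_pos[OF n1] mesh_le_T[of 1] N by auto
  have "integral {t 0..t 1} ?g \<le> M * (t 1 powr (2 * p) / (2 * p))"
  proof (rule integral_le_of_bound)
    show "((\<lambda>\<tau>. M * \<tau> powr (2 * p - 1)) has_integral M * (t 1 powr (2 * p) / (2 * p))) {t 0..t 1}"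
      unfolding t0 using has_integral_mult_right[OF has_integral_powr_from_0[of "2 * p - 1" "t 1"], of M] p(1) t1 by simp
    fix \<tau> assume \<tau>: "\<tau> \<in> {t 0..t 1}"
    show "?g \<tau> \<le> M * \<tau> powr (2 * p - 1)"
    proof (cases "\<tau> = 0")
      case False
      then show ?thesis using regular_bounds(3)[OF regular_f, of \<tau>] \<tau> t1 by (simp add: t0)
    qed simp
  qed (use M p(1) in simp)
  also have "t 1 powr (2 * p) = t 1 powr p * t 1 powr p" unfolding powr_add[symmetric] by simp
  also have "M * (t 1 powr p * t 1 powr p / (2 * p)) \<le> M * (Cg * k * T powr p / (2 * p))"
    using M p(1) t1 first_step Cg k by (intro mult_left_mono divide_right_mono mult_mono powr_mono2) auto
  finally have I: "integral {t 0..t 1} ?g \<le> M * (Cg * k * T powr p / (2 * p))" .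
  have "M * (Cg * k * T powr p / (2 * p)) = M / (2 * p) * (Cg * k * T powr p)"
    by (simp only: times_divide_eq_left times_divide_eq_right)
  with I have "integral {t 0..t 1} ?g \<le> M / (2 * p) * (Cg * k * T powr p)" by argo
  moreover have "0 \<le> integral {t 0..t 1} ?g"
  proof (cases "?g integrable_on {t 0..t 1}")
    case True
    then show ?thesis by (rule integral_nonneg) (use nn in \<open>simp add: t0\<close>)
  qed (simp add: not_integrable_integral)
  ultimately show ?thesis by (intro mult_le_abs_mult)
qed

text \<open>Only one of the two factors \<open>k\<^sub>n\<close> is estimated by \<open>k\<close>, the other one by \<open>t\<^sub>n\<close>. Using \<open>k\<close> twice would
  leave the integral of \<open>1 / s\<close>, which is not bounded uniformly in the mesh; this way the integral of
  \<open>s\<^sup>p\<^sup>-\<^sup>1\<close> remains, and its sum telescopes.\<close>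

lemma later_source_bound:
  assumes n: "n \<in> {2..N}"
  shows "Cf * (step t n)\<^sup>2 * integral {t (n - 1)..t n} (\<lambda>\<tau>. grid_norm_fun h J (\<lambda>x. f'' x \<tau>))
     \<le> \<bar>Cf\<bar> * (M * Cg powr (4 - 2 * p) * k * ((t n powr p - t (n - 1) powr p) / p))"
proof -
  let ?a = "t (n - 1)" and ?b = "t n" and ?s = "step t n"
  let ?g = "\<lambda>\<tau>. grid_norm_fun h J (\<lambda>x. f'' x \<tau>)"
  have n1: "n \<in> {1..N}" using n by auto
  have "n - 1 \<in> {1..N}" using n by auto
  then have a: "0 < ?a" "?a < ?b" "?b \<le> T" "?b \<le> Cg * ?a"
    using n mesh_pos[of "n - 1"] mesh_less[OF n1] mesh_le_T[of n] mesh_ratio[of n] by auto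
  have s: "0 < ?s" "?s = ?b - ?a" using a by (simp_all add: step_def)
  have nn: "0 \<le> ?g \<tau>" for \<tau> using h(1) by (simp add: grid_norm_fun_def grid_norm_nonneg)
  have I: "integral {?a..?b} ?g \<le> ?s * (M * ?a powr (2 * p - 3))"
  proof (rule integral_le_of_bound)
    show "((\<lambda>\<tau>. M * ?a powr (2 * p - 3)) has_integral ?s * (M * ?a powr (2 * p - 3))) {?a..?b}"
      using has_integral_const_real[of "M * ?a powr (2 * p - 3)" ?a ?b] a s by simp
    fix \<tau> assume \<tau>: "\<tau> \<in> {?a..?b}"
    have "?g \<tau> \<le> M * \<tau> powr (2 * p - 3)" using regular_bounds(2)[OF regular_f, of \<tau>] \<tau> a by simp
    also have "\<dots> \<le> M * ?a powr (2 * p - 3)" using \<tau> a p(2) M by (intro mult_left_mono powr_mono2') auto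
    finally show "?g \<tau> \<le> M * ?a powr (2 * p - 3)" .
  qed (use M s in simp)
  have I0: "0 \<le> integral {?a..?b} ?g"
  proof (cases "?g integrable_on {?a..?b}")
    case True
    then show ?thesis by (rule integral_nonneg) (rule nn)
  qed (simp add: not_integrable_integral)
  have s1: "?s \<le> Cg * k * (Cg powr (1 - p) * ?a powr (1 - p))"
  proof -
    have "?b powr (1 - p) \<le> (Cg * ?a) powr (1 - p)" using a p(2) by (intro powr_mono2) auto
    also have "\<dots> = Cg powr (1 - p) * ?a powr (1 - p)" using Cg a by (simp add: powr_mult)
    finally have "Cg * k * ?b powr (1 - p) \<le> Cg * k * (Cg powr (1 - p) * ?a powr (1 - p))"
      using Cg k by (intro mult_left_mono) auto
    then show ?thesis using step_le_graded[OF n1] by linarith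
  qed
  have s2: "?s \<le> Cg * ?a" using a s by linarith
  have s3: "?a powr (p - 1) * ?s \<le> Cg powr (1 - p) * ((?b powr p - ?a powr p) / p)"
  proof -
    have "?b / Cg \<le> ?a" using a(4) Cg by (simp add: field_simps)
    then have "?a powr (p - 1) \<le> (?b / Cg) powr (p - 1)" using a Cg p(2) by (intro powr_mono2') auto
    also have "\<dots> = Cg powr (1 - p) * ?b powr (p - 1)"
      using a Cg powr_minus_divide[of Cg "p - 1"] by (simp add: powr_divide)
    finally have "?a powr (p - 1) * ?s \<le> Cg powr (1 - p) * ?b powr (p - 1) * ?s" using s by (intro mult_right_mono) auto
    also have "\<dots> = Cg powr (1 - p) * (?b powr (p - 1) * (?b - ?a))" by (simp add: s mult.assoc)
    also have "\<dots> \<le> Cg powr (1 - p) * ((?b powr p - ?a powr p) / p)"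
      using powr_increment_ge[of p ?a ?b] p a by (intro mult_left_mono) auto
    finally show ?thesis .
  qed
  have "?s\<^sup>2 * integral {?a..?b} ?g \<le> (?s * ?s) * (?s * (M * ?a powr (2 * p - 3)))"
    using mult_left_mono[OF I, of "?s\<^sup>2"] by (simp add: power2_eq_square)
  also have "\<dots> \<le> ((Cg * k * (Cg powr (1 - p) * ?a powr (1 - p))) * (Cg * ?a)) * (?s * (M * ?a powr (2 * p - 3)))"
    using s1 s2 s M Cg k a by (intro mult_right_mono mult_mono) auto
  also have "\<dots> = M * (Cg * Cg * Cg powr (1 - p)) * k * ((?a powr (1 - p) * ?a * ?a powr (2 * p - 3)) * ?s)"
    by (simp add: mult_ac)
  also have "?a powr (1 - p) * ?a * ?a powr (2 * p - 3) = ?a powr (p - 1)"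
  proof -
    have "?a powr (1 - p) * ?a * ?a powr (2 * p - 3) = ?a powr (1 - p) * ?a powr 1 * ?a powr (2 * p - 3)" using a by simp
    also have "\<dots> = ?a powr (p - 1)" unfolding powr_add[symmetric] by (simp add: algebra_simps)
    finally show ?thesis .
  qed
  also have "M * (Cg * Cg * Cg powr (1 - p)) * k * (?a powr (p - 1) * ?s)
      \<le> M * (Cg * Cg * Cg powr (1 - p)) * k * (Cg powr (1 - p) * ((?b powr p - ?a powr p) / p))"
    using s3 M Cg k by (intro mult_left_mono) auto
  also have "\<dots> = M * (Cg * Cg * Cg powr (1 - p) * Cg powr (1 - p)) * k * ((?b powr p - ?a powr p) / p)"
    by (simp add: mult_ac)
  also have "Cg * Cg * Cg powr (1 - p) * Cg powr (1 - p) = Cg powr (4 - 2 * p)"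
  proof -
    have "Cg * Cg * Cg powr (1 - p) * Cg powr (1 - p) = Cg powr 1 * Cg powr 1 * Cg powr (1 - p) * Cg powr (1 - p)" using Cg by simp
    also have "\<dots> = Cg powr (4 - 2 * p)" unfolding powr_add[symmetric] by (simp add: algebra_simps)
    finally show ?thesis .
  qed
  finally have "?s\<^sup>2 * integral {?a..?b} ?g \<le> M * Cg powr (4 - 2 * p) * k * ((?b powr p - ?a powr p) / p)" .
  moreover have "0 \<le> ?s\<^sup>2 * integral {?a..?b} ?g" using I0 by simp
  ultimately show ?thesis unfolding mult.assoc[of Cf] by (intro mult_le_abs_mult)
qed

lemma mesh_powr_mono: "n \<in> {1..N} \<Longrightarrow> 0 < q \<Longrightarrow> t (n - 1) powr q \<le> t n powr q"
  using mesh_less[of n] mesh_pred_nonneg[of n] by (intro powr_mono2) auto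

lemma source_pairing:
  assumes n: "n \<in> {1..N}"
  shows "\<bar>grid_inner h J (\<lambda>j. fh n j * step t n - integral {t (n - 1)..t n} (f (real j * h))) z\<bar> \<le> source_error n * grid_norm h J z"
proof -
  let ?d = "\<lambda>j. fh n j * step t n - integral {t (n - 1)..t n} (f (real j * h))"
  have inc: "0 \<le> (t n powr p - t (n - 1) powr p) / p"
    using p(1) mesh_powr_mono[OF n p(1)] by (intro divide_nonneg_pos) auto
  have inc': "0 \<le> M * Cg powr (4 - 2 * p) * k * ((t n powr p - t (n - 1) powr p) / p)"
    by (rule mult_nonneg_nonneg[OF _ inc]) (use M k in simp)
  have "grid_norm h J ?d \<le> source_error n"
  proof (cases "n = 1")
    case True
    then have "grid_norm h J ?d \<le> Cf * integral {t 0..t 1} (\<lambda>\<tau>. \<tau> * grid_norm_fun h J (\<lambda>x. f' x \<tau>))"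
      using source by (simp add: source_approx_def)
    also have "\<dots> \<le> \<bar>Cf\<bar> * (M / (2 * p) * (Cg * k * T powr p))" by (rule first_source_bound)
    also have "\<dots> \<le> source_error n"
      unfolding source_error_def if_P[OF True] using inc' by (intro mult_left_mono) linarith+
    finally show ?thesis .
  next
    case False
    then have n2: "n \<in> {2..N}" using n by auto
    then have "grid_norm h J ?d \<le> Cf * (step t n)\<^sup>2 * integral {t (n - 1)..t n} (\<lambda>\<tau>. grid_norm_fun h J (\<lambda>x. f'' x \<tau>))"
      using source by (simp add: source_approx_def)
    also have "\<dots> \<le> source_error n" using later_source_bound[OF n2] False by (simp add: source_error_def)
    finally show ?thesis .
  qed
  then have "grid_norm h J ?d * grid_norm h J z \<le> source_error n * grid_norm h J z"
    using h(1) by (intro mult_right_mono) (auto simp: grid_norm_nonneg)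
  with grid_inner_Cauchy_Schwarz[of h J ?d z] h(1) show ?thesis by linarith
qed

definition space_error where
  "space_error n = \<bar>CR\<bar> * ((1 + T) * Cg * k * step t n + h\<^sup>2 * step t n
      + (t n powr \<alpha> - t (n - 1) powr \<alpha>) / Gamma (\<alpha> + 1) * h\<^sup>2)"

lemma Gamma_pos: "0 < Gamma (\<alpha> + 1)"
  using \<alpha> by (intro Gamma_real_pos) auto

lemma powr_increment_nonneg: "n \<in> {1..N} \<Longrightarrow> 0 \<le> (t n powr \<alpha> - t (n - 1) powr \<alpha>) / Gamma (\<alpha> + 1)"
  using Gamma_pos mesh_powr_mono[of n \<alpha>] \<alpha>(1) by (intro divide_nonneg_pos) auto

lemma space_error_nonneg: "n \<in> {1..N} \<Longrightarrow> 0 \<le> space_error n"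
  unfolding space_error_def using powr_increment_nonneg[of n] step_pos[of n] T Cg k
  by (intro mult_nonneg_nonneg add_nonneg_nonneg) auto

text \<open>Both \<open>k\<^sub>1\<close> in the first step and \<open>k\<^sub>n\<^sup>2\<close> in the later ones are at most \<open>(1 + T) C k\<close>.\<close>

lemma trunc2_pointwise:
  assumes n: "n \<in> {1..N}" and j: "j \<in> {1..J - 1}"
  shows "\<bar>step t n * trunc2 h \<alpha> t f fh u u_xx n j\<bar> \<le> space_error n"
proof -
  have s: "0 < step t n" by (rule step_pos[OF n])
  let ?d = "(t n powr \<alpha> - t (n - 1) powr \<alpha>) / (step t n * Gamma (\<alpha> + 1)) * h\<^sup>2"
  let ?b = "(1 + T) * Cg * k"
  have d0: "0 \<le> ?d" using powr_increment_nonneg[OF n] s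
    by (metis divide_divide_eq_left' divide_nonneg_pos mult_nonneg_nonneg zero_le_power2)
  have "\<bar>trunc2 h \<alpha> t f fh u u_xx n j\<bar> \<le> \<bar>CR\<bar> * (?b + h\<^sup>2 + ?d)"
  proof (cases "n = 1")
    case True
    have "\<bar>trunc2 h \<alpha> t f fh u u_xx n j\<bar> \<le> CR * (step t n + h\<^sup>2 + ?d)"
      using truncation j True by (simp add: trunc2_bound_def)
    also have "\<dots> \<le> \<bar>CR\<bar> * (step t n + h\<^sup>2 + ?d)" using d0 s by (intro mult_right_mono) auto
    also have "\<dots> \<le> \<bar>CR\<bar> * (?b + h\<^sup>2 + ?d)"
    proof -
      have "step t n \<le> Cg * k" by (rule step_le_k[OF n])
      also have "\<dots> \<le> ?b" using T Cg k by (simp add: algebra_simps)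
      finally show ?thesis by (intro mult_left_mono) auto
    qed
    finally show ?thesis .
  next
    case False
    then have "\<bar>trunc2 h \<alpha> t f fh u u_xx n j\<bar> \<le> CR * ((step t n)\<^sup>2 + h\<^sup>2 + ?d)"
      using truncation j n by (simp add: trunc2_bound_def)
    also have "\<dots> \<le> \<bar>CR\<bar> * ((step t n)\<^sup>2 + h\<^sup>2 + ?d)" using d0 s by (intro mult_right_mono) auto
    also have "\<dots> \<le> \<bar>CR\<bar> * (?b + h\<^sup>2 + ?d)"
    proof -
      have "step t n * step t n \<le> T * (Cg * k)"
        using step_le_k[OF n] step_le_T[OF n] s T by (intro mult_mono) auto
      also have "\<dots> \<le> ?b" using T Cg k by (simp add: algebra_simps)
      finally show ?thesis unfolding power2_eq_square by (intro mult_left_mono) auto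
    qed
    finally show ?thesis .
  qed
  then have "step t n * \<bar>trunc2 h \<alpha> t f fh u u_xx n j\<bar> \<le> step t n * (\<bar>CR\<bar> * (?b + h\<^sup>2 + ?d))"
    using s by (intro mult_left_mono) auto
  also have "\<dots> = \<bar>CR\<bar> * (?b * step t n + h\<^sup>2 * step t n + step t n * ?d)" by (simp add: algebra_simps)
  also have "step t n * ?d = (t n powr \<alpha> - t (n - 1) powr \<alpha>) / Gamma (\<alpha> + 1) * h\<^sup>2" using s by simp
  finally show ?thesis using s by (simp add: space_error_def abs_mult)
qed

definition residual_bound where
  "residual_bound n = interp_const * k * memory_mass n + source_error n + sqrt L * space_error n"

lemma residual_pairing:
  assumes n: "n \<in> {1..N}"
  shows "\<bar>step t n * grid_inner h J (\<lambda>j. trunc1 h \<alpha> t f fh u_xx n j + trunc2 h \<alpha> t f fh u u_xx n j) z\<bar>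
     \<le> residual_bound n * grid_norm h J z"
proof -
  have s: "step t n \<noteq> 0" using step_pos[OF n] by simp
  let ?d = "\<lambda>j. fh n j * step t n - integral {t (n - 1)..t n} (f (real j * h))"
  let ?r = "\<lambda>j. step t n * trunc2 h \<alpha> t f fh u u_xx n j"
  have "step t n * (trunc1 h \<alpha> t f fh u_xx n j + trunc2 h \<alpha> t f fh u u_xx n j) = memory_error n j - ?d j + ?r j" for j
    using s by (simp add: trunc1_def memory_error_def interp_error_def t0 algebra_simps)
  then have "step t n * grid_inner h J (\<lambda>j. trunc1 h \<alpha> t f fh u_xx n j + trunc2 h \<alpha> t f fh u u_xx n j) z
     = grid_inner h J (memory_error n) z - grid_inner h J ?d z + grid_inner h J ?r z"
    unfolding grid_inner_scale_left[symmetric] grid_inner_diff_left[symmetric] grid_inner_add_left[symmetric] by simp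
  moreover have "\<bar>grid_inner h J ?r z\<bar> \<le> sqrt L * space_error n * grid_norm h J z"
  proof -
    have "grid_norm h J ?r \<le> sqrt L * space_error n"
      using J h_eq L space_error_nonneg[OF n] trunc2_pointwise[OF n] by (rule grid_norm_le_const)
    then have "grid_norm h J ?r * grid_norm h J z \<le> sqrt L * space_error n * grid_norm h J z"
      using h(1) by (intro mult_right_mono) (auto simp: grid_norm_nonneg)
    with grid_inner_Cauchy_Schwarz[of h J ?r z] h(1) show ?thesis by linarith
  qed
  ultimately show ?thesis
    using memory_error_pairing[OF n, of z] source_pairing[OF n, of z]
    unfolding residual_bound_def distrib_right by linarith
qed

lemma residual_bound_nonneg: "n \<in> {1..N} \<Longrightarrow> 0 \<le> residual_bound n"
proof -
  assume n: "n \<in> {1..N}"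
  have "0 \<le> (t n powr p - t (n - 1) powr p) / p"
    using p(1) mesh_powr_mono[OF n p(1)] by (intro divide_nonneg_pos) auto
  then have "0 \<le> source_error n" unfolding source_error_def using M Cg k p(1)
    by (intro mult_nonneg_nonneg add_nonneg_nonneg) auto
  then show ?thesis unfolding residual_bound_def
    using interp_const_nonneg k memory_mass_bounds(3)[of n] space_error_nonneg[OF n] L by simp
qed

definition consistency_const where
  "consistency_const = interp_const * (T powr \<alpha> / Gamma (\<alpha> + 1) * (T powr p / p))
     + \<bar>Cf\<bar> * (M / (2 * p) * (Cg * T powr p) + M * Cg powr (4 - 2 * p) * (T powr p / p))
     + sqrt L * \<bar>CR\<bar> * ((1 + T) * Cg * T + T + T powr \<alpha> / Gamma (\<alpha> + 1))"

lemma consistency_const_nonneg: "0 \<le> consistency_const"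
  unfolding consistency_const_def using interp_const_nonneg Gamma_pos p(1) M Cg T L
  by (intro add_nonneg_nonneg mult_nonneg_nonneg divide_nonneg_nonneg) auto

lemma sum_residual_bound: "(\<Sum>n=1..N. residual_bound n) \<le> consistency_const * (k + h\<^sup>2)"
proof -
  have steps: "(\<Sum>n=1..N. step t n) = T"
    using sum_mesh_differences[of t N] by (simp add: step_def t0 tN)
  have 1: "(\<Sum>n=1..N. interp_const * k * memory_mass n) \<le> interp_const * (T powr \<alpha> / Gamma (\<alpha> + 1) * (T powr p / p)) * k"
    unfolding sum_distrib_left[symmetric] using mult_left_mono[OF memory_mass_bounds(2), of "interp_const * k"] interp_const_nonneg k
    by (simp add: mult_ac)
  have "(\<Sum>n=1..N. (if n = 1 then M / (2 * p) * (Cg * k * T powr p) else 0)) = M / (2 * p) * (Cg * k * T powr p)"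
    using N by (subst sum.delta) auto
  moreover have "(\<Sum>n=1..N. M * Cg powr (4 - 2 * p) * k * ((t n powr p - t (n - 1) powr p) / p)) = M * Cg powr (4 - 2 * p) * k * (T powr p / p)"
    unfolding sum_distrib_left[symmetric] sum_divide_distrib[symmetric]
    using sum_mesh_differences[of "\<lambda>n. t n powr p" N] by (simp add: t0 tN)
  ultimately have 2: "(\<Sum>n=1..N. source_error n) = \<bar>Cf\<bar> * (M / (2 * p) * (Cg * T powr p) + M * Cg powr (4 - 2 * p) * (T powr p / p)) * k"
    unfolding source_error_def sum_distrib_left[symmetric] sum.distrib by (simp add: algebra_simps)
  have "(\<Sum>n=1..N. (t n powr \<alpha> - t (n - 1) powr \<alpha>) / Gamma (\<alpha> + 1) * h\<^sup>2) = T powr \<alpha> / Gamma (\<alpha> + 1) * h\<^sup>2"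
    unfolding sum_distrib_right[symmetric] sum_divide_distrib[symmetric]
    using sum_mesh_differences[of "\<lambda>n. t n powr \<alpha>" N] by (simp add: t0 tN)
  then have "(\<Sum>n=1..N. space_error n) = \<bar>CR\<bar> * ((1 + T) * Cg * k * T + h\<^sup>2 * T + T powr \<alpha> / Gamma (\<alpha> + 1) * h\<^sup>2)"
    unfolding space_error_def sum_distrib_left[symmetric] sum.distrib steps by simp
  also have "\<dots> \<le> \<bar>CR\<bar> * (((1 + T) * Cg * T + T + T powr \<alpha> / Gamma (\<alpha> + 1)) * (k + h\<^sup>2))"
  proof (rule mult_left_mono)
    have "0 \<le> (1 + T) * Cg * T * h\<^sup>2" "0 \<le> T * k" "0 \<le> T powr \<alpha> / Gamma (\<alpha> + 1) * k"
      using T Cg k Gamma_pos by auto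
    then show "(1 + T) * Cg * k * T + h\<^sup>2 * T + T powr \<alpha> / Gamma (\<alpha> + 1) * h\<^sup>2 \<le> ((1 + T) * Cg * T + T + T powr \<alpha> / Gamma (\<alpha> + 1)) * (k + h\<^sup>2)"
      unfolding distrib_left distrib_right by (simp add: mult_ac)
  qed simp
  finally have 3: "(\<Sum>n=1..N. sqrt L * space_error n) \<le> sqrt L * \<bar>CR\<bar> * ((1 + T) * Cg * T + T + T powr \<alpha> / Gamma (\<alpha> + 1)) * (k + h\<^sup>2)"
    unfolding sum_distrib_left[symmetric] using L mult_left_mono[of _ _ "sqrt L"] by (simp add: mult.assoc)
  have le: "A * k \<le> A * (k + h\<^sup>2)" if "0 \<le> A" for A using that by (simp add: mult_left_mono)
  have "(\<Sum>n=1..N. residual_bound n) \<le> interp_const * (T powr \<alpha> / Gamma (\<alpha> + 1) * (T powr p / p)) * k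
      + \<bar>Cf\<bar> * (M / (2 * p) * (Cg * T powr p) + M * Cg powr (4 - 2 * p) * (T powr p / p)) * k
      + sqrt L * \<bar>CR\<bar> * ((1 + T) * Cg * T + T + T powr \<alpha> / Gamma (\<alpha> + 1)) * (k + h\<^sup>2)"
    unfolding residual_bound_def sum.distrib using 1 2 3 by linarith
  also have "\<dots> \<le> consistency_const * (k + h\<^sup>2)"
    unfolding consistency_const_def distrib_right[of _ _ "k + h\<^sup>2"]
    using interp_const_nonneg Gamma_pos p(1) M Cg T
    by (intro add_mono le mult_nonneg_nonneg add_nonneg_nonneg order_refl) auto
  finally show ?thesis .
qed

section \<open>Convergence\<close>

definition exact where
  "exact n i = u (real i * h) (t n)"

lemma exact_boundary: "n \<in> {1..N} \<Longrightarrow> exact n 0 = 0 \<and> exact n J = 0"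
  using solution mesh_pos[of n] mesh_le_T[of n] h(2) by (simp add: exact_def ibvp_solution_def)

lemma exact_bound: "n \<in> {1..N} \<Longrightarrow> i \<le> J \<Longrightarrow> \<bar>exact n i\<bar> \<le> c0"
proof -
  assume "n \<in> {1..N}" "i \<le> J"
  moreover have "real i * h \<le> real J * h" using \<open>i \<le> J\<close> h(1) by (intro mult_right_mono) auto
  ultimately show ?thesis
    using bounded[of "real i * h" "t n"] mesh_pos[of n] mesh_le_T[of n] h by (simp add: exact_def)
qed

lemma exact_Lipschitz:
  assumes n: "n \<in> {1..N}" and i: "i < J"
  shows "\<bar>exact n (i + 1) - exact n i\<bar> \<le> c0 * h"
proof -
  let ?a = "real i * h" and ?b = "real (i + 1) * h"
  have ab: "0 \<le> ?a" "?a \<le> ?b" "?b \<le> L" "?b - ?a = h"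
  proof -
    have "real (i + 1) * h \<le> real J * h" using i h(1) by (intro mult_right_mono) auto
    then show "?b \<le> L" using h(2) by simp
  qed (use h(1) in \<open>auto simp: algebra_simps\<close>)
  have tn: "t n \<in> {0<..T}" using n mesh_pos[of n] mesh_le_T[of n] by simp
  have "norm (u ?b (t n) - u ?a (t n)) \<le> c0 * norm (?b - ?a)"
  proof (rule field_differentiable_bound[where S = "{0..L}" and f' = "\<lambda>x. u_x x (t n)"])
    fix x assume x: "x \<in> {0..L}"
    show "((\<lambda>y. u y (t n)) has_field_derivative u_x x (t n)) (at x within {0..L})"
      using solution x tn by (simp add: ibvp_solution_def)
    show "norm (u_x x (t n)) \<le> c0" using bounded[OF x tn] by simp
  qed (use ab in auto)
  then show ?thesis using ab(4) h(1) by (simp add: exact_def)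
qed

lemma mid_exact:
  assumes n: "n \<in> {1..N}"
  shows "mid exact n 0 = 0" "mid exact n J = 0"
    and "i \<le> J \<Longrightarrow> \<bar>mid exact n i\<bar> \<le> c0"
    and "i < J \<Longrightarrow> \<bar>mid exact n (i + 1) - mid exact n i\<bar> \<le> c0 * h"
proof -
  have pred: "n - 1 \<in> {1..N}" if "n \<noteq> 1" using n that by auto
  show "mid exact n 0 = 0" "mid exact n J = 0"
    using exact_boundary[OF n] exact_boundary[OF pred] by (auto simp: mid_def)
  show "\<bar>mid exact n i\<bar> \<le> c0" if "i \<le> J"
  proof (cases "n = 1")
    case False
    then show ?thesis using exact_bound[OF n that] exact_bound[OF pred[OF False] that]
      by (simp add: mid_def)
  qed (use exact_bound[OF n that] in \<open>simp add: mid_def\<close>)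
  show "\<bar>mid exact n (i + 1) - mid exact n i\<bar> \<le> c0 * h" if "i < J"
  proof (cases "n = 1")
    case False
    then have "mid exact n (i + 1) - mid exact n i = ((exact n (i + 1) - exact n i) + (exact (n - 1) (i + 1) - exact (n - 1) i)) / 2"
      by (simp add: mid_def field_simps)
    moreover have "\<bar>(exact n (i + 1) - exact n i) + (exact (n - 1) (i + 1) - exact (n - 1) i)\<bar> \<le> c0 * h + c0 * h"
      using exact_Lipschitz[OF n that] exact_Lipschitz[OF pred[OF False] that]
      by (rule order_trans[OF abs_triangle_ineq add_mono])
    ultimately show ?thesis by simp
  qed (use exact_Lipschitz[OF n that] in \<open>simp add: mid_def\<close>)
qed

lemma exact_equation:
  "diff_t t (\<lambda>m. exact m j) n + convection h exact n j = frac_quad \<alpha> t (\<lambda>m. diff_xx h (exact m) j) n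
     + (fh n j + (trunc1 h \<alpha> t f fh u_xx n j + trunc2 h \<alpha> t f fh u u_xx n j))"
  by (simp add: trunc2_def Let_def exact_def[abs_def])

definition error_bound where
  "error_bound = 4 * exp (2 * c0 * T) * consistency_const"

lemma error_bound_nonneg: "0 \<le> error_bound"
  using consistency_const_nonneg by (simp add: error_bound_def)

text \<open>Subtract the equations for \<open>u\<close> and \<open>U\<close>, test with \<open>mid e n\<close> and sum over the levels. The sum of the
  quadrature terms is at most \<open>0\<close>, the nonlinear terms cost \<open>c0 / 2\<close> times the squared norm, and the
  residual enters linearly; the rest is the discrete Gronwall inequality.\<close>

lemma scheme_error_bound:
  assumes U: "scheme_solution h J N \<alpha> t u0 fh U" and small: "2 * c0 * (Cg * k) \<le> 1" and m: "m \<le> N"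
  shows "grid_norm h J (\<lambda>j. U m j - exact m j) \<le> error_bound * (k + h\<^sup>2)"
proof -
  let ?W = "\<lambda>n V j. \<Sum>s=1..n. quad_weight \<alpha> t n s * step t s * diff_xx h (V s) j"
  define e where "e n j = U n j - exact n j" for n j
  define E where "E n = grid_norm h J (e n)" for n
  let ?y = "mid e"
  let ?Y = "\<lambda>n. grid_norm h J (?y n)"
  have hn: "0 \<le> h" using h(1) by simp
  have mid_e: "mid e n j = mid U n j - mid exact n j" for n j by (simp add: mid_def e_def field_simps)
  have y0: "?y n 0 = 0 \<and> ?y n J = 0" if n: "n \<in> {1..N}" for n
  proof -
    have "e n 0 = 0 \<and> e n J = 0" if "n \<in> {1..N}" for n
      using U exact_boundary[OF that] that by (simp add: e_def scheme_solution_def)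
    moreover have "n - 1 \<in> {1..N}" if "n \<noteq> 1" using n that by auto
    ultimately show ?thesis using n by (auto simp: mid_def)
  qed
  have e0: "E 0 = 0"
  proof -
    have "e 0 j = 0" if "j \<in> {1..J - 1}" for j
      using U solution that grid_point[OF that] by (simp add: e_def exact_def scheme_solution_def ibvp_solution_def t0)
    then show ?thesis by (simp add: E_def grid_norm_def)
  qed
  have step_energy: "((E n)\<^sup>2 - (E (n - 1))\<^sup>2) / 2
      \<le> step t n * grid_inner h J (?W n ?y) (?y n)
        + (c0 / 2 * step t n * (?Y n)\<^sup>2 + residual_bound n * ?Y n)" if n: "n \<in> {1..N}" for n
  proof -
    have n1: "1 \<le> n" and s: "0 < step t n" using n step_pos[OF n] by auto
    let ?R = "\<lambda>j. trunc1 h \<alpha> t f fh u_xx n j + trunc2 h \<alpha> t f fh u u_xx n j"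
    let ?Q = "\<lambda>j. ?W n ?y j"
    let ?B = "\<lambda>j. convect h (\<lambda>i. mid exact n i + ?y n i) j - convect h (mid exact n) j"
    have clear: "a = s * q - s * r - s * b" if "a / s = q - r - b" "0 < s" for a s q r b :: real
      using that by (simp add: field_simps)
    have eq: "lead n * (?y n j - e (n - 1) j) = step t n * ?Q j - step t n * ?R j - step t n * ?B j" if j: "j \<in> {1..J - 1}" for j
    proof -
      have 1: "lead n * (mid U n j - U (n - 1) j) / step t n + convect h (mid U n) j
          = ?W n (mid U) j + fh n j"
        using U n j scheme_equation_mid[OF n1, of t U j h \<alpha> "fh n j"] by (simp add: scheme_solution_def)
      have 2: "lead n * (mid exact n j - exact (n - 1) j) / step t n + convect h (mid exact n) j
          = ?W n (mid exact) j + (fh n j + ?R j)"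
        using exact_equation[of j n] unfolding scheme_equation_mid[OF n1] .
      have 3: "?Q j = ?W n (mid U) j
          - ?W n (mid exact) j"
      proof -
        have "diff_xx h (?y s) j = diff_xx h (mid U s) j - diff_xx h (mid exact s) j" for s
          by (simp add: mid_e diff_xx_def diff_divide_distrib[symmetric])
        then show ?thesis by (simp add: right_diff_distrib sum_subtractf)
      qed
      have 4: "(\<lambda>i. mid exact n i + ?y n i) = mid U n" by (simp add: mid_e fun_eq_iff)
      have "lead n * (?y n j - e (n - 1) j) / step t n
          = lead n * (mid U n j - U (n - 1) j) / step t n - lead n * (mid exact n j - exact (n - 1) j) / step t n"
        by (simp add: mid_e e_def right_diff_distrib diff_divide_distrib)
      also have "\<dots> = ?Q j - ?R j - ?B j" unfolding 3 4 using 1 2 by linarith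
      finally show ?thesis using s by (rule clear)
    qed
    have "lead n * grid_inner h J (\<lambda>j. ?y n j - e (n - 1) j) (?y n)
        = grid_inner h J (\<lambda>j. lead n * (?y n j - e (n - 1) j)) (?y n)" by (rule grid_inner_scale_left[symmetric])
    also have "\<dots> = grid_inner h J (\<lambda>j. step t n * ?Q j - step t n * ?R j - step t n * ?B j) (?y n)"
      by (rule grid_inner_cong) (rule eq)
    also have "\<dots> = step t n * grid_inner h J ?Q (?y n) - step t n * grid_inner h J ?R (?y n) - step t n * grid_inner h J ?B (?y n)"
      unfolding grid_inner_diff_left grid_inner_scale_left ..
    also have "grid_inner h J ?B (?y n) = - grid_inner h J (convect h (?y n)) (mid exact n)"
      by (rule convect_polarized) (use J mid_exact[OF n] y0[OF n] in auto)
    also have "step t n * grid_inner h J ?Q (?y n) - step t n * grid_inner h J ?R (?y n) - step t n * - grid_inner h J (convect h (?y n)) (mid exact n)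
       \<le> step t n * grid_inner h J ?Q (?y n) + residual_bound n * ?Y n + step t n * (c0 / 2 * (?Y n)\<^sup>2)"
    proof -
      have "\<bar>grid_inner h J (convect h (?y n)) (mid exact n)\<bar> \<le> c0 / 2 * (?Y n)\<^sup>2"
        by (rule convect_bound_Lipschitz) (use J h(1) mid_exact[OF n] y0[OF n] in auto)
      then have "step t n * grid_inner h J (convect h (?y n)) (mid exact n) \<le> step t n * (c0 / 2 * (?Y n)\<^sup>2)"
        using s by (intro mult_left_mono) auto
      then show ?thesis using residual_pairing[OF n, of "?y n"] by linarith
    qed
    finally show ?thesis using mid_energy[OF hn, of J e n] by (simp add: E_def algebra_simps)
  qed
  have energy: "(E m)\<^sup>2 / 2 \<le> (\<Sum>n=1..m. c0 / 2 * step t n * (?Y n)\<^sup>2 + residual_bound n * ?Y n)" if m: "m \<in> {1..N}" for m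
  proof -
    have "(E m)\<^sup>2 / 2 = (\<Sum>n=1..m. ((E n)\<^sup>2 - (E (n - 1))\<^sup>2) / 2)"
      unfolding sum_divide_distrib[symmetric] using sum_mesh_differences[of "\<lambda>n. (E n)\<^sup>2" m] e0 by simp
    also have "\<dots> \<le> (\<Sum>n=1..m. step t n * grid_inner h J (?W n ?y) (?y n)
        + (c0 / 2 * step t n * (?Y n)\<^sup>2 + residual_bound n * ?Y n))"
      using m by (intro sum_mono step_energy) auto
    also have "\<dots> = (\<Sum>n=1..m. step t n * grid_inner h J (?W n ?y) (?y n))
        + (\<Sum>n=1..m. c0 / 2 * step t n * (?Y n)\<^sup>2 + residual_bound n * ?Y n)"
      by (rule sum.distrib)
    also have "\<dots> \<le> (\<Sum>n=1..m. c0 / 2 * step t n * (?Y n)\<^sup>2 + residual_bound n * ?Y n)"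
    proof -
      have "(\<Sum>n=1..m. step t n * grid_inner h J (?W n ?y) (?y n)) \<le> 0"
        using m by (intro quad_form_nonneg J h(1) \<alpha> mesh_less y0) auto
      then show ?thesis by linarith
    qed
    finally show ?thesis .
  qed
  have Y: "0 \<le> ?Y n \<and> ?Y n \<le> max (E n) (E (n - 1))" for n
  proof (cases "n = 1")
    case True
    then have "?y n = e 1" by (simp add: mid_def fun_eq_iff)
    then show ?thesis using True hn by (simp add: E_def grid_norm_nonneg)
  next
    case False
    then have "?y n = (\<lambda>j. 1 / 2 * (e n j + e (n - 1) j))" by (simp add: mid_def fun_eq_iff)
    then have "?Y n = 1 / 2 * grid_norm h J (\<lambda>j. e n j + e (n - 1) j)" by (simp only: grid_norm_scale)
    also have "\<dots> \<le> 1 / 2 * (E n + E (n - 1))" using grid_norm_triangle[OF hn, of J "e n" "e (n - 1)"] by (simp add: E_def)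
    finally show ?thesis using hn by (auto simp: grid_norm_nonneg max_def)
  qed
  have steps: "(\<Sum>n=1..N. step t n) = T"
    using sum_mesh_differences[of t N] by (simp add: step_def t0 tN)
  have "E m \<le> 4 * (consistency_const * (k + h\<^sup>2)) * exp (4 * (c0 / 2) * (\<Sum>n=1..N. step t n))"
  proof (rule discrete_Gronwall[where Y = ?Y and r = residual_bound])
    fix n assume n: "n \<in> {1..N}"
    have "c0 / 2 * step t n \<le> c0 / 2 * (Cg * k)" using c0_nonneg step_le_k[OF n] by (intro mult_left_mono) auto
    then show "0 \<le> step t n \<and> c0 / 2 * step t n \<le> 1 / 4" using small step_pos[OF n] by simp
  qed (use Y e0 energy residual_bound_nonneg sum_residual_bound c0_nonneg m hn in \<open>auto simp: E_def grid_norm_nonneg\<close>)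
  then show ?thesis unfolding steps by (simp add: E_def e_def[abs_def] error_bound_def mult_ac)
qed

section \<open>Uniqueness\<close>

text \<open>The inverse inequality \<open>grid_value_le_norm\<close> loses \<open>h\<^sup>1\<^sup>/\<^sup>2\<close>, which the error bound provides.\<close>

lemma scheme_solution_bounded:
  assumes U: "scheme_solution h J N \<alpha> t u0 fh U" and small: "2 * c0 * (Cg * k) \<le> 1"
    and close: "error_bound * (k + h\<^sup>2) \<le> sqrt h" and n: "n \<in> {1..N}" and j: "j \<in> {1..J - 1}"
  shows "\<bar>mid U n j\<bar> \<le> c0 + 1"
proof -
  have level: "\<bar>U m j\<bar> \<le> c0 + 1" if m: "m \<in> {1..N}" for m
  proof -
    have "sqrt h * \<bar>U m j - exact m j\<bar> \<le> grid_norm h J (\<lambda>j. U m j - exact m j)"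
      using grid_value_le_norm[OF h(1) j, of "\<lambda>j. U m j - exact m j"] .
    also have "\<dots> \<le> sqrt h * 1" using scheme_error_bound[OF U small, of m] m close by simp
    finally have "\<bar>U m j - exact m j\<bar> \<le> 1" using h(1) by simp
    moreover have "\<bar>exact m j\<bar> \<le> c0" using exact_bound[OF m] j by auto
    ultimately show ?thesis by linarith
  qed
  show ?thesis
  proof (cases "n = 1")
    case False
    then have "n - 1 \<in> {1..N}" using n by auto
    then show ?thesis using level[OF n] level[of "n - 1"] False by (simp add: mid_def)
  qed (use level[OF n] in \<open>simp add: mid_def\<close>)
qed

text \<open>Only \<open>U\<close> has to be bounded: in \<open>convect_polarized\<close> the second solution occurs through the difference
  \<open>z\<close> alone. All quadrature terms except the last one cancel by induction.\<close>

lemma scheme_solution_unique: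
  assumes U: "scheme_solution h J N \<alpha> t u0 fh U" and V: "scheme_solution h J N \<alpha> t u0 fh V"
    and K: "\<And>n j. n \<in> {1..N} \<Longrightarrow> j \<in> {1..J - 1} \<Longrightarrow> \<bar>mid U n j\<bar> \<le> K" "0 \<le> K"
    and smoothing: "K\<^sup>2 * Gamma (\<alpha> + 2) * (Cg * k) powr (1 - \<alpha>) < 4"
  shows "n \<le> N \<Longrightarrow> j \<in> {1..J - 1} \<Longrightarrow> V n j = U n j"
proof (induction n arbitrary: j rule: less_induct)
  case (less n)
  show ?case
  proof (cases "n = 0")
    case True
    then show ?thesis using U V less.prems by (simp add: scheme_solution_def)
  next
    case False
    then have n: "n \<in> {1..N}" and n1: "1 \<le> n" using less.prems by auto
    have bdU: "U m 0 = 0 \<and> U m J = 0 \<and> V m 0 = 0 \<and> V m J = 0" if "m \<in> {1..N}" for m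
      using U V that by (simp add: scheme_solution_def)
    \<comment> \<open>The corner values at level \<open>0\<close> may differ, but they enter none of the equations.\<close>
    have same: "V m i = U m i" if "m < n" "i \<in> {1..J - 1} \<or> 1 \<le> m \<and> i \<le> J" for m i
    proof (cases "i \<in> {1..J - 1}")
      case True
      then show ?thesis using less.IH[of m i] that less.prems by simp
    next
      case False
      then have "m \<in> {1..N}" "i = 0 \<or> i = J" using that less.prems by auto
      then show ?thesis using bdU by auto
    qed
    have same_mid: "mid V m i = mid U m i" if "1 \<le> m" "m < n" "i \<le> J" for m i
    proof (cases "m = 1")
      case False
      then have "1 \<le> m - 1" "m - 1 < n" using that by auto
      then show ?thesis using same[of m i] same[of "m - 1" i] that False by (simp add: mid_def)
    qed (use same[of m i] that in \<open>simp add: mid_def\<close>)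
    define z where "z i = mid V n i - mid U n i" for i
    have bd: "mid U n 0 = 0 \<and> mid U n J = 0 \<and> z 0 = 0 \<and> z J = 0"
    proof -
      have "n - 1 \<in> {1..N}" if "n \<noteq> 1" using n that by auto
      then show ?thesis using bdU[OF n] bdU[of "n - 1"] by (auto simp: mid_def z_def)
    qed
    let ?W = "\<lambda>V i. \<Sum>s=1..n. quad_weight \<alpha> t n s * step t s * diff_xx h (V s) i"
    let ?s = "step t n" and ?w = "quad_weight \<alpha> t n n * step t n"
    have s: "0 < ?s" by (rule step_pos[OF n])
    let ?B = "\<lambda>i. convect h (\<lambda>i. mid U n i + z i) i - convect h (mid U n) i"
    have eq: "lead n / ?s * z i = ?w * diff_xx h z i - ?B i" if i: "i \<in> {1..J - 1}" for i
    proof -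
      have split: "(\<Sum>s=1..n. F s) = (\<Sum>s=1..n - 1. F s) + F n" for F :: "nat \<Rightarrow> real"
        using n1 by (cases n) auto
      have old: "(\<Sum>s=1..n - 1. quad_weight \<alpha> t n s * step t s * diff_xx h (mid V s) i)
          = (\<Sum>s=1..n - 1. quad_weight \<alpha> t n s * step t s * diff_xx h (mid U s) i)"
      proof (rule sum.cong[OF refl])
        fix s assume "s \<in> {1..n - 1}"
        then have "1 \<le> s" "s < n" by auto
        moreover have "i - 1 \<le> J" "i \<le> J" "i + 1 \<le> J" using i by auto
        ultimately show "quad_weight \<alpha> t n s * step t s * diff_xx h (mid V s) i = quad_weight \<alpha> t n s * step t s * diff_xx h (mid U s) i"
          by (simp add: diff_xx_def same_mid)
      qed
      have prev: "V (n - 1) i = U (n - 1) i" using same[of "n - 1" i] i n1 by simp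
      have eqU: "lead n * (mid U n i - U (n - 1) i) / ?s + convect h (mid U n) i
          = ?W (mid U) i + fh n i"
        using U n i scheme_equation_mid[OF n1, of t U i h \<alpha> "fh n i"] by (simp add: scheme_solution_def)
      have eqV: "lead n * (mid V n i - V (n - 1) i) / ?s + convect h (mid V n) i
          = ?W (mid V) i + fh n i"
        using V n i scheme_equation_mid[OF n1, of t V i h \<alpha> "fh n i"] by (simp add: scheme_solution_def)
      have sumV: "(\<lambda>i. mid U n i + z i) = mid V n" by (simp add: z_def fun_eq_iff)
      have d: "diff_xx h z i = diff_xx h (mid V n) i - diff_xx h (mid U n) i"
        by (simp add: z_def diff_xx_def diff_divide_distrib[symmetric])
      have "lead n / ?s * z i = lead n * (mid V n i - V (n - 1) i) / ?s - lead n * (mid U n i - U (n - 1) i) / ?s"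
        unfolding prev by (simp add: z_def right_diff_distrib diff_divide_distrib)
      also have "\<dots> = ?w * diff_xx h (mid V n) i - ?w * diff_xx h (mid U n) i - ?B i"
        unfolding sumV using eqU eqV unfolding split old by linarith
      also have "\<dots> = ?w * diff_xx h z i - ?B i" unfolding d by (simp only: right_diff_distrib)
      finally show ?thesis .
    qed
    let ?a = "grid_norm h J z" and ?b = "grid_seminorm h J z"
    have "lead n / ?s * ?a\<^sup>2 = grid_inner h J (\<lambda>i. lead n / ?s * z i) z"
      using h(1) by (simp only: grid_norm_sq less_imp_le grid_inner_scale_left)
    also have "\<dots> = grid_inner h J (\<lambda>i. ?w * diff_xx h z i - ?B i) z" by (rule grid_inner_cong) (rule eq)
    also have "\<dots> = ?w * grid_inner h J (diff_xx h z) z - grid_inner h J ?B z"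
      unfolding grid_inner_diff_left grid_inner_scale_left ..
    also have "grid_inner h J (diff_xx h z) z = - ?b\<^sup>2"
      using grid_inner_diff_xx[OF J, of h z z] h(1) bd grid_seminorm_sq[OF h(1), of J z] by simp
    also have "grid_inner h J ?B z = - grid_inner h J (convect h z) (mid U n)"
      by (rule convect_polarized) (use J bd in auto)
    also have "?w = ?s powr \<alpha> / Gamma (\<alpha> + 2)" by (rule quad_weight_diagonal[OF \<alpha>(1) mesh_less[OF n]])
    finally have energy: "lead n / ?s * ?a\<^sup>2 + ?s powr \<alpha> / Gamma (\<alpha> + 2) * ?b\<^sup>2 = grid_inner h J (convect h z) (mid U n)" by simp
    have G: "0 < Gamma (\<alpha> + 2)" using \<alpha> by (intro Gamma_real_pos) auto
    have "?a = 0"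
    proof (rule quadratic_form_trivial)
      show "1 / ?s * ?a\<^sup>2 + ?s powr \<alpha> / Gamma (\<alpha> + 2) * ?b\<^sup>2 \<le> K * (?a * ?b)"
      proof -
        have "1 / ?s * ?a\<^sup>2 \<le> lead n / ?s * ?a\<^sup>2"
          using s lead_ge_1[of n] by (intro mult_right_mono divide_right_mono) auto
        moreover have "\<bar>grid_inner h J (convect h z) (mid U n)\<bar> \<le> K * (?a * ?b)"
          by (rule convect_bound_sup) (use J h(1) bd K n in auto)
        ultimately show ?thesis using energy by linarith
      qed
      have "?s powr (1 - \<alpha>) \<le> (Cg * k) powr (1 - \<alpha>)" using s step_le_k[OF n] \<alpha> by (intro powr_mono2) auto
      then have "K\<^sup>2 * Gamma (\<alpha> + 2) * ?s powr (1 - \<alpha>) \<le> K\<^sup>2 * Gamma (\<alpha> + 2) * (Cg * k) powr (1 - \<alpha>)"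
        using G by (intro mult_left_mono) auto
      then have "K\<^sup>2 * Gamma (\<alpha> + 2) * ?s powr (1 - \<alpha>) < 4" using smoothing by linarith
      then have "K\<^sup>2 < 4 / (Gamma (\<alpha> + 2) * ?s powr (1 - \<alpha>))" using G s by (simp add: field_simps)
      also have "4 / (Gamma (\<alpha> + 2) * ?s powr (1 - \<alpha>)) = 4 * (1 / ?s) * (?s powr \<alpha> / Gamma (\<alpha> + 2))"
        using s by (simp add: powr_diff)
      finally show "K\<^sup>2 < 4 * (1 / ?s) * (?s powr \<alpha> / Gamma (\<alpha> + 2))" .
    qed (use h(1) s in \<open>auto simp: grid_norm_nonneg grid_seminorm_nonneg\<close>)
    then have "z j = 0" using grid_value_le_norm[OF h(1) less.prems(2), of z] h(1) by (simp add: mult_le_0_iff)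
    then have "mid V n j = mid U n j" by (simp add: z_def)
    then show ?thesis using same[of "n - 1" j] less.prems n1 by (auto simp: mid_def split: if_splits)
  qed
qed

lemma uniquely_solvable:
  assumes small: "2 * c0 * (Cg * k) \<le> 1"
    and close: "error_bound * (k + h\<^sup>2) \<le> sqrt h"
    and smoothing: "(c0 + 1)\<^sup>2 * Gamma (\<alpha> + 2) * (Cg * k) powr (1 - \<alpha>) < 4"
  shows "scheme_uniquely_solvable h J N \<alpha> t u0 fh"
proof -
  obtain U where U: "scheme_solution h J N \<alpha> t u0 fh U"
    using scheme_solution_exists[OF J h(1) \<alpha>(1), of N t u0 fh] mesh_less by blast
  have "V n j = U n j" if V: "scheme_solution h J N \<alpha> t u0 fh V" and nj: "(n, j) \<in> scheme_unknowns J N" for V n j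
  proof (cases "j \<in> {1..J - 1}")
    case True
    have "n \<le> N" using nj by (auto simp: scheme_unknowns_def)
    show ?thesis
    proof (rule scheme_solution_unique[OF U V _ _ smoothing \<open>n \<le> N\<close> True])
      show "\<bar>mid U n j\<bar> \<le> c0 + 1" if "n \<in> {1..N}" "j \<in> {1..J - 1}" for n j
        by (rule scheme_solution_bounded[OF U small close that])
      show "0 \<le> c0 + 1" using c0_nonneg by simp
    qed
  next
    case False
    then have "n \<in> {1..N}" "j = 0 \<or> j = J" using nj by (auto simp: scheme_unknowns_def)
    then show ?thesis using U V by (auto simp: scheme_solution_def)
  qed
  then show ?thesis unfolding scheme_uniquely_solvable_def using U by blast
qed

end

section \<open>Families of discretizations\<close>

theorem theorem4p4:
  fixes L T \<alpha> \<gamma> \<sigma> M c0 Cg cg Cf CR :: real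
    and f f' f'' :: "real \<Rightarrow> real \<Rightarrow> real"
    and u u_t u_x u_xx u_xx' u_xx'' :: "real \<Rightarrow> real \<Rightarrow> real"
    and u0 :: "real \<Rightarrow> real"
    and J N :: "'i \<Rightarrow> nat"
    and h k :: "'i \<Rightarrow> real"
    and t :: "'i \<Rightarrow> nat \<Rightarrow> real"
    and fh :: "'i \<Rightarrow> nat \<Rightarrow> nat \<Rightarrow> real"
  assumes "0 < L" and "0 < T" and "0 < \<alpha>" and "\<alpha> < 1"
    and "0 < \<sigma>" and "0 < M" and "0 < Cg" and "0 < cg"
    and "1 \<le> \<gamma>" and "\<gamma> = 2 / \<sigma>"
    and solution: "ibvp_solution L T \<alpha> f u0 u u_t u_x u_xx"
    and bounded: "\<And>x \<tau>. x \<in> {0..L} \<Longrightarrow> \<tau> \<in> {0<..T} \<Longrightarrow> \<bar>u x \<tau>\<bar> \<le> c0 \<and> \<bar>u_x x \<tau>\<bar> \<le> c0"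
    and time_derivatives:
      "time_derivative L T u_xx u_xx'" "time_derivative L T u_xx' u_xx''"
      "time_derivative L T f f'" "time_derivative L T f' f''"
    and space_grid: "\<And>i. 0 < J i" "\<And>i. h i = L / real (J i)"
    and time_mesh: "\<And>i. 0 < k i" "\<And>i. graded_mesh T Cg cg \<gamma> (k i) (N i) (t i)"
    and smooth: "\<And>i n. n \<le> N i \<Longrightarrow> C_class_on 4 {0..L} (\<lambda>x. u x (t i n))"
    and truncation: "\<And>i. trunc2_bound CR (h i) (J i) (N i) \<alpha> (t i) f (fh i) u u_xx"
    and source: "\<And>i. source_approx Cf (h i) (J i) (N i) (t i) f f' f'' (fh i)"
    and regular_u: "\<And>i. regularity_bound M \<sigma> T (h i) (J i) u_xx' u_xx''"
    and regular_f: "\<And>i. regularity_bound M \<sigma> T (h i) (J i) f' f''"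
    and step_ratio: "k \<in> o[filtercomap h (at_right 0)](\<lambda>i. h i powr (1 / 2))"
  shows "\<exists>h0>0. \<forall>i. h i < h0 \<longrightarrow>
           scheme_uniquely_solvable (h i) (J i) (N i) \<alpha> (t i) u0 (fh i)"
proof -
  have disc: "burgers_discretization L T \<alpha> \<gamma> \<sigma> M c0 Cg cg Cf CR f f' f'' u u_t u_x u_xx u_xx' u_xx'' u0
      (J i) (N i) (h i) (k i) (t i) (fh i)" for i
    by unfold_locales fact+
  interpret family: burgers_discretization L T \<alpha> \<gamma> \<sigma> M c0 Cg cg Cf CR f f' f'' u u_t u_x u_xx u_xx' u_xx'' u0
      "J i" "N i" "h i" "k i" "t i" "fh i" for i
    by (rule disc)
  let ?B = "family.error_bound"
  let ?K = "(c0 + 1)\<^sup>2 * Gamma (\<alpha> + 2)"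
  have B: "0 \<le> ?B" by (rule family.error_bound_nonneg)
  have c0: "0 \<le> c0" by (rule family.c0_nonneg)
  have K: "0 < ?K" using c0 Gamma_real_pos[of "\<alpha> + 2"] \<open>0 < \<alpha>\<close> by simp
  \<comment> \<open>Time steps up to \<open>\<kappa>\<close> satisfy the smoothing condition of \<open>uniquely_solvable\<close>.\<close>
  define \<kappa> where "\<kappa> = (1 / ?K) powr (1 / (1 - \<alpha>))"
  have \<kappa>: "0 < \<kappa>" "\<kappa> powr (1 - \<alpha>) = 1 / ?K"
    using K c0 Gamma_nonzero[of "\<alpha> + 2"] \<open>0 < \<alpha>\<close> \<open>\<alpha> < 1\<close> by (simp_all add: \<kappa>_def powr_powr)
  \<comment> \<open>A ratio \<open>k \<le> c h\<^sup>1\<^sup>/\<^sup>2\<close> with this \<open>c\<close> bounds \<open>?B k\<close> by half of \<open>h\<^sup>1\<^sup>/\<^sup>2\<close>, and gives the two other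
    smallness conditions since \<open>h \<le> 1\<close>.\<close>
  define c where "c = Min {1 / (2 * (?B + 1)), 1 / (2 * (c0 + 1) * Cg), \<kappa> / Cg}"
  have c: "0 < c" "c \<le> 1 / (2 * (?B + 1))" "c \<le> 1 / (2 * (c0 + 1) * Cg)" "c \<le> \<kappa> / Cg"
    using B c0 \<kappa>(1) \<open>0 < Cg\<close> by (auto simp: c_def)
  have "eventually (\<lambda>i. norm (k i) \<le> c * norm (h i powr (1 / 2))) (filtercomap h (at_right 0))"
    using landau_o.smallD[OF step_ratio c(1)] .
  then obtain P where P: "eventually P (at_right 0)" "\<And>i. P (h i) \<Longrightarrow> norm (k i) \<le> c * norm (h i powr (1 / 2))"
    unfolding eventually_filtercomap by blast
  then obtain b where b: "0 < b" "\<And>x. 0 < x \<Longrightarrow> x < b \<Longrightarrow> P x"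
    unfolding eventually_at_right_field by blast
  define h0 where "h0 = Min {b, 1, 1 / (2 * (?B + 1))}"
  have h0: "0 < h0" "h0 \<le> b" "h0 \<le> 1" "h0 \<le> 1 / (2 * (?B + 1))"
    using b(1) B unfolding h0_def by (auto intro: Min_le simp del: Min_insert Min.insert simp: Min_gr_iff)
  show ?thesis
  proof (intro exI conjI allI impI)
    fix i assume hi: "h i < h0"
    have hp: "0 < h i" by (rule family.h)
    have kp: "0 < k i" by (rule time_mesh)
    have h1: "h i \<le> 1" using hi h0 by linarith
    have sq1: "sqrt (h i) \<le> 1" using h1 by simp
    have ks: "k i \<le> c * sqrt (h i)"
      using P(2)[OF b(2)[OF hp]] hi h0 kp by (simp add: powr_half_sqrt hp less_imp_le)
    also have "\<dots> \<le> c * 1" using c(1) sq1 by (intro mult_left_mono) auto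
    finally have kc: "k i \<le> c" by simp
    have hs: "h i \<le> sqrt (h i)"
      using hp h1 by (intro real_le_rsqrt) (simp add: power2_eq_square mult_le_one mult_left_le)
    show "scheme_uniquely_solvable (h i) (J i) (N i) \<alpha> (t i) u0 (fh i)"
    proof (rule family.uniquely_solvable)
      have "2 * (c0 + 1) * Cg * k i \<le> 2 * (c0 + 1) * Cg * (1 / (2 * (c0 + 1) * Cg))"
        using kc c(3) c0 \<open>0 < Cg\<close> by (intro mult_left_mono) auto
      also have "\<dots> = 1" using c0 \<open>0 < Cg\<close> by simp
      finally show "2 * c0 * (Cg * k i) \<le> 1" using kp \<open>0 < Cg\<close> by (simp add: algebra_simps) (smt (verit) mult_pos_pos)
      have Bc: "?B * c \<le> 1 / 2" "?B * h0 \<le> 1 / 2"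
      proof -
        have "?B * x \<le> 1 / 2" if "x \<le> 1 / (2 * (?B + 1))" for x
        proof -
          have "?B * x \<le> ?B * (1 / (2 * (?B + 1)))" using that B by (intro mult_left_mono)
          also have "\<dots> \<le> 1 / 2" using B by (simp add: field_simps)
          finally show ?thesis .
        qed
        then show "?B * c \<le> 1 / 2" "?B * h0 \<le> 1 / 2" using c h0 by blast+
      qed
      have "?B * k i \<le> ?B * (c * sqrt (h i))" using ks B by (rule mult_left_mono)
      also have "\<dots> \<le> 1 / 2 * sqrt (h i)" using Bc(1) hp by (simp add: mult.assoc[symmetric] mult_right_mono)
      finally have "?B * k i \<le> 1 / 2 * sqrt (h i)" .
      moreover have "?B * (h i)\<^sup>2 \<le> 1 / 2 * sqrt (h i)"
      proof -
        have "?B * (h i)\<^sup>2 \<le> (?B * h0) * sqrt (h i)"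
          unfolding power2_eq_square mult.assoc[symmetric] using hi hs hp B h0 by (intro mult_mono mult_left_mono) auto
        also have "\<dots> \<le> 1 / 2 * sqrt (h i)" using Bc(2) hp by (intro mult_right_mono) auto
        finally show ?thesis .
      qed
      ultimately show "?B * (k i + (h i)\<^sup>2) \<le> sqrt (h i)" by (simp add: distrib_left)
      have "Cg * k i \<le> \<kappa>"
      proof -
        have "Cg * k i \<le> Cg * (\<kappa> / Cg)" using kc c(4) \<open>0 < Cg\<close> by (intro mult_left_mono) auto
        then show ?thesis using \<open>0 < Cg\<close> by simp
      qed
      then have "(Cg * k i) powr (1 - \<alpha>) \<le> 1 / ?K"
        unfolding \<kappa>(2)[symmetric] using kp \<open>0 < Cg\<close> \<open>\<alpha> < 1\<close> by (intro powr_mono2) auto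
      then have "?K * (Cg * k i) powr (1 - \<alpha>) \<le> ?K * (1 / ?K)" using K by (intro mult_left_mono) auto
      also have "\<dots> = 1" using c0 Gamma_nonzero[of "\<alpha> + 2"] \<open>0 < \<alpha>\<close> by simp
      finally show "?K * (Cg * k i) powr (1 - \<alpha>) < 4" by simp
    qed
  qed (rule h0(1))
qed

end
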